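(* Let $P\subset\mathbb{R}^d$ be a full-dimensional convex polytope with $0\in\operatorname{int}(P)$. Then the (linear) orbit coloring $\mathfrak{o}$ of the edge-graph $G_P$ captures the linear symmetries of $P$; that is, the natural homomorphism $\phi^{\mathfrak{o}}\colon \operatorname{Aut}_{\mathrm{GL}}(P)\to\operatorname{Aut}(G_P^{\mathfrak{o}})$, $T\mapsto\sigma_T$, is well-defined and is a group isomorphism.
   Context: A polytope is the convex hull of finitely many points; $P\subset\mathbb{R}^d$ is full-dimensional (not contained in a proper affine subspace) with $0\in\operatorname{int}(P)$. Its vertices are enumerated $v_1,\dots,v_n$. The edge-graph $G_P=(V,E)$ is the simple graph with $V=\{1,\dots,n\}$ and $ij\in E$ iff $\operatorname{conv}\{v_i,v_j\}$ is an edge (1-dimensional face) of $P$. $\operatorname{Aut}_{\mathrm{GL}}(P):=\{T\in\mathrm{GL}(\mathbb{R}^d)\mid TP=P\}$. $\operatorname{Aut}(G_P)$ is the group of permutations $\sigma$ of $V$ with $ij\in E\Leftrightarrow\sigma(i)\sigma(j)\in E$. Each $T\in\operatorname{Aut}_{\mathrm{GL}}(P)$ induces $\sigma_T\in\operatorname{Aut}(G_P)$ by $Tv_i=v_{\sigma_T(i)}$ for all $i\in V$. A coloring of $G_P$ is a map $\mathfrak{c}\colon V\,\dot\cup\,E\to\mathfrak{C}$ to a set $\mathfrak{C}$; $G_P^{\mathfrak{c}}$ denotes the colored graph, and $\operatorname{Aut}(G_P^{\mathfrak{c}})$ is the group of all $\sigma\in\operatorname{Aut}(G_P)$ with $\mathfrak{c}(i)=\mathfrak{c}(\sigma(i))$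 for all $i\in V$ and $\mathfrak{c}(ij)=\mathfrak{c}(\sigma(i)\sigma(j))$ for all $ij\in E$. The natural homomorphism is $\phi^{\mathfrak{c}}\colon\operatorname{Aut}_{\mathrm{GL}}(P)\to\operatorname{Aut}(G_P^{\mathfrak{c}})$, $T\mapsto\sigma_T$; it is well-defined iff $\sigma_T\in\operatorname{Aut}(G_P^{\mathfrak{c}})$ for every $T\in\operatorname{Aut}_{\mathrm{GL}}(P)$. The coloring $\mathfrak{c}$ captures the linear symmetries of $P$ if $\phi^{\mathfrak{c}}$ is well-defined and an isomorphism. The (linear) orbit coloring $\mathfrak{o}$ of $G_P$ assigns the same color to two vertices (resp. two edges) of $G_P$ if and only if the corresponding vertices (resp. edges) of $P$ lie in the same $\operatorname{Aut}_{\mathrm{GL}}(P)$-orbit. *)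

theory Defs
  imports "HOL-Analysis.Analysis" "HOL-Algebra.Group_Action"
begin

text \<open>Simple graphs are pairs of a vertex set and a set of two-element sets of vertices.\<close>

type_synonym 'v graph = "'v set \<times> 'v set set"

text \<open>A coloring of \<open>(V, E)\<close> is a map on the disjoint union of \<open>V\<close> (left summand) and \<open>E\<close>
  (right summand). Values outside \<open>V\<close> and \<open>E\<close> are irrelevant.\<close>

type_synonym ('v, 'c) coloring = "'v + 'v set \<Rightarrow> 'c"

definition graph_Aut :: "'v graph \<Rightarrow> ('v \<Rightarrow> 'v) monoid" where
  "graph_Aut G =
    \<lparr>carrier = {\<sigma>. \<sigma> permutes fst G \<and>
        (\<forall>i\<in>fst G. \<forall>j\<in>fst G. {i, j} \<in> snd G \<longleftrightarrow> {\<sigma> i, \<sigma> j} \<in> snd G)},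
     mult = (\<circ>), one = id\<rparr>"

definition colored_graph_Aut :: "'v graph \<Rightarrow> ('v, 'c) coloring \<Rightarrow> ('v \<Rightarrow> 'v) monoid" where
  "colored_graph_Aut G c = graph_Aut G
    \<lparr>carrier := {\<sigma> \<in> carrier (graph_Aut G).
        (\<forall>i\<in>fst G. c (Inl i) = c (Inl (\<sigma> i))) \<and>
        (\<forall>e\<in>snd G. c (Inr e) = c (Inr (\<sigma> ` e)))}\<rparr>"

definition Aut_GL :: "(real ^ 'd) set \<Rightarrow> (real ^ 'd \<Rightarrow> real ^ 'd) monoid" where
  "Aut_GL P = \<lparr>carrier = {T. linear T \<and> bij T \<and> T ` P = P}, mult = (\<circ>), one = id\<rparr>"

text \<open>In the following, \<open>v\<close> enumerates the vertices of \<open>P\<close> as \<open>v 1, \<dots>, v n\<close>.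
  The relation \<open>edge_of\<close> demands affine dimension 1, so it excludes \<open>i = j\<close>.\<close>

definition edge_graph :: "(real ^ 'd) set \<Rightarrow> (nat \<Rightarrow> real ^ 'd) \<Rightarrow> nat \<Rightarrow> nat graph" where
  "edge_graph P v n =
    ({1..n}, {{i, j} | i j. i \<in> {1..n} \<and> j \<in> {1..n} \<and> convex hull {v i, v j} edge_of P})"

text \<open>The permutation \<open>\<sigma>\<^sub>T\<close> with \<open>T (v i) = v (\<sigma>\<^sub>T i)\<close>, extended by the identity outside
  \<open>{1..n}\<close> as required by \<open>permutes\<close>.\<close>

definition vertex_perm ::
    "(nat \<Rightarrow> real ^ 'd) \<Rightarrow> nat \<Rightarrow> (real ^ 'd \<Rightarrow> real ^ 'd) \<Rightarrow> nat \<Rightarrow> nat" where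
  "vertex_perm v n T =
    (\<lambda>i. if i \<in> {1..n} then THE j. j \<in> {1..n} \<and> T (v i) = v j else i)"

text \<open>The first conjunct is well-definedness of \<open>T \<mapsto> \<sigma>\<^sub>T\<close> as a map into the automorphism group
  of the colored graph.\<close>

definition captures_linear_symmetries ::
    "(real ^ 'd) set \<Rightarrow> (nat \<Rightarrow> real ^ 'd) \<Rightarrow> nat \<Rightarrow> (nat, 'c) coloring \<Rightarrow> bool" where
  "captures_linear_symmetries P v n c \<longleftrightarrow>
    (\<forall>T\<in>carrier (Aut_GL P).
       vertex_perm v n T \<in> carrier (colored_graph_Aut (edge_graph P v n) c)) \<and>
    vertex_perm v n \<in> iso (Aut_GL P) (colored_graph_Aut (edge_graph P v n) c)"

text \<open>Orbit colorings are determined only up to renaming of colors, and no relation between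
  vertex colors and edge colors is prescribed. The edge of \<open>P\<close> corresponding to \<open>e = {i, j}\<close>
  is \<open>convex hull (v ` e)\<close>.\<close>

definition is_orbit_coloring ::
    "(real ^ 'd) set \<Rightarrow> (nat \<Rightarrow> real ^ 'd) \<Rightarrow> nat \<Rightarrow> (nat, 'c) coloring \<Rightarrow> bool" where
  "is_orbit_coloring P v n c \<longleftrightarrow>
    (\<forall>i\<in>fst (edge_graph P v n). \<forall>j\<in>fst (edge_graph P v n).
       c (Inl i) = c (Inl j) \<longleftrightarrow> v j \<in> orbit (Aut_GL P) (\<lambda>T. T) (v i)) \<and>
    (\<forall>e\<in>snd (edge_graph P v n). \<forall>e'\<in>snd (edge_graph P v n).
       c (Inr e) = c (Inr e') \<longleftrightarrow>
         convex hull (v ` e') \<in> orbit (Aut_GL P) (`) (convex hull (v ` e)))"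

lemma group_Aut_GL: "group (Aut_GL P)"
proof (rule groupI)
  fix T assume T: "T \<in> carrier (Aut_GL P)"
  then have lin: "linear T" and bij: "bij T" and im: "T ` P = P"
    by (auto simp: Aut_GL_def)
  let ?S = "inv_into UNIV T"
  have "linear ?S"
    using lin bij by (simp add: bij_is_inj bij_is_surj inj_linear_imp_inv_linear)
  moreover have "?S ` P = P"
    using bij im by (metis bij_is_inj image_inv_f_f)
  ultimately have "?S \<in> carrier (Aut_GL P)"
    using bij by (simp add: Aut_GL_def bij_imp_bij_inv)
  moreover have "?S \<circ> T = id"
    using bij by (simp add: bij_is_inj)
  ultimately show "\<exists>S\<in>carrier (Aut_GL P). S \<otimes>\<^bsub>Aut_GL P\<^esub> T = \<one>\<^bsub>Aut_GL P\<^esub>"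
    by (auto simp: Aut_GL_def)
next
  fix S T assume "S \<in> carrier (Aut_GL P)" "T \<in> carrier (Aut_GL P)"
  then have "linear S" "bij S" "S ` P = P" "linear T" "bij T" "T ` P = P"
    by (simp_all add: Aut_GL_def)
  then have "linear (S \<circ> T)" "bij (S \<circ> T)" "(S \<circ> T) ` P = P"
    by (simp_all only: linear_compose bij_comp image_comp[symmetric])
  then show "S \<otimes>\<^bsub>Aut_GL P\<^esub> T \<in> carrier (Aut_GL P)" by (simp add: Aut_GL_def)
qed (simp_all add: Aut_GL_def comp_assoc linear_id)

lemma colored_graph_Aut_iff:
  "\<sigma> \<in> carrier (colored_graph_Aut G c) \<longleftrightarrow> \<sigma> permutes fst G \<and>
    (\<forall>i\<in>fst G. \<forall>j\<in>fst G. {i, j} \<in> snd G \<longleftrightarrow> {\<sigma> i, \<sigma> j} \<in> snd G) \<and>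
    (\<forall>i\<in>fst G. c (Inl i) = c (Inl (\<sigma> i))) \<and>
    (\<forall>e\<in>snd G. c (Inr e) = c (Inr (\<sigma> ` e)))"
  unfolding colored_graph_Aut_def graph_Aut_def
  by (simp only: monoid.simps partial_object.simps mem_Collect_eq conj_assoc)

lemma colored_graph_Aut_ops:
  "monoid.mult (colored_graph_Aut G c) = (\<circ>)" "one (colored_graph_Aut G c) = id"
  by (simp_all add: colored_graph_Aut_def graph_Aut_def)

lemma group_colored_graph_Aut:
  assumes E: "\<And>e. e \<in> snd G \<Longrightarrow> \<exists>i\<in>fst G. \<exists>j\<in>fst G. e = {i, j}"
  shows "group (colored_graph_Aut G c)"
proof (rule groupI)
  fix \<sigma> assume S: "\<sigma> \<in> carrier (colored_graph_Aut G c)"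
  then have p: "\<sigma> permutes fst G"
    and e: "\<And>i j. i \<in> fst G \<Longrightarrow> j \<in> fst G \<Longrightarrow> {i, j} \<in> snd G \<longleftrightarrow> {\<sigma> i, \<sigma> j} \<in> snd G"
    and cv: "\<And>i. i \<in> fst G \<Longrightarrow> c (Inl i) = c (Inl (\<sigma> i))"
    and ce: "\<And>e. e \<in> snd G \<Longrightarrow> c (Inr e) = c (Inr (\<sigma> ` e))"
    unfolding colored_graph_Aut_iff by blast+
  let ?r = "inv_into UNIV \<sigma>"
  have rp: "?r permutes fst G" by (rule permutes_inv[OF p])
  have sr: "\<sigma> (?r i) = i" for i using p by (simp add: permutes_inverses)
  have re: "{i, j} \<in> snd G \<longleftrightarrow> {?r i, ?r j} \<in> snd G" if "i \<in> fst G" "j \<in> fst G" for i j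
    using e[of "?r i" "?r j"] that rp by (simp add: sr permutes_in_image)
  have rcv: "c (Inl i) = c (Inl (?r i))" if "i \<in> fst G" for i
    using cv[of "?r i"] that rp by (simp add: sr permutes_in_image)
  have rce: "c (Inr e) = c (Inr (?r ` e))" if ee: "e \<in> snd G" for e
  proof -
    from E[OF ee] obtain i j where "i \<in> fst G" "j \<in> fst G" "e = {i, j}" by blast
    then have "?r ` e \<in> snd G" using re[of i j] ee by simp
    from ce[OF this] show ?thesis by (simp add: image_comp o_def sr)
  qed
  have "?r \<in> carrier (colored_graph_Aut G c)"
    unfolding colored_graph_Aut_iff using rp re rcv rce by blast
  moreover have "?r \<circ> \<sigma> = id" using p by (simp add: permutes_inv_o)
  ultimately show "\<exists>\<rho>\<in>carrier (colored_graph_Aut G c).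
      \<rho> \<otimes>\<^bsub>colored_graph_Aut G c\<^esub> \<sigma> = \<one>\<^bsub>colored_graph_Aut G c\<^esub>"
    unfolding colored_graph_Aut_ops by blast
next
  fix \<sigma> \<tau>
  assume S: "\<sigma> \<in> carrier (colored_graph_Aut G c)" and T: "\<tau> \<in> carrier (colored_graph_Aut G c)"
  then have Sp: "\<sigma> permutes fst G" and Tp: "\<tau> permutes fst G"
    and Se: "\<And>i j. i \<in> fst G \<Longrightarrow> j \<in> fst G \<Longrightarrow> {i, j} \<in> snd G \<longleftrightarrow> {\<sigma> i, \<sigma> j} \<in> snd G"
    and Te: "\<And>i j. i \<in> fst G \<Longrightarrow> j \<in> fst G \<Longrightarrow> {i, j} \<in> snd G \<longleftrightarrow> {\<tau> i, \<tau> j} \<in> snd G"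
    and Sv: "\<And>i. i \<in> fst G \<Longrightarrow> c (Inl i) = c (Inl (\<sigma> i))"
    and Tv: "\<And>i. i \<in> fst G \<Longrightarrow> c (Inl i) = c (Inl (\<tau> i))"
    and Sc: "\<And>e. e \<in> snd G \<Longrightarrow> c (Inr e) = c (Inr (\<sigma> ` e))"
    and Tc: "\<And>e. e \<in> snd G \<Longrightarrow> c (Inr e) = c (Inr (\<tau> ` e))"
    unfolding colored_graph_Aut_iff by blast+
  have TV: "\<tau> i \<in> fst G" if "i \<in> fst G" for i
    using permutes_in_image[OF Tp] that by blast
  have "(\<sigma> \<circ> \<tau>) permutes fst G" by (rule permutes_compose[OF Tp Sp])
  moreover have "{i, j} \<in> snd G \<longleftrightarrow> {(\<sigma> \<circ> \<tau>) i, (\<sigma> \<circ> \<tau>) j} \<in> snd G"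
    if "i \<in> fst G" "j \<in> fst G" for i j
    unfolding o_apply using Te[OF that] Se[OF TV TV, OF that] by (rule trans)
  moreover have "c (Inl i) = c (Inl ((\<sigma> \<circ> \<tau>) i))" if "i \<in> fst G" for i
    unfolding o_apply using Tv[OF that] Sv[OF TV, OF that] by (rule trans)
  moreover have "c (Inr e) = c (Inr ((\<sigma> \<circ> \<tau>) ` e))" if ee: "e \<in> snd G" for e
  proof -
    from E[OF ee] obtain i j where ij: "i \<in> fst G" "j \<in> fst G" "e = {i, j}" by blast
    then have "\<tau> ` e \<in> snd G" using Te[OF ij(1,2)] ee by simp
    then show ?thesis unfolding image_comp[symmetric] using Tc[OF ee] Sc by (metis (no_types))
  qed
  ultimately have "\<sigma> \<circ> \<tau> \<in> carrier (colored_graph_Aut G c)"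
    unfolding colored_graph_Aut_iff by blast
  then show "\<sigma> \<otimes>\<^bsub>colored_graph_Aut G c\<^esub> \<tau> \<in> carrier (colored_graph_Aut G c)"
    by (simp only: colored_graph_Aut_ops)
next
  have "id \<in> carrier (colored_graph_Aut G c)"
    by (simp only: colored_graph_Aut_iff permutes_id id_apply image_id simp_thms ball_triv imp_refl ball_simps)
  then show "\<one>\<^bsub>colored_graph_Aut G c\<^esub> \<in> carrier (colored_graph_Aut G c)"
    by (simp only: colored_graph_Aut_ops)
qed (simp_all only: colored_graph_Aut_ops comp_assoc id_comp)

lemma group_colored_edge_graph_Aut: "group (colored_graph_Aut (edge_graph P v n) c)"
proof (rule group_colored_graph_Aut)
  fix e assume "e \<in> snd (edge_graph P v n)"
  then obtain i j where "i \<in> {1..n}" "j \<in> {1..n}" "e = {i, j}"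
    unfolding edge_graph_def snd_conv mem_Collect_eq by (elim exE conjE)
  then show "\<exists>i\<in>fst (edge_graph P v n). \<exists>j\<in>fst (edge_graph P v n). e = {i, j}"
    unfolding edge_graph_def fst_conv by (intro bexI)
qed

lemma vertex_perm_eq:
  assumes v: "bij_betw v {1..n} {x. x extreme_point_of P}"
    and T: "T \<in> carrier (Aut_GL P)" and i: "i \<in> {1..n}"
  shows "vertex_perm v n T i \<in> {1..n}" and "T (v i) = v (vertex_perm v n T i)"
proof -
  have lin: "linear T" and bij: "bij T" and im: "T ` P = P"
    using T by (auto simp: Aut_GL_def)
  have "v i extreme_point_of P" using bij_betwE[OF v] i by blast
  then have "{v i} face_of P" by (simp add: face_of_singleton)
  then have "T ` {v i} face_of T ` P"
    by (simp only: face_of_linear_image[OF lin bij_is_inj[OF bij]])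
  then have "T (v i) extreme_point_of P" by (simp add: im face_of_singleton)
  then obtain j where j: "j \<in> {1..n}" "T (v i) = v j"
    unfolding mem_Collect_eq[of "T (v i)" "\<lambda>x. x extreme_point_of P", symmetric]
      bij_betw_imp_surj_on[OF v, symmetric] by (elim imageE)
  have "(THE j. j \<in> {1..n} \<and> T (v i) = v j) = j"
    using j bij_betw_imp_inj_on[OF v] by (intro the_equality) (simp_all only: inj_on_eq_iff simp_thms)
  then show "vertex_perm v n T i \<in> {1..n}" "T (v i) = v (vertex_perm v n T i)"
    using i j by (simp_all only: vertex_perm_def if_True)
qed

lemma orbit_eq_iff:
  fixes act :: "(real ^ 'd \<Rightarrow> real ^ 'd) \<Rightarrow> 'x \<Rightarrow> 'x"
  assumes id: "\<And>x. act id x = x" and comp: "\<And>S T x. act (S \<circ> T) x = act S (act T x)"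
  shows "orbit (Aut_GL P) act x = orbit (Aut_GL P) act y \<longleftrightarrow> y \<in> orbit (Aut_GL P) act x"
proof -
  interpret group "Aut_GL P" by (rule group_Aut_GL)
  have self: "y \<in> orbit (Aut_GL P) act y"
    using one_closed id[of y] by (force simp: orbit_def Aut_GL_def)
  have sub: "orbit (Aut_GL P) act b \<subseteq> orbit (Aut_GL P) act a"
    if "b \<in> orbit (Aut_GL P) act a" for a b
  proof
    fix z assume "z \<in> orbit (Aut_GL P) act b"
    then obtain S where S: "S \<in> carrier (Aut_GL P)" "z = act S b" by (auto simp: orbit_def)
    from that obtain T where T: "T \<in> carrier (Aut_GL P)" "b = act T a" by (auto simp: orbit_def)
    have "S \<circ> T \<in> carrier (Aut_GL P)" using m_closed[OF S(1) T(1)] by (simp add: Aut_GL_def)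
    then show "z \<in> orbit (Aut_GL P) act a" using S T comp[of S T a, symmetric] by (auto simp: orbit_def)
  qed
  have sym: "x \<in> orbit (Aut_GL P) act y" if "y \<in> orbit (Aut_GL P) act x"
  proof -
    from that obtain T where T: "T \<in> carrier (Aut_GL P)" "y = act T x" by (auto simp: orbit_def)
    obtain S where S: "S \<in> carrier (Aut_GL P)" "S \<otimes>\<^bsub>Aut_GL P\<^esub> T = \<one>\<^bsub>Aut_GL P\<^esub>"
      using T(1) l_inv_ex by blast
    then have "S \<circ> T = id" by (simp add: Aut_GL_def)
    then have "act S y = x" using T(2) comp[of S T x] id by simp
    then show ?thesis using S(1) by (auto simp: orbit_def)
  qed
  show ?thesis using self sub sym by blast
qed

text \<open>Orbit colorings exist: color every vertex and every edge by its orbit.\<close>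

lemma ex_orbit_coloring:
  fixes P :: "(real ^ 'd) set"
  shows
  "\<exists>c :: (nat, (real ^ 'd) set + (real ^ 'd) set set) coloring. is_orbit_coloring P v n c"
proof
  have "orbit (Aut_GL P) (\<lambda>T. T) x = orbit (Aut_GL P) (\<lambda>T. T) y \<longleftrightarrow>
      y \<in> orbit (Aut_GL P) (\<lambda>T. T) x" for x y
    by (rule orbit_eq_iff) auto
  moreover have "orbit (Aut_GL P) (`) F = orbit (Aut_GL P) (`) F' \<longleftrightarrow>
      F' \<in> orbit (Aut_GL P) (`) F" for F F'
    by (rule orbit_eq_iff) auto
  ultimately show "is_orbit_coloring P v n
      (case_sum (\<lambda>i. Inl (orbit (Aut_GL P) (\<lambda>T. T) (v i)))
        (\<lambda>e. Inr (orbit (Aut_GL P) (`) (convex hull (v ` e)))))"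
    by (simp add: is_orbit_coloring_def)
qed

end

theory Submission
  imports Defs
begin

text \<open>After a change of coordinates the finite group of linear automorphisms of \<open>P\<close> is orthogonal.
  Let \<open>K\<close> be the polar of \<open>P\<close>: its facets correspond to the vertices of \<open>P\<close> and its ridges to the
  edges. The second derivative \<open>M\<close> of the volume of \<open>K\<close> with respect to its support numbers
  (Izmestiev's matrix) is symmetric, supported on the diagonal and the edges, invariant under linear
  automorphisms, and its kernel consists precisely of the linear functionals restricted to the
  vertices. A permutation preserving the orbit coloring preserves every entry of \<open>M\<close>, hence the
  kernel, and therefore extends to a linear map.

  The kernel is determined by the infinitesimal Minkowski inequality: the second variation of volume
  is negative semidefinite on the complement of the vector of facet volumes, and only linear
  functionals are degenerate. This is shown for all faces of \<open>K\<close> by induction on the dimension, with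
  the Bochner method of Shenfeld and van Handel: the inequality for the facets forces every
  eigenvalue \<open>l\<close> of a normalized second variation to satisfy \<open>l \<le> l\<^sup>2\<close>, while connectedness of the
  facet adjacency gives \<open>l < 1\<close> away from the top eigenvector. Since \<open>K\<close> need not be simple, the Bochner
  formula has an error term at every face of codimension three; these terms are nonnegative.\<close>

section \<open>Outer normals of facets\<close>

text \<open>Neither measure nor differentiation enters: volume is the recursive number
  \<open>vol\<close>, and the second derivative is defined directly as the bilinear
  \<open>form\<close>. Moving the facets of a polytope that is not simple can change its face
  lattice; working only with the lattice of the original polytope avoids following the deformed
  ones. Identities become finite sums over flags and are mostly proved by exchanging the two facets
  at a ridge: the orthonormal frames of normals then differ by a reflection, so determinants change
  sign while inner products persist. Normals are taken inside the affine hull of each face, so the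
  induction over the dimension stays in one ambient space. It starts with polygons, which have no
  faces of codimension three; segments are treated by hand. Normals and volumes are metric notions,
  which is why the automorphisms must become orthogonal before the matrix can be invariant under
  them. The coloring supplies a separate automorphism for each vertex and each edge; the matrix
  compares entries one at a time and so merges this local information into a single linear
  map.\<close>

definition dir :: "'a::euclidean_space set \<Rightarrow> 'a set" where
  "dir F = span {x - y | x y. x \<in> F \<and> y \<in> F}"

definition is_nrm :: "'a::euclidean_space set \<Rightarrow> 'a set \<Rightarrow> 'a \<Rightarrow> bool" where
  "is_nrm F G u \<longleftrightarrow> norm u = 1 \<and> u \<in> dir F \<and>
     (\<exists>b. (\<forall>x\<in>F. u \<bullet> x \<le> b) \<and> G = F \<inter> {x. u \<bullet> x = b})"

definition nrm :: "'a::euclidean_space set \<Rightarrow> 'a set \<Rightarrow> 'a" where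
  "nrm F G = (SOME u. is_nrm F G u)"

lemma subspace_dir [simp]: "subspace (dir F)"
  by (simp add: dir_def)

lemma diff_in_dir: "x \<in> F \<Longrightarrow> y \<in> F \<Longrightarrow> x - y \<in> dir F"
  unfolding dir_def by (rule span_base) blast

lemma dir_mono: "F \<subseteq> G \<Longrightarrow> dir F \<subseteq> dir G"
  unfolding dir_def by (rule span_mono) blast

lemma dir_eq_span:
  assumes "a \<in> F" shows "dir F = span ((\<lambda>x. x - a) ` F)"
proof
  show "dir F \<subseteq> span ((\<lambda>x. x - a) ` F)"
    unfolding dir_def
  proof (rule span_minimal)
    show "{x - y |x y. x \<in> F \<and> y \<in> F} \<subseteq> span ((\<lambda>x. x - a) ` F)"
    proof clarify
      fix x y assume "x \<in> F" "y \<in> F"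
      then have "(x - a) - (y - a) \<in> span ((\<lambda>x. x - a) ` F)"
        by (intro span_diff span_base) auto
      then show "x - y \<in> span ((\<lambda>x. x - a) ` F)" by simp
    qed
  qed simp
  show "span ((\<lambda>x. x - a) ` F) \<subseteq> dir F"
    unfolding dir_def using assms by (intro span_mono) blast
qed

lemma dim_dir: "F \<noteq> {} \<Longrightarrow> int (dim (dir F)) = aff_dim F"
proof -
  assume "F \<noteq> {}" then obtain a where a: "a \<in> F" by blast
  have "aff_dim F = int (dim ((\<lambda>x. -a + x) ` F))"
    using aff_dim_eq_dim[of a F] a by (simp add: hull_inc)
  then show ?thesis using dir_eq_span[OF a] by (simp add: dim_span)
qed

lemma affine_hull_dir:
  assumes "a \<in> affine hull F" shows "x \<in> affine hull F \<longleftrightarrow> x - a \<in> dir F"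
proof -
  have "F \<noteq> {}" using assms by auto
  then obtain b where b: "b \<in> F" by blast
  have *: "affine hull F = (\<lambda>x. b + x) ` dir F"
    using affine_hull_span_gen[of b F] b dir_eq_span[OF b] by (simp add: hull_inc)
  have iff: "y \<in> affine hull F \<longleftrightarrow> y - b \<in> dir F" for y
    unfolding * by (auto simp: image_iff) (metis add_diff_cancel_left' add.commute diff_add_cancel)
  have ab: "a - b \<in> dir F" using assms iff by blast
  have "x - a \<in> dir F \<longleftrightarrow> x - b \<in> dir F"
    using ab subspace_add[OF subspace_dir, of "x - a" F "a - b"] subspace_diff[OF subspace_dir, of "x - b" F "a - b"]
    by auto
  then show ?thesis using iff by blast
qed

text \<open>Faces of a polytope are exposed, and the exposing functional can be chosen parallel to
  the affine hull of \<open>F\<close>; it only has to be scaled to length one.\<close>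

lemma is_nrm_exists:
  assumes F: "polytope F" and G: "G facet_of F"
  shows "\<exists>u. is_nrm F G u"
proof -
  have Gf: "G face_of F" and Gn: "G \<noteq> {}" and dimG: "aff_dim G = aff_dim F - 1"
    using G by (auto simp: facet_of_def)
  have "G exposed_face_of F"
    using exposed_face_of_polyhedron[OF polytope_imp_polyhedron[OF F]] Gf by blast
  moreover have GF: "G \<noteq> F" using dimG by auto
  ultimately obtain a b where ab: "F \<subseteq> {x. a \<bullet> x \<le> b}" "G = F \<inter> {x. a \<bullet> x = b}" "a \<noteq> 0"
      "\<And>w. w \<in> affine hull F \<Longrightarrow> w + a \<in> affine hull F"
    using Gn unfolding exposed_face_of_parallel by auto
  obtain g where g: "g \<in> G" using Gn by blast
  then have "g \<in> F" using face_of_imp_subset[OF Gf] by blast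
  then have gF: "g \<in> affine hull F" by (rule hull_inc)
  have "a \<in> dir F" using affine_hull_dir[OF gF, of "g + a"] ab(4)[OF gF] by simp
  then have "a /\<^sub>R norm a \<in> dir F" by (rule subspace_scale[OF subspace_dir])
  moreover have "norm (a /\<^sub>R norm a) = 1" using ab(3) by simp
  moreover have "(a /\<^sub>R norm a) \<bullet> x \<le> b / norm a \<longleftrightarrow> a \<bullet> x \<le> b"
      "(a /\<^sub>R norm a) \<bullet> x = b / norm a \<longleftrightarrow> a \<bullet> x = b" for x
    using ab(3) by (simp_all add: divide_simps)
  ultimately have "is_nrm F G (a /\<^sub>R norm a)"
    unfolding is_nrm_def using ab(1,2) by (intro conjI exI[of _ "b / norm a"]) auto
  then show ?thesis by blast
qed

lemma is_nrm_nrm: "polytope F \<Longrightarrow> G facet_of F \<Longrightarrow> is_nrm F G (nrm F G)"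
  unfolding nrm_def using is_nrm_exists by (rule someI_ex)

lemma is_nrm_le: "is_nrm F G u \<Longrightarrow> x \<in> F \<Longrightarrow> g \<in> G \<Longrightarrow> u \<bullet> x \<le> u \<bullet> g"
  unfolding is_nrm_def by auto

lemma is_nrm_eq_iff: "is_nrm F G u \<Longrightarrow> x \<in> F \<Longrightarrow> g \<in> G \<Longrightarrow> u \<bullet> x = u \<bullet> g \<longleftrightarrow> x \<in> G"
  unfolding is_nrm_def by auto

lemma is_nrm_orth:
  assumes "is_nrm F G u" "w \<in> dir G" shows "u \<bullet> w = 0"
proof -
  have "dir G \<subseteq> {w. u \<bullet> w = 0}" unfolding dir_def
    using assms(1) by (intro span_minimal) (auto simp: is_nrm_def inner_diff_right subspace_hyperplane)
  then show ?thesis using assms(2) by blast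
qed

text \<open>The vectors of \<open>dir F\<close> orthogonal to \<open>u\<close> form a subspace that
  contains \<open>dir G\<close>; both have dimension one less than \<open>dir F\<close>, so they
  coincide.\<close>

lemma is_nrm_decomp:
  assumes u: "is_nrm F G u" and G: "G facet_of F" and w: "w \<in> dir F" "u \<bullet> w = 0"
  shows "w \<in> dir G"
proof -
  let ?H = "{w \<in> dir F. u \<bullet> w = 0}"
  have Gn: "G \<noteq> {}" "F \<noteq> {}" and dimG: "aff_dim G = aff_dim F - 1" and GF: "G \<subseteq> F"
    using G facet_of_imp_subset by (auto simp: facet_of_def)
  have H: "subspace ?H" unfolding subspace_def by (auto simp: inner_add_right subspace_add subspace_scale subspace_0)
  have "u \<in> dir F" "u \<notin> ?H" using u by (auto simp: is_nrm_def)
  then have "?H \<subset> dir F" by blast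
  moreover have "span ?H = ?H" "span (dir F) = dir F" using H by (simp_all add: span_eq_iff)
  ultimately have "span ?H \<subset> span (dir F)" by (simp only:)
  then have "dim ?H < dim (dir F)" by (rule dim_psubset)
  then have "dim ?H \<le> dim (dir G)" using dim_dir[OF Gn(1)] dim_dir[OF Gn(2)] dimG by linarith
  moreover have "dir G \<subseteq> ?H" using dir_mono[OF GF] is_nrm_orth[OF u] by blast
  ultimately have "dir G = ?H" using subspace_dim_equal H by (metis subspace_dir)
  then show ?thesis using w by blast
qed

text \<open>The part of \<open>u'\<close> orthogonal to \<open>u\<close> lies in
  \<open>dir G\<close>, hence is orthogonal to both normals and vanishes. A point of
  \<open>F\<close> outside \<open>G\<close> excludes the opposite sign.\<close>

lemma is_nrm_unique:
  assumes G: "G facet_of F" and u: "is_nrm F G u" and u': "is_nrm F G u'"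
  shows "u = u'"
proof -
  have nn: "norm u = 1" "norm u' = 1" "u \<in> dir F" "u' \<in> dir F" using u u' by (auto simp: is_nrm_def)
  let ?w = "u' - (u \<bullet> u') *\<^sub>R u"
  have "?w \<in> dir F" using nn by (simp add: subspace_diff subspace_scale)
  moreover have "u \<bullet> ?w = 0" using nn by (simp add: inner_diff_right dot_square_norm)
  ultimately have "?w \<in> dir G" using is_nrm_decomp[OF u G] by blast
  then have "u' \<bullet> ?w = 0" "u \<bullet> ?w = 0" using is_nrm_orth u u' by blast+
  then have "?w \<bullet> ?w = 0" by (simp add: inner_diff_left)
  then have eq: "u' = (u \<bullet> u') *\<^sub>R u" by simp
  then have "norm u' = \<bar>u \<bullet> u'\<bar> * norm u" by (metis norm_scaleR)
  then have abs: "\<bar>u \<bullet> u'\<bar> = 1" using nn by simp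
  obtain g where g: "g \<in> G" using G by (auto simp: facet_of_def)
  have "G \<noteq> F" "G \<subseteq> F" using G facet_of_imp_subset by (auto simp: facet_of_def)
  then obtain x where x: "x \<in> F" "x \<notin> G" by blast
  have "u \<bullet> x < u \<bullet> g" "u' \<bullet> x < u' \<bullet> g"
    using x g is_nrm_le is_nrm_eq_iff u u' by (metis order_le_less)+
  then have "u' \<noteq> - u" by auto
  moreover have "u \<bullet> u' = 1 \<or> u \<bullet> u' = -1" using abs by linarith
  ultimately show ?thesis using eq by (metis scaleR_minus1_left scaleR_one)
qed

lemma nrm_eqI: "polytope F \<Longrightarrow> G facet_of F \<Longrightarrow> is_nrm F G u \<Longrightarrow> nrm F G = u"
  using is_nrm_unique is_nrm_nrm by blast

lemma norm_nrm: "polytope F \<Longrightarrow> G facet_of F \<Longrightarrow> norm (nrm F G) = 1"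
  and nrm_in_dir: "polytope F \<Longrightarrow> G facet_of F \<Longrightarrow> nrm F G \<in> dir F"
  using is_nrm_nrm by (auto simp: is_nrm_def)

lemma nrm_self: "polytope F \<Longrightarrow> G facet_of F \<Longrightarrow> nrm F G \<bullet> nrm F G = 1"
  by (simp add: dot_square_norm norm_nrm)

lemmas nrm_le = is_nrm_le[OF is_nrm_nrm]
lemmas nrm_eq_iff = is_nrm_eq_iff[OF is_nrm_nrm]
lemmas nrm_orth = is_nrm_orth[OF is_nrm_nrm]
lemma nrm_decomp: "polytope F \<Longrightarrow> G facet_of F \<Longrightarrow> w \<in> dir F \<Longrightarrow> nrm F G \<bullet> w = 0 \<Longrightarrow> w \<in> dir G"
  using is_nrm_decomp is_nrm_nrm by blast

lemma nrm_less: "polytope F \<Longrightarrow> G facet_of F \<Longrightarrow> x \<in> F \<Longrightarrow> x \<notin> G \<Longrightarrow> g \<in> G \<Longrightarrow> nrm F G \<bullet> x < nrm F G \<bullet> g"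
  using nrm_le nrm_eq_iff by (metis order_le_less)

lemma polytope_facet: "polytope F \<Longrightarrow> G facet_of F \<Longrightarrow> polytope G"
  using face_of_polytope_polytope facet_of_imp_face_of by blast

section \<open>Ridges and the two facets that contain them\<close>

lemma facet_subset_eq:
  assumes "convex F" "G facet_of F" "H facet_of F" "G \<subseteq> H" shows "G = H"
proof (rule ccontr)
  assume ne: "G \<noteq> H"
  have "G face_of H" using assms face_of_subset[of G F H] facet_of_imp_face_of facet_of_imp_subset by blast
  moreover have "convex H" using assms face_of_imp_convex facet_of_imp_face_of by blast
  ultimately have "aff_dim G < aff_dim H" using face_of_aff_dim_lt ne by blast
  then show False using assms by (simp add: facet_of_def)
qed

lemma facet_plane_split:
  assumes F: "polytope F" and G: "G facet_of F" and R: "R facet_of G"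
    and w: "w \<in> dir F" and orth: "\<And>y. y \<in> dir R \<Longrightarrow> w \<bullet> y = 0"
  shows "w = (nrm F G \<bullet> w) *\<^sub>R nrm F G + (nrm G R \<bullet> w) *\<^sub>R nrm G R"
proof -
  let ?u = "nrm F G" and ?n = "nrm G R"
  note PG = polytope_facet[OF F G]
  have GF: "dir G \<subseteq> dir F" using dir_mono facet_of_imp_subset[OF G] by blast
  have n: "?n \<in> dir G" using nrm_in_dir[OF PG R] .
  have un: "?u \<bullet> ?n = 0" using nrm_orth[OF F G n] .
  let ?y = "w - ((?u \<bullet> w) *\<^sub>R ?u + (?n \<bullet> w) *\<^sub>R ?n)"
  have "?y \<in> dir F" using w n GF nrm_in_dir[OF F G] by (intro subspace_diff subspace_add subspace_scale) auto
  moreover have "?u \<bullet> ?y = 0" by (simp add: inner_diff_right inner_add_right un nrm_self[OF F G])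
  ultimately have "?y \<in> dir G" by (rule nrm_decomp[OF F G])
  moreover have "?n \<bullet> ?y = 0" by (simp add: inner_diff_right inner_add_right un inner_commute[of ?n ?u] nrm_self[OF PG R])
  ultimately have yR: "?y \<in> dir R" by (rule nrm_decomp[OF PG R])
  then have yG: "?y \<in> dir G" using dir_mono facet_of_imp_subset[OF R] by blast
  have "?y \<bullet> ?y = w \<bullet> ?y - (?u \<bullet> w) * (?u \<bullet> ?y) - (?n \<bullet> w) * (?n \<bullet> ?y)"
    by (simp add: inner_diff_left inner_add_left)
  also have "\<dots> = 0" using orth[OF yR] nrm_orth[OF F G yG] nrm_orth[OF PG R yR] by simp
  finally show ?thesis by simp
qed

text \<open>Measured from a point of \<open>R\<close>, the functional of \<open>G'\<close>
  restricted to \<open>G\<close> is \<open>s\<close> times the functional of \<open>nrm G R\<close>.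
  It is negative somewhere on \<open>G\<close>, because \<open>G\<close> is not contained in
  \<open>G'\<close>; this forces \<open>s > 0\<close>, and its zero set on \<open>G\<close> is then
  \<open>R\<close>.\<close>

lemma facet_turn:
  assumes F: "polytope F" and G: "G facet_of F" and R: "R facet_of G"
    and G': "G' facet_of F" "R \<subseteq> G'" "G' \<noteq> G"
  obtains s where "s > 0" "s\<^sup>2 + (nrm F G \<bullet> nrm F G')\<^sup>2 = 1"
    "nrm F G' = (nrm F G \<bullet> nrm F G') *\<^sub>R nrm F G + s *\<^sub>R nrm G R" "s = nrm G R \<bullet> nrm F G'"
    "G \<inter> G' = R" "R facet_of G'"
proof -
  let ?u = "nrm F G" and ?n = "nrm G R" and ?u' = "nrm F G'"
  define s where "s = nrm G R \<bullet> nrm F G'"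
  note PG = polytope_facet[OF F G]
  have n: "?n \<in> dir G" using nrm_in_dir[OF PG R] .
  have un: "?u \<bullet> ?n = 0" using nrm_orth[OF F G n] .
  have eq: "?u' = (?u \<bullet> ?u') *\<^sub>R ?u + s *\<^sub>R ?n"
    unfolding s_def
    by (rule facet_plane_split[OF F G R nrm_in_dir[OF F G'(1)]])
       (use nrm_orth[OF F G'(1)] dir_mono[OF G'(2)] in blast)
  have "?u' \<bullet> ?u' = (?u \<bullet> ?u')\<^sup>2 + s\<^sup>2"
  proof -
    have "?u' \<bullet> ?u' = ((?u \<bullet> ?u') *\<^sub>R ?u + s *\<^sub>R ?n) \<bullet> ?u'" using eq by simp
    also have "\<dots> = (?u \<bullet> ?u')\<^sup>2 + s\<^sup>2" by (simp add: inner_add_left s_def power2_eq_square)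
    finally show ?thesis .
  qed
  then have sq: "s\<^sup>2 + (?u \<bullet> ?u')\<^sup>2 = 1" using nrm_self[OF F G'(1)] by simp
  obtain r where r: "r \<in> R" using R by (auto simp: facet_of_def)
  then have rG: "r \<in> G" "r \<in> G'" using G' R facet_of_imp_subset by blast+
  obtain g where g: "g \<in> G" "g \<notin> G'" using facet_subset_eq[OF polytope_imp_convex[OF F] G G'(1)] G'(3) by blast
  have gF: "G \<subseteq> F" using facet_of_imp_subset[OF G] .
  have key: "?u' \<bullet> (x - r) = s * (?n \<bullet> (x - r))" if "x \<in> G" for x
    using nrm_orth[OF F G diff_in_dir[OF that rG(1)]]
    by (subst eq) (simp add: inner_add_left)
  have "?u' \<bullet> g < ?u' \<bullet> r" using nrm_less[OF F G'(1) _ g(2) rG(2)] g gF by blast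
  then have "s * (?n \<bullet> (g - r)) < 0" using key[OF g(1)] by (simp add: inner_diff_right)
  moreover have "?n \<bullet> (g - r) \<le> 0" using nrm_le[OF PG R g(1) r] by (simp add: inner_diff_right)
  ultimately have spos: "s > 0" by (metis mult_less_0_iff not_less)
  have int: "G \<inter> G' = R"
  proof
    show "R \<subseteq> G \<inter> G'" using G' facet_of_imp_subset[OF R] by blast
    show "G \<inter> G' \<subseteq> R"
    proof
      fix x assume x: "x \<in> G \<inter> G'"
      then have "?u' \<bullet> (x - r) = 0" using nrm_orth[OF F G'(1) diff_in_dir] rG by blast
      then have "?n \<bullet> (x - r) = 0" using key[of x] x spos by simp
      then show "x \<in> R" using nrm_eq_iff[OF PG R _ r, of x] x by (simp add: inner_diff_right)
    qed
  qed
  have "R face_of F" using R G face_of_trans facet_of_imp_face_of by blast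
  then have "R face_of G'" using face_of_subset[of R F G'] G' facet_of_imp_subset by blast
  then have "R facet_of G'" using R G G'(1) by (simp add: facet_of_def)
  then show ?thesis using that[OF spos sq eq s_def int] by blast
qed

text \<open>A proper face is the intersection of the facets containing it; if \<open>G\<close> were
  the only one, \<open>R\<close> would equal \<open>G\<close>.\<close>

lemma diamond_exists:
  assumes F: "polytope F" and G: "G facet_of F" and R: "R facet_of G"
  shows "\<exists>G'. G' facet_of F \<and> R \<subseteq> G' \<and> G' \<noteq> G"
proof (rule ccontr)
  assume "\<not> ?thesis"
  then have *: "\<And>H. H facet_of F \<Longrightarrow> R \<subseteq> H \<Longrightarrow> H = G" by blast
  have Rf: "R face_of F" using R G face_of_trans facet_of_imp_face_of by blast
  have "R \<noteq> {}" "R \<noteq> F" "R \<subseteq> G" using R G by (auto simp: facet_of_def face_of_imp_subset)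
  then have "R = \<Inter>{H. H facet_of F \<and> R \<subseteq> H}"
    using face_of_polyhedron[OF polytope_imp_polyhedron[OF F] Rf] by blast
  also have "{H. H facet_of F \<and> R \<subseteq> H} = {G}" using * G facet_of_imp_subset[OF R] by blast
  finally have "R = G" by simp
  then show False using R by simp
qed

text \<open>The normals of both candidates have positive coefficients along \<open>nrm G R\<close>.
  If the quotients of their two coefficients differ, one normal is a positive combination of the
  other one and of \<open>nrm F G\<close>, so all functionals are tight on its facet, which then
  lies in \<open>G\<close>. Equal quotients make the unit normals equal.\<close>

lemma diamond_unique:
  assumes F: "polytope F" and G: "G facet_of F" and R: "R facet_of G"
    and G1: "G1 facet_of F" "R \<subseteq> G1" "G1 \<noteq> G"
    and G2: "G2 facet_of F" "R \<subseteq> G2" "G2 \<noteq> G"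
  shows "G1 = G2"
proof -
  have aux: False if H: "H facet_of F" "R \<subseteq> H" "H \<noteq> G" and L: "L facet_of F" "R \<subseteq> L" "L \<noteq> G"
    and st: "s > 0" "t > 0" "nrm F H = c *\<^sub>R nrm F G + s *\<^sub>R nrm G R" "nrm F L = d *\<^sub>R nrm F G + t *\<^sub>R nrm G R"
    and less: "c / s > d / t" and inter: "G \<inter> H = R" for H L s t c d
  proof -
    obtain r where r: "r \<in> R" using R by (auto simp: facet_of_def)
    have rr: "r \<in> G" "r \<in> H" "r \<in> L" using r H L R facet_of_imp_subset by blast+
    have comb: "nrm F H = (s / t) *\<^sub>R nrm F L + (s * (c / s - d / t)) *\<^sub>R nrm F G"
      using st by (simp add: scaleR_add_right algebra_simps)
    have "H \<subseteq> R"
    proof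
      fix x assume x: "x \<in> H"
      then have xF: "x \<in> F" using H facet_of_imp_subset by blast
      have "nrm F H \<bullet> (x - r) = 0" using nrm_orth[OF F H(1) diff_in_dir[OF x rr(2)]] .
      then have "(s / t) * (nrm F L \<bullet> (x - r)) + (s * (c / s - d / t)) * (nrm F G \<bullet> (x - r)) = 0"
        by (subst (asm) comb) (simp add: inner_add_left)
      moreover have "nrm F L \<bullet> (x - r) \<le> 0" "nrm F G \<bullet> (x - r) \<le> 0"
        using nrm_le[OF F L(1) xF rr(3)] nrm_le[OF F G xF rr(1)] by (simp_all add: inner_diff_right)
      moreover have "s / t > 0" "s * (c / s - d / t) > 0" using st less by simp_all
      ultimately have "nrm F G \<bullet> (x - r) = 0"
        by (smt (verit) mult_nonneg_nonpos mult_pos_neg)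
      then have "x \<in> G" using nrm_eq_iff[OF F G xF rr(1)] by (simp add: inner_diff_right)
      then show "x \<in> R" using inter x by blast
    qed
    then have "H \<subseteq> G" using facet_of_imp_subset[OF R] by blast
    then show False using facet_subset_eq[OF polytope_imp_convex[OF F] H(1) G] H by blast
  qed
  obtain s where s: "s > 0" "s\<^sup>2 + (nrm F G \<bullet> nrm F G1)\<^sup>2 = 1" "nrm F G1 = (nrm F G \<bullet> nrm F G1) *\<^sub>R nrm F G + s *\<^sub>R nrm G R" "G \<inter> G1 = R"
    using facet_turn[OF F G R G1] by metis
  obtain t where t: "t > 0" "t\<^sup>2 + (nrm F G \<bullet> nrm F G2)\<^sup>2 = 1" "nrm F G2 = (nrm F G \<bullet> nrm F G2) *\<^sub>R nrm F G + t *\<^sub>R nrm G R" "G \<inter> G2 = R"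
    using facet_turn[OF F G R G2] by metis
  let ?c = "nrm F G \<bullet> nrm F G1" and ?d = "nrm F G \<bullet> nrm F G2"
  have "?c / s = ?d / t"
    using aux[OF G1 G2 s(1) t(1) s(3) t(3) _ s(4)] aux[OF G2 G1 t(1) s(1) t(3) s(3) _ t(4)] by argo
  then have c: "?c = s / t * ?d" using s(1) t(1) by (simp add: field_simps)
  have "nrm F G1 = (s / t * ?d) *\<^sub>R nrm F G + (s / t * t) *\<^sub>R nrm G R"
    using s(3) c t(1) by simp
  also have "\<dots> = (s / t) *\<^sub>R (?d *\<^sub>R nrm F G + t *\<^sub>R nrm G R)" by (simp add: scaleR_add_right)
  finally have cd: "nrm F G1 = (s / t) *\<^sub>R nrm F G2" using t(3) by simp
  then have "norm (nrm F G1) = \<bar>s / t\<bar> * norm (nrm F G2)" by (metis norm_scaleR)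
  then have "s / t = 1" using norm_nrm[OF F] G1 G2 s(1) t(1) by simp
  then have "nrm F G1 = nrm F G2" using cd by (metis scaleR_one)
  moreover obtain r where "r \<in> R" using R by (auto simp: facet_of_def)
  then have "r \<in> G1" "r \<in> G2" using G1 G2 by blast+
  ultimately have "x \<in> G1 \<longleftrightarrow> x \<in> G2" if "x \<in> F" for x
    using nrm_eq_iff[OF F G1(1) that] nrm_eq_iff[OF F G2(1) that] by metis
  then show ?thesis using facet_of_imp_subset[OF G1(1)] facet_of_imp_subset[OF G2(1)] by blast
qed

definition other :: "'a::euclidean_space set \<Rightarrow> 'a set \<Rightarrow> 'a set \<Rightarrow> 'a set" where
  "other F G R = (THE G'. G' facet_of F \<and> R \<subseteq> G' \<and> G' \<noteq> G)"

lemma other_eqI: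
  assumes "polytope F" "G facet_of F" "R facet_of G" "G' facet_of F" "R \<subseteq> G'" "G' \<noteq> G"
  shows "other F G R = G'"
  unfolding other_def
proof (rule the_equality)
  show "G' facet_of F \<and> R \<subseteq> G' \<and> G' \<noteq> G" using assms(4-6) by blast
next
  fix H assume "H facet_of F \<and> R \<subseteq> H \<and> H \<noteq> G"
  then show "H = G'" using diamond_unique[OF assms(1-3) _ _ _ assms(4-6)] by blast
qed

lemma other:
  assumes "polytope F" "G facet_of F" "R facet_of G"
  shows "other F G R facet_of F" "R facet_of other F G R" "other F G R \<noteq> G"
    "G \<inter> other F G R = R" "other F (other F G R) R = G"
proof -
  obtain G' where G': "G' facet_of F" "R \<subseteq> G'" "G' \<noteq> G" using diamond_exists[OF assms] by blast
  note eq = other_eqI[OF assms G']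
  show "other F G R facet_of F" "other F G R \<noteq> G" using G' eq by auto
  show R': "R facet_of other F G R" "G \<inter> other F G R = R" unfolding eq using facet_turn[OF assms G'] by blast+
  show "other F (other F G R) R = G"
    unfolding eq
    by (rule other_eqI[OF assms(1) G'(1) _ assms(2) facet_of_imp_subset[OF assms(3)]]) (use R'(1) eq G'(3) in auto)
qed

text \<open>Cosine and sine of the angle between the normals of the two facets of \<open>F\<close> that meet in the ridge
  \<open>R\<close>. The pair \<open>(nrm F G, nrm G R)\<close> of one facet is a reflection of the pair of the other one.\<close>

definition cs :: "'a::euclidean_space set \<Rightarrow> 'a set \<Rightarrow> 'a set \<Rightarrow> real" where
  "cs F G R = nrm F G \<bullet> nrm F (other F G R)"
definition sn :: "'a::euclidean_space set \<Rightarrow> 'a set \<Rightarrow> 'a set \<Rightarrow> real" where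
  "sn F G R = nrm G R \<bullet> nrm F (other F G R)"

text \<open>The roles of the two facets are symmetric, so \<open>nrm F G\<close> has the same
  expansion in the frame of the other facet; solving it gives the last formula. The change of frame
  is an involution of determinant -1, and this sign drives the cancellations in flag sums.\<close>

lemma turn:
  assumes F: "polytope F" and G: "G facet_of F" and R: "R facet_of G"
  shows "sn F G R > 0" "(sn F G R)\<^sup>2 + (cs F G R)\<^sup>2 = 1"
    "cs F (other F G R) R = cs F G R" "sn F (other F G R) R = sn F G R"
    "nrm F (other F G R) = cs F G R *\<^sub>R nrm F G + sn F G R *\<^sub>R nrm G R"
    "nrm (other F G R) R = sn F G R *\<^sub>R nrm F G - cs F G R *\<^sub>R nrm G R"
proof -
  note o = other[OF assms]
  have gen: "sn F G R > 0 \<and> (sn F G R)\<^sup>2 + (cs F G R)\<^sup>2 = 1 \<and>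
     nrm F (other F G R) = cs F G R *\<^sub>R nrm F G + sn F G R *\<^sub>R nrm G R"
    if G: "G facet_of F" and R: "R facet_of G" for G
  proof -
    note o = other[OF F G R]
    show ?thesis
    proof (rule facet_turn[OF F G R o(1) facet_of_imp_subset[OF o(2)] o(3)])
      fix s assume s: "0 < s" "s\<^sup>2 + (nrm F G \<bullet> nrm F (other F G R))\<^sup>2 = 1"
        "nrm F (other F G R) = (nrm F G \<bullet> nrm F (other F G R)) *\<^sub>R nrm F G + s *\<^sub>R nrm G R"
        "s = nrm G R \<bullet> nrm F (other F G R)"
      have sn: "sn F G R = s" unfolding sn_def by (rule s(4)[symmetric])
      show ?thesis unfolding sn cs_def by (intro conjI s(1-3))
    qed
  qed
  show 1: "sn F G R > 0" "(sn F G R)\<^sup>2 + (cs F G R)\<^sup>2 = 1"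
    "nrm F (other F G R) = cs F G R *\<^sub>R nrm F G + sn F G R *\<^sub>R nrm G R"
    by (rule conjunct1[OF gen[OF G R]], rule conjunct1[OF conjunct2[OF gen[OF G R]]],
        rule conjunct2[OF conjunct2[OF gen[OF G R]]])
  note 2 = gen[OF o(1,2), unfolded o(5)]
  show c: "cs F (other F G R) R = cs F G R" unfolding cs_def o(5) by (rule inner_commute)
  have "(sn F (other F G R) R)\<^sup>2 = (sn F G R)\<^sup>2" using 1(2) conjunct1[OF conjunct2[OF 2]] c by simp
  moreover have "sn F (other F G R) R > 0" using 2 by blast
  ultimately show s: "sn F (other F G R) R = sn F G R" using 1(1) power2_eq_iff_nonneg[of "sn F (other F G R) R" "sn F G R"] by simp
  let ?s = "sn F G R" and ?c = "cs F G R"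
  have "nrm F G = ?c *\<^sub>R (?c *\<^sub>R nrm F G + ?s *\<^sub>R nrm G R) + ?s *\<^sub>R nrm (other F G R) R"
    using conjunct2[OF conjunct2[OF 2]] unfolding c s 1(3)[symmetric] .
  then have "?s *\<^sub>R nrm (other F G R) R = nrm F G - ?c *\<^sub>R (?c *\<^sub>R nrm F G + ?s *\<^sub>R nrm G R)"
    by (metis add_diff_cancel_left')
  also have "\<dots> = (1 - ?c * ?c) *\<^sub>R nrm F G - (?s * ?c) *\<^sub>R nrm G R"
    by (simp add: scaleR_add_right scaleR_diff_left mult.commute)
  also have "1 - ?c * ?c = ?s * ?s" using 1(2) unfolding power2_eq_square by linarith
  also have "(?s * ?s) *\<^sub>R nrm F G - (?s * ?c) *\<^sub>R nrm G R = ?s *\<^sub>R (?s *\<^sub>R nrm F G - ?c *\<^sub>R nrm G R)"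
    by (simp add: scaleR_diff_right)
  finally show "nrm (other F G R) R = ?s *\<^sub>R nrm F G - ?c *\<^sub>R nrm G R"
    using 1(1) scaleR_cancel_left[of ?s] by simp
qed

section \<open>Volumes of faces\<close>

lemma sum_involution:
  assumes "\<And>x. x \<in> A \<Longrightarrow> \<iota> x \<in> A" "\<And>x. x \<in> A \<Longrightarrow> \<iota> (\<iota> x) = x"
  shows "sum \<phi> A = (\<Sum>x\<in>A. \<phi> (\<iota> x))"
  by (rule sum.reindex_bij_witness[of _ \<iota> \<iota>]) (use assms in auto)

lemma sum_involution_zero:
  fixes \<phi> :: "'b \<Rightarrow> 'a::real_vector"
  assumes "\<And>x. x \<in> A \<Longrightarrow> \<iota> x \<in> A" "\<And>x. x \<in> A \<Longrightarrow> \<iota> (\<iota> x) = x"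
    and "\<And>x. x \<in> A \<Longrightarrow> \<phi> x + \<phi> (\<iota> x) = 0"
  shows "sum \<phi> A = 0"
proof -
  have "sum \<phi> A + sum \<phi> A = (\<Sum>x\<in>A. \<phi> x + \<phi> (\<iota> x))"
    unfolding sum.distrib using sum_involution[of A \<iota> \<phi>, OF assms(1,2)] by simp
  also have "\<dots> = 0" using assms(3) by simp
  finally show ?thesis by (metis scaleR_2 scaleR_eq_0_iff zero_neq_numeral)
qed

lemma finite_facets [simp]: "polytope F \<Longrightarrow> finite {G. G facet_of F}"
  by (rule finite_polytope_facets)

text \<open>The map sending \<open>(G, R)\<close> to \<open>(other F G R, R)\<close> is an
  involution on the flags, so a summand that it negates has sum zero.\<close>

lemma flag_sum_zero:
  fixes \<phi> :: "'a::euclidean_space set \<Rightarrow> 'a set \<Rightarrow> 'b::real_vector"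
  assumes F: "polytope F"
    and "\<And>G R. G facet_of F \<Longrightarrow> R facet_of G \<Longrightarrow> \<phi> G R + \<phi> (other F G R) R = 0"
  shows "(\<Sum>G | G facet_of F. \<Sum>R | R facet_of G. \<phi> G R) = 0"
proof -
  let ?\<iota> = "\<lambda>(G, R). (other F G R, R)"
  have "(\<Sum>G | G facet_of F. \<Sum>R | R facet_of G. \<phi> G R) =
      (\<Sum>(G, R)\<in>Sigma {G. G facet_of F} (\<lambda>G. {R. R facet_of G}). \<phi> G R)"
    by (rule sum.Sigma) (use F polytope_facet[OF F] in simp_all)
  also have "\<dots> = 0"
    by (rule sum_involution_zero[where \<iota> = ?\<iota>]) (auto simp: other[OF F] assms(2))
  finally show ?thesis .
qed

lemma flag_sum_eq:
  fixes \<phi> :: "'a::euclidean_space set \<Rightarrow> 'a set \<Rightarrow> 'b::real_vector"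
  assumes F: "polytope F"
    and "\<And>G R. G facet_of F \<Longrightarrow> R facet_of G \<Longrightarrow>
      \<phi> G R + \<phi> (other F G R) R = \<psi> G R + \<psi> (other F G R) R"
  shows "(\<Sum>G | G facet_of F. \<Sum>R | R facet_of G. \<phi> G R) = (\<Sum>G | G facet_of F. \<Sum>R | R facet_of G. \<psi> G R)"
proof -
  have "(\<Sum>G | G facet_of F. \<Sum>R | R facet_of G. \<phi> G R - \<psi> G R) = 0"
  proof (rule flag_sum_zero[OF F])
    fix G R assume "G facet_of F" "R facet_of G"
    from assms(2)[OF this] show "\<phi> G R - \<psi> G R + (\<phi> (other F G R) R - \<psi> (other F G R) R) = 0"
      by (metis add_diff_add diff_self)
  qed
  then show ?thesis by (simp add: sum_subtractf)
qed

text \<open>A ray in direction \<open>e\<close> from a relative interior point leaves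
  \<open>F\<close> through a facet with this property.\<close>

lemma facet_toward:
  assumes F: "polytope F" and e: "e \<in> dir F" "e \<noteq> 0"
  obtains G where "G facet_of F" "nrm F G \<bullet> e > 0"
proof -
  have "F \<noteq> {}" using e by (auto simp: dir_def)
  then obtain p where p: "p \<in> rel_interior F"
    using rel_interior_eq_empty[OF polytope_imp_convex[OF F]] by blast
  have pF: "p \<in> F" using p rel_interior_subset by blast
  have "p + e \<in> affine hull F" using affine_hull_dir[OF hull_inc[OF pF], of "p + e"] e by simp
  then obtain d where d: "0 < d" "p + d *\<^sub>R e \<in> rel_frontier F"
    using ray_to_rel_frontier[OF polytope_imp_bounded[OF F] p] e(2) by metis
  then obtain G where G: "G facet_of F" "p + d *\<^sub>R e \<in> G"
    using rel_frontier_of_polyhedron[OF polytope_imp_polyhedron[OF F]] by auto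
  have "p \<notin> G" using p G(1) rel_interior_of_polyhedron[OF polytope_imp_polyhedron[OF F]] by auto
  then have "nrm F G \<bullet> p < nrm F G \<bullet> (p + d *\<^sub>R e)" using nrm_less[OF F G(1) pF _ G(2)] by blast
  then have "0 < d * (nrm F G \<bullet> e)" by (simp add: inner_add_right)
  then have "nrm F G \<bullet> e > 0" using d(1) by (simp add: zero_less_mult_iff)
  then show ?thesis using that G(1) by blast
qed

lemma nrm_inject:
  assumes F: "polytope F" and G: "G facet_of F" and H: "H facet_of F" and eq: "nrm F G = nrm F H"
  shows "G = H"
proof -
  obtain g h where gh: "g \<in> G" "h \<in> H" using G H by (auto simp: facet_of_def)
  then have "g \<in> F" "h \<in> F" using facet_of_imp_subset G H by blast+
  then have "nrm F G \<bullet> g = nrm F G \<bullet> h"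
    using nrm_le[OF F G _ gh(1)] nrm_le[OF F H _ gh(2)] eq by (metis antisym)
  then have "x \<in> G \<longleftrightarrow> x \<in> H" if "x \<in> F" for x
    using nrm_eq_iff[OF F G that gh(1)] nrm_eq_iff[OF F H that gh(2)] eq by simp
  then show ?thesis using facet_of_imp_subset[OF G] facet_of_imp_subset[OF H] by blast
qed

lemma segment_facets:
  assumes F: "polytope F" and dim: "aff_dim F = 1"
  obtains G1 G2 where "G1 \<noteq> G2" "{G. G facet_of F} = {G1, G2}" "nrm F G2 = - nrm F G1"
proof -
  have "F \<noteq> {}" using dim by auto
  then have "dim (dir F) = 1" using dim_dir[of F] dim by simp
  then obtain e0 where e0: "e0 \<in> dir F" "e0 \<noteq> 0"
    by (metis dim_eq_0 subsetI singletonD singletonI zero_neq_one)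
  obtain G1 where G1: "G1 facet_of F" "nrm F G1 \<bullet> e0 > 0" using facet_toward[OF F e0] .
  let ?u = "nrm F G1"
  have u: "?u \<in> dir F" "norm ?u = 1" using nrm_in_dir[OF F G1(1)] norm_nrm[OF F G1(1)] .
  then have "- ?u \<in> dir F" "- ?u \<noteq> 0" using subspace_neg[OF subspace_dir] by auto
  then obtain G2 where G2: "G2 facet_of F" "nrm F G2 \<bullet> - ?u > 0" using facet_toward[OF F] by blast
  have "span {?u} \<subseteq> dir F" using u by (simp add: span_minimal)
  moreover have "dim (dir F) \<le> dim (span {?u})" using u \<open>dim (dir F) = 1\<close> dim_span[of "{?u}"] dim_eq_0[of "{?u}"] by auto
  ultimately have span: "dir F = span {?u}" by (metis subspace_dim_equal subspace_dir subspace_span)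
  have pm: "nrm F G = ?u \<or> nrm F G = - ?u" if G: "G facet_of F" for G
  proof -
    obtain k where k: "nrm F G = k *\<^sub>R ?u" using nrm_in_dir[OF F G] span by (auto simp: span_singleton)
    then have "\<bar>k\<bar> = 1" using norm_nrm[OF F G] u(2) by simp
    then show ?thesis using k by (metis abs_if minus_equation_iff scaleR_minus_left scaleR_one)
  qed
  have n2: "nrm F G2 = - ?u" using pm[OF G2(1)] G2(2) nrm_self[OF F G1(1)] by auto
  have "{G. G facet_of F} = {G1, G2}"
  proof (intro Set.set_eqI iffI)
    fix G assume "G \<in> {G. G facet_of F}"
    then have G: "G facet_of F" by simp
    then show "G \<in> {G1, G2}" using pm[OF G] nrm_inject[OF F G] G1(1) G2(1) n2 by (metis insertCI)
  qed (use G1(1) G2(1) in auto)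
  moreover have "G1 \<noteq> G2" using G2(2) nrm_self[OF F G1(1)] by auto
  ultimately show ?thesis using that n2 by blast
qed

definition pt :: "'a::euclidean_space set \<Rightarrow> 'a" where "pt G = (SOME g. g \<in> G)"

text \<open>The parameter \<open>m\<close> is meant to be the dimension of \<open>F\<close>. The recursion cuts \<open>F\<close> into pyramids
  over its facets with apex \<open>0\<close>, which need not lie in \<open>F\<close>; any other apex gives the same value
  (\<open>vol_from\<close>).\<close>

primrec vol :: "nat \<Rightarrow> 'a::euclidean_space set \<Rightarrow> real" where
  "vol 0 F = 1"
| "vol (Suc m) F = (\<Sum>G | G facet_of F. vol m G * (nrm F G \<bullet> pt G)) / real (Suc m)"

lemma pt_in: "G facet_of F \<Longrightarrow> pt G \<in> G"
  unfolding pt_def by (rule someI_ex) (auto simp: facet_of_def)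

lemma vol_Suc: "real (Suc m) * vol (Suc m) F = (\<Sum>G | G facet_of F. vol m G * (nrm F G \<bullet> pt G))"
  by simp

declare vol.simps(2) [simp del]

lemma aff_dim_facet: "G facet_of F \<Longrightarrow> aff_dim F = int (Suc m) \<Longrightarrow> aff_dim G = int m"
  by (simp add: facet_of_def)

lemma nrm_pt: "polytope F \<Longrightarrow> G facet_of F \<Longrightarrow> g \<in> G \<Longrightarrow> nrm F G \<bullet> pt G = nrm F G \<bullet> g"
  using nrm_eq_iff pt_in facet_of_imp_subset by (metis subsetD)

text \<open>Let \<open>a\<close> and \<open>b\<close> be the coordinates of a point of
  \<open>R\<close> along \<open>u = nrm F G\<close> and \<open>n = nrm G R\<close>. Then
  \<open>b u - a n\<close> is its projection turned by a right angle. The frames of the two facets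
  at \<open>R\<close> have opposite orientation, so these vectors cancel. The sum over the
  \<open>u\<close> thus becomes one sum over the \<open>n\<close> for each facet, and these vanish
  by induction. Only the apex \<open>0\<close> of the recursion for \<open>vol\<close> can be used
  here, since independence of the apex is a consequence.\<close>

lemma minkowski:
  "polytope F \<Longrightarrow> aff_dim F = int (Suc m) \<Longrightarrow> (\<Sum>G | G facet_of F. vol m G *\<^sub>R nrm F G) = 0"
proof (induction m arbitrary: F)
  case 0
  then obtain G1 G2 where "G1 \<noteq> G2" "{G. G facet_of F} = {G1, G2}" "nrm F G2 = - nrm F G1"
    using segment_facets[of F] by auto
  then show ?case by simp
next
  case (Suc m)
  note F = Suc.prems(1)
  let ?u = "\<lambda>G. nrm F G" and ?n = "\<lambda>G R. nrm G R"
  have "real (Suc m) *\<^sub>R (\<Sum>G | G facet_of F. vol (Suc m) G *\<^sub>R ?u G) =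
      (\<Sum>G | G facet_of F. \<Sum>R | R facet_of G. (vol m R * (?n G R \<bullet> pt R)) *\<^sub>R ?u G)"
    unfolding scaleR_sum_right by (simp only: scaleR_scaleR vol_Suc scaleR_sum_left)
  also have "\<dots> = (\<Sum>G | G facet_of F. \<Sum>R | R facet_of G. (?u G \<bullet> pt G * vol m R) *\<^sub>R ?n G R)"
  proof (rule flag_sum_eq[OF F])
    fix G R assume G: "G facet_of F" and R: "R facet_of G"
    let ?G' = "other F G R" and ?c = "cs F G R" and ?s = "sn F G R"
    note o = other[OF F G R] and t = turn[OF F G R]
    have r: "pt R \<in> G" "pt R \<in> ?G'" using pt_in[OF R] facet_of_imp_subset[OF R] facet_of_imp_subset[OF o(2)] by blast+
    have s2: "?s * ?s = 1 - ?c * ?c" using t(2) unfolding power2_eq_square by linarith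
    define a b where "a = ?u G \<bullet> pt R" and "b = ?n G R \<bullet> pt R"
    have h: "?u G \<bullet> pt G = a" "?u ?G' \<bullet> pt ?G' = ?c * a + ?s * b" "?n ?G' R \<bullet> pt R = ?s * a - ?c * b"
      using nrm_pt[OF F G r(1)] nrm_pt[OF F o(1) r(2)] by (simp_all add: a_def b_def t(5,6) inner_add_left inner_diff_left)
    have "b *\<^sub>R ?u G + (?s * a - ?c * b) *\<^sub>R ?u ?G' = a *\<^sub>R ?n G R + (?c * a + ?s * b) *\<^sub>R ?n ?G' R"
    proof -
      have "b + (?s * a - ?c * b) * ?c - (?c * a + ?s * b) * ?s = b * (1 - ?c * ?c - ?s * ?s)"
        by (simp add: algebra_simps)
      then have e1: "b + (?s * a - ?c * b) * ?c = (?c * a + ?s * b) * ?s" using s2 by simp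
      have "(?s * a - ?c * b) * ?s - (a - (?c * a + ?s * b) * ?c) = a * (?s * ?s - (1 - ?c * ?c))"
        by (simp add: algebra_simps)
      then have e2: "(?s * a - ?c * b) * ?s = a - (?c * a + ?s * b) * ?c" using s2 by simp
      have "b *\<^sub>R ?u G + (?s * a - ?c * b) *\<^sub>R ?u ?G'
         = (b + (?s * a - ?c * b) * ?c) *\<^sub>R ?u G + ((?s * a - ?c * b) * ?s) *\<^sub>R ?n G R"
        unfolding t(5) by (simp add: scaleR_add_right scaleR_add_left)
      also have "\<dots> = ((?c * a + ?s * b) * ?s) *\<^sub>R ?u G + (a - (?c * a + ?s * b) * ?c) *\<^sub>R ?n G R"
        unfolding e1 e2 ..
      also have "\<dots> = a *\<^sub>R ?n G R + (?c * a + ?s * b) *\<^sub>R ?n ?G' R"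
        unfolding t(6) by (simp add: scaleR_diff_right scaleR_diff_left)
      finally show ?thesis .
    qed
    then have "vol m R *\<^sub>R (b *\<^sub>R ?u G + (?s * a - ?c * b) *\<^sub>R ?u ?G') = vol m R *\<^sub>R (a *\<^sub>R ?n G R + (?c * a + ?s * b) *\<^sub>R ?n ?G' R)"
      by (rule arg_cong)
    then show "(vol m R * (?n G R \<bullet> pt R)) *\<^sub>R ?u G + (vol m R * (?n ?G' R \<bullet> pt R)) *\<^sub>R ?u ?G'
      = (?u G \<bullet> pt G * vol m R) *\<^sub>R ?n G R + (?u ?G' \<bullet> pt ?G' * vol m R) *\<^sub>R ?n ?G' R"
      unfolding h b_def[symmetric] by (simp only: scaleR_add_right scaleR_scaleR mult.commute)
  qed
  also have "\<dots> = (\<Sum>G | G facet_of F. (?u G \<bullet> pt G) *\<^sub>R (\<Sum>R | R facet_of G. vol m R *\<^sub>R ?n G R))"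
    by (simp only: scaleR_sum_right scaleR_scaleR)
  also have "\<dots> = 0"
    using Suc.IH polytope_facet[OF F] aff_dim_facet[OF _ Suc.prems(2)] by (intro sum.neutral) simp
  finally show ?case by simp
qed

lemma vol_from:
  assumes F: "polytope F" and dim: "aff_dim F = int (Suc m)"
  shows "real (Suc m) * vol (Suc m) F = (\<Sum>G | G facet_of F. vol m G * (nrm F G \<bullet> (pt G - p)))"
proof -
  have "(\<Sum>G | G facet_of F. vol m G * (nrm F G \<bullet> p)) = (\<Sum>G | G facet_of F. vol m G *\<^sub>R nrm F G) \<bullet> p"
    by (simp add: inner_sum_left)
  then have "(\<Sum>G | G facet_of F. vol m G * (nrm F G \<bullet> p)) = 0" using minkowski[OF assms] by simp
  then show ?thesis unfolding vol_Suc by (simp only: inner_diff_right right_diff_distrib sum_subtractf diff_zero)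
qed

lemma rel_interior_nrm_less:
  assumes F: "polytope F" and p: "p \<in> rel_interior F" and G: "G facet_of F"
  shows "nrm F G \<bullet> (pt G - p) > 0"
proof -
  have "p \<in> F" "p \<notin> G" using p G rel_interior_of_polyhedron[OF polytope_imp_polyhedron[OF F]] by auto
  then show ?thesis using nrm_less[OF F G _ _ pt_in[OF G]] by (simp add: inner_diff_right)
qed

lemma facet_exists:
  assumes F: "polytope F" and dim: "aff_dim F = int (Suc m)"
  obtains G where "G facet_of F"
  using polytope_facet_exists[OF F] dim by auto

lemma rel_interior_point:
  assumes F: "polytope F" and dim: "aff_dim F = int m"
  obtains p where "p \<in> rel_interior F"
proof -
  have "F \<noteq> {}" using dim by auto
  then show ?thesis using that rel_interior_eq_empty[OF polytope_imp_convex[OF F]] by blast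
qed

text \<open>With the apex in the relative interior every pyramid has positive height, whereas
  heights from \<open>0\<close> may have either sign.\<close>

lemma vol_pos: "polytope F \<Longrightarrow> aff_dim F = int m \<Longrightarrow> vol m F > 0"
proof (induction m arbitrary: F)
  case (Suc m)
  note F = Suc.prems(1)
  obtain p where p: "p \<in> rel_interior F" using rel_interior_point[OF Suc.prems] .
  obtain G where G: "G facet_of F" using facet_exists[OF Suc.prems] .
  have "(\<Sum>G | G facet_of F. vol m G * (nrm F G \<bullet> (pt G - p))) > 0"
  proof (rule sum_pos)
    show "{G. G facet_of F} \<noteq> {}" using G by blast
    show "0 < vol m G * (nrm F G \<bullet> (pt G - p))" if "G \<in> {G. G facet_of F}" for G
      using that Suc.IH[OF polytope_facet[OF F] aff_dim_facet[OF _ Suc.prems(2)], of G]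
        rel_interior_nrm_less[OF F p, of G] by simp
  qed (use F in simp)
  then have "0 < real (Suc m) * vol (Suc m) F" unfolding vol_from[OF Suc.prems, of p] .
  then show ?case by (simp only: zero_less_mult_iff) (simp add: not_less)
qed simp

section \<open>The second variation of volume\<close>

text \<open>A function \<open>f\<close> on the facets of \<open>F\<close> is a perturbation of its support numbers. It moves the facet
  \<open>R\<close> of \<open>G\<close> by \<open>res F f G R\<close> inside the affine hull of \<open>G\<close>, and \<open>facet_row m F f G\<close> is the derivative of the
  volume of \<open>G\<close>. Here \<open>m\<close> is the dimension of the ridges of \<open>F\<close>.\<close>

definition res :: "'a::euclidean_space set \<Rightarrow> ('a set \<Rightarrow> real) \<Rightarrow> 'a set \<Rightarrow> 'a set \<Rightarrow> real" where
  "res F f G R = (f (other F G R) - cs F G R * f G) / sn F G R"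

definition facet_row :: "nat \<Rightarrow> 'a::euclidean_space set \<Rightarrow> ('a set \<Rightarrow> real) \<Rightarrow> 'a set \<Rightarrow> real" where
  "facet_row m F f G = (\<Sum>R | R facet_of G. vol m R * res F f G R)"

definition form :: "nat \<Rightarrow> 'a::euclidean_space set \<Rightarrow> ('a set \<Rightarrow> real) \<Rightarrow> ('a set \<Rightarrow> real) \<Rightarrow> real" where
  "form m F f g = (\<Sum>G | G facet_of F. f G * facet_row m F g G)"

text \<open>Two special perturbations: translation by \<open>t\<close>, and dilation from the point \<open>p\<close>.\<close>

definition lin_val :: "'a::euclidean_space set \<Rightarrow> 'a \<Rightarrow> 'a set \<Rightarrow> real" where
  "lin_val F t G = nrm F G \<bullet> t"

definition hgt :: "'a::euclidean_space set \<Rightarrow> 'a \<Rightarrow> 'a set \<Rightarrow> real" where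
  "hgt F p G = nrm F G \<bullet> (pt G - p)"

section \<open>Bilinearity, change of facet at a ridge, translations and dilations\<close>

lemma res_comb: "res F (\<lambda>G. a * f G + b * g G) G R = a * res F f G R + b * res F g G R"
  by (simp add: res_def add_divide_distrib diff_divide_distrib algebra_simps)

lemma row_comb: "facet_row m F (\<lambda>G. a * f G + b * g G) G = a * facet_row m F f G + b * facet_row m F g G"
  by (simp add: facet_row_def res_comb sum.distrib sum_distrib_left algebra_simps)

lemma form_comb_left: "form m F (\<lambda>G. a * f G + b * g G) k = a * form m F f k + b * form m F g k"
  by (simp add: form_def sum.distrib sum_distrib_left algebra_simps)

lemma form_comb_right: "form m F k (\<lambda>G. a * f G + b * g G) = a * form m F k f + b * form m F k g"
  by (simp add: form_def row_comb sum.distrib sum_distrib_left algebra_simps)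

lemma reflect_twice:
  fixes s c :: real
  shows "s\<^sup>2 + c\<^sup>2 = 1 \<Longrightarrow> a - c * (c * a + s * b) = s * (s * a - c * b)"
  by algebra

lemma reflect_sym:
  fixes s c :: real
  shows "s\<^sup>2 + c\<^sup>2 = 1 \<Longrightarrow> x * y' + (c * x + s * y) * (s * x' - c * y') = x' * y + (c * x' + s * y') * (s * x - c * y)"
  by algebra

context
  fixes F G R :: "'a::euclidean_space set"
  assumes F: "polytope F" and G: "G facet_of F" and R: "R facet_of G"
begin

lemma val_other: "f (other F G R) = cs F G R * f G + sn F G R * res F f G R"
  using turn(1)[OF F G R] by (simp add: res_def)

lemma res_other: "res F f (other F G R) R = sn F G R * f G - cs F G R * res F f G R"
proof -
  note t = turn[OF F G R] and o = other[OF F G R]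
  have "f G - cs F G R * f (other F G R) = sn F G R * (sn F G R * f G - cs F G R * res F f G R)"
    unfolding val_other using reflect_twice[OF t(2)] .
  then show ?thesis unfolding res_def[of F f "other F G R"] o(5) t(3,4) using t(1) by simp
qed

lemma res_lin: "res F (lin_val F t) G R = nrm G R \<bullet> t"
  using turn(1)[OF F G R] by (simp add: res_def lin_val_def turn(5)[OF F G R] inner_add_left)

lemma hgt_eq: "hgt F p G = nrm F G \<bullet> (pt R - p)" "hgt F p (other F G R) = nrm F (other F G R) \<bullet> (pt R - p)"
  using nrm_pt[OF F G, of "pt R"] nrm_pt[OF F other(1)[OF F G R], of "pt R"] pt_in[OF R]
    facet_of_imp_subset[OF R] facet_of_imp_subset[OF other(2)[OF F G R]]
  by (auto simp: hgt_def inner_diff_right subset_iff)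

lemma res_hgt: "res F (hgt F p) G R = hgt G p R"
  using turn(1)[OF F G R] unfolding res_def hgt_eq by (simp add: hgt_def[of G] turn(5)[OF F G R] inner_add_left)

end

text \<open>For one flag, \<open>f G * res F g G R - g G * res F f G R\<close> is a determinant of
  coordinates in the frame of the flag; it changes sign when the facet is exchanged.\<close>

lemma form_sym:
  assumes F: "polytope F" shows "form m F f g = form m F g f"
proof -
  have "form m F f g = (\<Sum>G | G facet_of F. \<Sum>R | R facet_of G. f G * (vol m R * res F g G R))"
    by (simp add: form_def facet_row_def sum_distrib_left)
  also have "\<dots> = (\<Sum>G | G facet_of F. \<Sum>R | R facet_of G. g G * (vol m R * res F f G R))"
  proof (rule flag_sum_eq[OF F])
    fix G R assume G: "G facet_of F" and R: "R facet_of G"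
    show "f G * (vol m R * res F g G R) + f (other F G R) * (vol m R * res F g (other F G R) R) =
      g G * (vol m R * res F f G R) + g (other F G R) * (vol m R * res F f (other F G R) R)"
      unfolding res_other[OF F G R] val_other[OF F G R, of f] val_other[OF F G R, of g]
      using arg_cong[where f = "\<lambda>z. vol m R * z", OF reflect_sym[OF turn(2)[OF F G R], of "f G" "res F g G R" "res F f G R" "g G"]]
      by (simp only: distrib_left mult.assoc mult.commute mult.left_commute)
  qed
  also have "\<dots> = form m F g f" by (simp add: form_def facet_row_def sum_distrib_left)
  finally show ?thesis .
qed

text \<open>Restricting a translation of \<open>F\<close> to \<open>G\<close> gives the translation
  of \<open>G\<close> by the same vector, so the row is the Minkowski relation of \<open>G\<close>
  paired with \<open>t\<close>.\<close>

lemma row_lin: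
  assumes F: "polytope F" and dim: "aff_dim F = int (Suc (Suc m))" and G: "G facet_of F"
  shows "facet_row m F (lin_val F t) G = 0"
proof -
  have "facet_row m F (lin_val F t) G = (\<Sum>R | R facet_of G. vol m R *\<^sub>R nrm G R) \<bullet> t"
    unfolding facet_row_def inner_sum_left by (rule sum.cong) (simp_all add: res_lin[OF F G])
  then show ?thesis using minkowski[OF polytope_facet[OF F G] aff_dim_facet[OF G dim]] by simp
qed

text \<open>A dilation of \<open>F\<close> restricts to the dilation of \<open>G\<close> with the
  same center, and the claim is Euler's relation for a volume homogeneous of degree
  \<open>Suc m\<close>.\<close>

lemma row_hgt:
  assumes F: "polytope F" and dim: "aff_dim F = int (Suc (Suc m))" and G: "G facet_of F"
  shows "facet_row m F (hgt F p) G = real (Suc m) * vol (Suc m) G"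
  unfolding facet_row_def vol_from[OF polytope_facet[OF F G] aff_dim_facet[OF G dim], of p]
  by (rule sum.cong) (simp_all add: res_hgt[OF F G], simp add: hgt_def)

lemma form_lin_right: "polytope F \<Longrightarrow> aff_dim F = int (Suc (Suc m)) \<Longrightarrow> form m F f (lin_val F t) = 0"
  unfolding form_def by (rule sum.neutral) (simp add: row_lin)

lemma form_lin_left: "polytope F \<Longrightarrow> aff_dim F = int (Suc (Suc m)) \<Longrightarrow> form m F (lin_val F t) f = 0"
  using form_lin_right form_sym by metis

lemma form_hgt:
  assumes F: "polytope F" and dim: "aff_dim F = int (Suc (Suc m))"
  shows "form m F f (hgt F p) = real (Suc m) * (\<Sum>G | G facet_of F. f G * vol (Suc m) G)"
  unfolding form_def sum_distrib_left by (rule sum.cong) (simp_all add: row_hgt[OF assms] mult.commute mult.left_commute)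

lemma form_hgt_hgt:
  assumes F: "polytope F" and dim: "aff_dim F = int (Suc (Suc m))"
  shows "form m F (hgt F p) (hgt F p) = real (Suc m) * (real (Suc (Suc m)) * vol (Suc (Suc m)) F)"
  unfolding form_hgt[OF assms] vol_from[OF assms, of p] by (simp add: hgt_def mult.commute)

lemma form_hgt_pos:
  assumes F: "polytope F" and dim: "aff_dim F = int (Suc (Suc m))"
  shows "form m F (hgt F p) (hgt F p) > 0"
  unfolding form_hgt_hgt[OF assms] using vol_pos[OF assms] by (intro mult_pos_pos) auto

text \<open>By \<open>form_hgt\<close> the constraint says that \<open>f\<close> is orthogonal to
  the dilations, on which the form is positive. So this is the signature statement with exactly one
  positive direction, together with the equality case. \<open>F\<close> is meant to have dimension
  \<open>Suc (Suc m)\<close>, hence the index \<open>Suc m\<close> for its facets.\<close>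

definition hyperbolic :: "nat \<Rightarrow> 'a::euclidean_space set \<Rightarrow> bool" where
  "hyperbolic m F \<longleftrightarrow> (\<forall>f. (\<Sum>G | G facet_of F. f G * vol (Suc m) G) = 0 \<longrightarrow>
     form m F f f \<le> 0 \<and> (form m F f f = 0 \<longrightarrow> (\<exists>t\<in>dir F. \<forall>G. G facet_of F \<longrightarrow> f G = nrm F G \<bullet> t)))"

text \<open>Adding a multiple of the new vector \<open>n\<close> to \<open>e\<close> repairs the
  condition at \<open>n\<close>; each old condition forbids at most one multiple.\<close>

lemma generic_vector:
  fixes V :: "'a::real_inner set"
  assumes "finite N" "subspace V" "N \<subseteq> V" "0 \<notin> N"
  shows "\<exists>e\<in>V. \<forall>n\<in>N. e \<bullet> n \<noteq> 0"
  using assms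
proof (induction N)
  case empty
  then show ?case using subspace_0 by blast
next
  case (insert n N)
  then obtain e where e: "e \<in> V" "\<forall>k\<in>N. e \<bullet> k \<noteq> 0" by auto
  show ?case
  proof (cases "e \<bullet> n = 0")
    case True
    let ?B = "(\<lambda>k. - (e \<bullet> k) / (n \<bullet> k)) ` N"
    have "finite (insert 0 ?B)" using insert by simp
    then obtain a where a: "a \<notin> insert 0 ?B" using ex_new_if_finite[OF infinite_UNIV_char_0] by blast
    have "(e + a *\<^sub>R n) \<bullet> k \<noteq> 0" if k: "k \<in> insert n N" for k
    proof (cases "k = n")
      case True
      then show ?thesis using \<open>e \<bullet> n = 0\<close> a insert by (simp add: inner_add_left)
    next
      case False
      then have kN: "k \<in> N" using k by simp
      show ?thesis
      proof
        assume "(e + a *\<^sub>R n) \<bullet> k = 0"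
        then have *: "e \<bullet> k + a * (n \<bullet> k) = 0" by (simp add: inner_add_left)
        then have "n \<bullet> k \<noteq> 0" using e kN by auto
        then have "a = - (e \<bullet> k) / (n \<bullet> k)" using * by (simp add: field_simps)
        then show False using a kN by blast
      qed
    qed
    moreover have "e + a *\<^sub>R n \<in> V" using insert e by (simp add: subspace_add subspace_scale)
    ultimately show ?thesis by blast
  qed (use e in auto)
qed

text \<open>Modulo \<open>dir R\<close>, this is where the two moved facet hyperplanes through \<open>R\<close> meet; it does not depend
  on the choice of \<open>G\<close> (\<open>xv_eq\<close>).\<close>

definition xv :: "'a::euclidean_space set \<Rightarrow> 'a set \<Rightarrow> 'a set \<Rightarrow> ('a set \<Rightarrow> real) \<Rightarrow> 'a" where
  "xv F G R f = f G *\<^sub>R nrm F G + res F f G R *\<^sub>R nrm G R"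

lemma xv_comb: "xv F G R (\<lambda>H. a * f H + b * g H) = a *\<^sub>R xv F G R f + b *\<^sub>R xv F G R g"
  by (simp add: xv_def res_comb scaleR_add_left scaleR_add_right)

context
  fixes F G R :: "'a::euclidean_space set"
  assumes F: "polytope F" and G: "G facet_of F" and R: "R facet_of G"
begin

lemma nrm_frame:
  "nrm F G \<bullet> nrm F G = 1" "nrm G R \<bullet> nrm G R = 1" "nrm F G \<bullet> nrm G R = 0" "nrm G R \<bullet> nrm F G = 0"
  using nrm_self[OF F G] nrm_self[OF polytope_facet[OF F G] R]
    nrm_orth[OF F G nrm_in_dir[OF polytope_facet[OF F G] R]] by (simp_all add: inner_commute)

lemma xv_nrm: "nrm F G \<bullet> xv F G R f = f G" "nrm G R \<bullet> xv F G R f = res F f G R"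
  by (simp_all add: xv_def inner_add_right nrm_frame)

lemma xv_in_dir: "xv F G R f \<in> dir F"
  using nrm_in_dir[OF F G] nrm_in_dir[OF polytope_facet[OF F G] R] dir_mono[OF facet_of_imp_subset[OF G]]
  unfolding xv_def by (intro subspace_add subspace_scale) auto

text \<open>The frame and the coordinates change by the same orthogonal matrix.\<close>

lemma xv_other: "xv F (other F G R) R f = xv F G R f"
proof -
  define s c x y u n where "s = sn F G R" and "c = cs F G R" and "x = f G" and "y = res F f G R"
    and "u = nrm F G" and "n = nrm G R"
  have sc: "s\<^sup>2 + c\<^sup>2 = 1" using turn(2)[OF F G R] by (simp add: s_def c_def)
  then have 1: "(c * x + s * y) * c + (s * x - c * y) * s = x" "(c * x + s * y) * s - (s * x - c * y) * c = y"
    by algebra+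
  have "xv F (other F G R) R f = (c * x + s * y) *\<^sub>R (c *\<^sub>R u + s *\<^sub>R n) + (s * x - c * y) *\<^sub>R (s *\<^sub>R u - c *\<^sub>R n)"
    unfolding xv_def res_other[OF F G R] val_other[OF F G R, of f] turn(5,6)[OF F G R] s_def c_def x_def y_def u_def n_def ..
  also have "\<dots> = ((c * x + s * y) * c + (s * x - c * y) * s) *\<^sub>R u + ((c * x + s * y) * s - (s * x - c * y) * c) *\<^sub>R n"
    by (simp only: scaleR_add_right scaleR_diff_right scaleR_add_left scaleR_diff_left scaleR_scaleR) simp
  also have "\<dots> = xv F G R f" unfolding 1 by (simp add: xv_def x_def y_def u_def n_def)
  finally show ?thesis .
qed

lemma xv_lin: "t \<in> dir F \<Longrightarrow> (\<And>y. y \<in> dir R \<Longrightarrow> t \<bullet> y = 0) \<Longrightarrow> xv F G R (lin_val F t) = t"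
  using facet_plane_split[OF F G R, of t] by (simp add: xv_def res_lin[OF F G R]) (simp add: lin_val_def)

end

subsection \<open>Polygons\<close>

lemma dir_point: "dir {r} = {0}"
  by (simp add: dir_def)

lemma vertex_dir:
  assumes "aff_dim R = 0" "y \<in> dir R" shows "y = 0"
  using assms aff_dim_eq_0[of R] dir_point by auto

context
  fixes F :: "'a::euclidean_space set" and e :: 'a
  assumes F: "polytope F" and dim: "aff_dim F = 2"
    and e: "e \<in> dir F" "\<And>G R. G facet_of F \<Longrightarrow> R facet_of G \<Longrightarrow> nrm G R \<bullet> e \<noteq> 0"
begin

lemma polygon_dims:
  "G facet_of F \<Longrightarrow> aff_dim G = 1" "G facet_of F \<Longrightarrow> R facet_of G \<Longrightarrow> aff_dim R = 0"
  using dim by (auto simp: facet_of_def)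

lemma xv_lin_polygon:
  assumes "G facet_of F" "R facet_of G" "t \<in> dir F" shows "xv F G R (lin_val F t) = t"
  using xv_lin[OF F assms] vertex_dir[OF polygon_dims(2)[OF assms(1,2)]] inner_zero_right by metis

text \<open>In this sum over the vertices of a polygon, positive terms occur only at the vertices where \<open>e\<close> is
  maximal or minimal. No cyclic ordering of the edges is needed.\<close>

lemma polygon_form:
  "form 0 F f f = (\<Sum>G | G facet_of F. \<Sum>R | R facet_of G.
     sn F G R * (xv F G R f \<bullet> e)\<^sup>2 / (2 * (nrm G R \<bullet> e) * (nrm (other F G R) R \<bullet> e)))"
proof -
  \<comment> \<open>When \<open>res\<close> is expressed by \<open>xv F G R f \<bullet> e\<close>, a
    remainder is left over. It cancels along each edge, because the normals at its two ends are
    opposite.\<close>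
  have edge: "(\<Sum>R | R facet_of G. f G * (f G * (nrm F G \<bullet> e)) / (nrm G R \<bullet> e)) = 0" if G: "G facet_of F" for G
  proof -
    obtain R1 R2 where "R1 \<noteq> R2" "{R. R facet_of G} = {R1, R2}" "nrm G R2 = - nrm G R1"
      using segment_facets[OF polytope_facet[OF F G] polygon_dims(1)[OF G]] .
    then show ?thesis by simp
  qed
  have "form 0 F f f = (\<Sum>G | G facet_of F. \<Sum>R | R facet_of G.
      f G * (xv F G R f \<bullet> e) / (nrm G R \<bullet> e) - f G * (f G * (nrm F G \<bullet> e)) / (nrm G R \<bullet> e))"
    unfolding form_def facet_row_def sum_distrib_left
  proof (intro sum.cong refl)
    fix G R assume "G \<in> {G. G facet_of F}" "R \<in> {R. R facet_of G}"
    then have "nrm G R \<bullet> e \<noteq> 0" using e(2) by simp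
    then show "f G * (vol 0 R * res F f G R) = f G * (xv F G R f \<bullet> e) / (nrm G R \<bullet> e) - f G * (f G * (nrm F G \<bullet> e)) / (nrm G R \<bullet> e)"
      by (simp add: xv_def inner_add_left field_simps)
  qed
  also have "\<dots> = (\<Sum>G | G facet_of F. \<Sum>R | R facet_of G. f G * (xv F G R f \<bullet> e) / (nrm G R \<bullet> e))"
    unfolding sum_subtractf using edge by simp
  also have "\<dots> = (\<Sum>G | G facet_of F. \<Sum>R | R facet_of G.
     sn F G R * (xv F G R f \<bullet> e)\<^sup>2 / (2 * (nrm G R \<bullet> e) * (nrm (other F G R) R \<bullet> e)))"
  proof (rule flag_sum_eq[OF F])
    fix G R assume G: "G facet_of F" and R: "R facet_of G"
    note o = other[OF F G R] and t = turn[OF F G R]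
    define q q' E where "q = nrm G R \<bullet> e" and "q' = nrm (other F G R) R \<bullet> e" and "E = xv F G R f \<bullet> e"
    have nz: "q \<noteq> 0" "q' \<noteq> 0" unfolding q_def q'_def using e(2) G R o by auto
    have q': "q' = sn F G R * (nrm F G \<bullet> e) - cs F G R * q"
      by (simp add: q'_def q_def t(6) inner_diff_left)
    have E: "E = f G * (nrm F G \<bullet> e) + res F f G R * q"
      by (simp add: E_def q_def xv_def inner_add_left)
    have "f G * q' + (cs F G R * f G + sn F G R * res F f G R) * q = sn F G R * E"
      unfolding q' E by (simp add: algebra_simps)
    then have num: "f G * q' + f (other F G R) * q = sn F G R * E" unfolding val_other[OF F G R, of f] .
    have "f G * E / q + f (other F G R) * E / q' = (f G * q' + f (other F G R) * q) * E / (q * q')"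
      using nz by (simp add: field_simps)
    also have "\<dots> = sn F G R * E\<^sup>2 / (2 * q * q') + sn F G R * E\<^sup>2 / (2 * q' * q)"
      unfolding num using nz by (simp add: field_simps power2_eq_square)
    finally show "f G * (xv F G R f \<bullet> e) / (nrm G R \<bullet> e) +
       f (other F G R) * (xv F (other F G R) R f \<bullet> e) / (nrm (other F G R) R \<bullet> e) =
       sn F G R * (xv F G R f \<bullet> e)\<^sup>2 / (2 * (nrm G R \<bullet> e) * (nrm (other F G R) R \<bullet> e)) +
       sn F (other F G R) R * (xv F (other F G R) R f \<bullet> e)\<^sup>2 /
       (2 * (nrm (other F G R) R \<bullet> e) * (nrm (other F (other F G R) R) R \<bullet> e))"
      unfolding xv_other[OF F G R] t(4) o(5) q_def q'_def E_def .
  qed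
  finally show ?thesis .
qed

text \<open>Translating by a multiple of \<open>e\<close> leaves the form unchanged and subtracts
  \<open>\<kappa>\<close> from every \<open>xv F G R f \<bullet> e\<close>. This annihilates the
  terms of \<open>polygon_form\<close> with positive denominator; the others are
  nonpositive.\<close>

lemma polygon_form_nonpos:
  assumes k: "\<And>G R. G facet_of F \<Longrightarrow> R facet_of G \<Longrightarrow> (nrm G R \<bullet> e) * (nrm (other F G R) R \<bullet> e) > 0 \<Longrightarrow> xv F G R f \<bullet> e = \<kappa>"
  shows "form 0 F f f \<le> 0 \<and> (form 0 F f f = 0 \<longrightarrow> (\<forall>G R. G facet_of F \<longrightarrow> R facet_of G \<longrightarrow> xv F G R f \<bullet> e = \<kappa>))"
proof (cases "e = 0")
  case True
  then have "\<not> (R facet_of G)" if "G facet_of F" for G R using e(2)[OF that] by auto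
  then show ?thesis by (simp add: form_def facet_row_def)
next
  case False
  define a where "a = \<kappa> / (e \<bullet> e)"
  define g where "g = (\<lambda>G. 1 * f G + (- 1) * lin_val F (a *\<^sub>R e) G)"
  have dim2: "aff_dim F = int (Suc (Suc 0))" using dim by simp
  have form: "form 0 F f f = form 0 F g g"
    unfolding g_def form_comb_left form_comb_right form_lin_left[OF F dim2] form_lin_right[OF F dim2] by simp
  have ae: "a *\<^sub>R e \<in> dir F" using e(1) by (simp add: subspace_scale)
  have xg: "xv F G R g \<bullet> e = xv F G R f \<bullet> e - \<kappa>" if "G facet_of F" "R facet_of G" for G R
    using False unfolding g_def xv_comb xv_lin_polygon[OF that ae] by (simp add: inner_diff_left a_def)
  define T where "T G R = sn F G R * (xv F G R g \<bullet> e)\<^sup>2 / (2 * (nrm G R \<bullet> e) * (nrm (other F G R) R \<bullet> e))" for G R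
  have T: "T G R \<le> 0 \<and> (T G R = 0 \<longrightarrow> xv F G R g \<bullet> e = 0)" if G: "G facet_of F" and R: "R facet_of G" for G R
  proof -
    have s: "sn F G R > 0" by (rule turn(1)[OF F G R])
    have nz: "(nrm G R \<bullet> e) * (nrm (other F G R) R \<bullet> e) \<noteq> 0"
      using e(2)[OF G R] e(2)[OF other(1,2)[OF F G R]] by simp
    show ?thesis
    proof (cases "(nrm G R \<bullet> e) * (nrm (other F G R) R \<bullet> e) > 0")
      case True
      then show ?thesis using k[OF G R] xg[OF G R] by (simp add: T_def)
    next
      case False
      then have neg: "2 * (nrm G R \<bullet> e) * (nrm (other F G R) R \<bullet> e) < 0" using nz by (simp only: mult.assoc)
      have "sn F G R * (xv F G R g \<bullet> e)\<^sup>2 \<ge> 0" using s by simp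
      then show ?thesis unfolding T_def using neg s e(2)[OF G R] e(2)[OF other(1,2)[OF F G R]] by (simp add: divide_le_0_iff)
    qed
  qed
  have eq: "form 0 F f f = (\<Sum>G | G facet_of F. \<Sum>R | R facet_of G. T G R)"
    unfolding T_def form by (rule polygon_form)
  have inner: "(\<Sum>R | R facet_of G. T G R) \<le> 0" if "G facet_of F" for G
    using T that by (intro sum_nonpos) auto
  have le: "form 0 F f f \<le> 0" unfolding eq by (rule sum_nonpos) (use inner in auto)
  have "xv F G R f \<bullet> e = \<kappa>" if z: "form 0 F f f = 0" and G: "G facet_of F" and R: "R facet_of G" for G R
  proof -
    have "(\<Sum>G | G facet_of F. - (\<Sum>R | R facet_of G. T G R)) = 0" using z eq by (simp add: sum_negf)
    then have "- (\<Sum>R | R facet_of G. T G R) = 0"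
      using inner F G by (subst (asm) sum_nonneg_eq_0_iff) auto
    then have "(\<Sum>R | R facet_of G. - T G R) = 0" by (simp add: sum_negf)
    then have "- T G R = 0"
      using T[OF G] polytope_facet[OF F G] R by (subst (asm) sum_nonneg_eq_0_iff) auto
    then show ?thesis using T[OF G R] xg[OF G R] by simp
  qed
  then show ?thesis using le by blast
qed

text \<open>\<open>R\<close> is chosen to maximize \<open>e\<close> among the vertices. Since
  \<open>e\<close> does not increase towards the other end of an edge at \<open>R\<close>, the signs
  follow. They make \<open>e\<close> a positive combination of the normals of both edges at
  \<open>R\<close>, so the maximum over \<open>F\<close> is attained at \<open>R\<close>
  only.\<close>

lemma top_vertex:
  obtains G R where "G facet_of F" "R facet_of G" "nrm G R \<bullet> e > 0" "nrm (other F G R) R \<bullet> e > 0"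
    "\<And>x. x \<in> F \<Longrightarrow> x \<notin> R \<Longrightarrow> e \<bullet> x < e \<bullet> pt R"
proof -
  let ?S = "{(G, R). G facet_of F \<and> R facet_of G}"
  have "?S = Sigma {G. G facet_of F} (\<lambda>G. {R. R facet_of G})" by auto
  then have fin: "finite ?S" using F polytope_facet[OF F] by (auto intro!: finite_SigmaI)
  obtain G0 where G0: "G0 facet_of F" using facet_exists[OF F, of 1] dim by auto
  obtain R0 where R0: "R0 facet_of G0" using facet_exists[OF polytope_facet[OF F G0], of 0] polygon_dims(1)[OF G0] by auto
  have ne: "?S \<noteq> {}" using G0 R0 by auto
  let ?h = "\<lambda>z. e \<bullet> pt (snd z)"
  have "Max (?h ` ?S) \<in> ?h ` ?S" using fin ne by (intro Max_in) auto
  then obtain GR where "GR \<in> ?S" "?h GR = Max (?h ` ?S)" by (metis (no_types, lifting) imageE)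
  then have GR: "GR \<in> ?S" "\<And>z. z \<in> ?S \<Longrightarrow> e \<bullet> pt (snd z) \<le> e \<bullet> pt (snd GR)"
    using Max_ge[of "?h ` ?S"] fin by simp_all
  obtain G R where "GR = (G, R)" by (cases GR)
  then have G: "G facet_of F" and R: "R facet_of G"
    and max: "\<And>H Q. H facet_of F \<Longrightarrow> Q facet_of H \<Longrightarrow> e \<bullet> pt Q \<le> e \<bullet> pt R" using GR by auto
  have pos: "nrm H R \<bullet> e > 0" if H: "H facet_of F" and RH: "R facet_of H" for H
  proof -
    note PH = polytope_facet[OF F H]
    obtain R1 R2 where R12: "R1 \<noteq> R2" "{R. R facet_of H} = {R1, R2}"
      using segment_facets[OF PH polygon_dims(1)[OF H]] .
    then obtain Q where Q: "Q facet_of H" "Q \<noteq> R" using RH by blast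
    have QR: "pt Q \<notin> R"
    proof
      assume "pt Q \<in> R"
      moreover obtain q where "Q = {q}" using polygon_dims(2)[OF H Q(1)] aff_dim_eq_0 by blast
      ultimately have "Q \<subseteq> R" using pt_in[OF Q(1)] by auto
      then show False using facet_subset_eq[OF polytope_imp_convex[OF PH] Q(1) RH] Q(2) by blast
    qed
    have ptH: "pt Q \<in> H" "pt R \<in> H" using pt_in Q RH facet_of_imp_subset by blast+
    define w where "w = pt Q - pt R"
    define k where "k = nrm H R \<bullet> w"
    have k: "k < 0" using nrm_less[OF PH RH ptH(1) QR pt_in[OF RH]] by (simp add: k_def w_def inner_diff_right)
    have w: "w \<in> dir H" unfolding w_def using ptH by (rule diff_in_dir)
    have "w - k *\<^sub>R nrm H R \<in> dir R"
      using nrm_in_dir[OF PH RH] w nrm_self[OF PH RH] by (intro nrm_decomp[OF PH RH] subspace_diff subspace_scale) (auto simp: inner_diff_right k_def)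
    then have "w - k *\<^sub>R nrm H R = 0" by (rule vertex_dir[OF polygon_dims(2)[OF H RH]])
    then have "w = k *\<^sub>R nrm H R" by simp
    then have "e \<bullet> w = k * (nrm H R \<bullet> e)" by (simp add: inner_commute)
    moreover have "e \<bullet> w \<le> 0" using max[OF H Q(1)] by (simp add: w_def inner_diff_right)
    ultimately have "nrm H R \<bullet> e \<ge> 0" using k by (simp add: mult_le_0_iff)
    then show ?thesis using e(2)[OF H RH] by simp
  qed
  note o = other[OF F G R] and t = turn[OF F G R]
  define q q' where "q = nrm G R \<bullet> e" and "q' = nrm (other F G R) R \<bullet> e"
  have q: "q > 0" "q' > 0" unfolding q_def q'_def using pos G R o by auto
  have esplit: "e = (nrm F G \<bullet> e) *\<^sub>R nrm F G + q *\<^sub>R nrm G R"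
    unfolding q_def
    by (rule facet_plane_split[OF F G R e(1)]) (metis vertex_dir[OF polygon_dims(2)[OF G R]] inner_zero_right)
  have q': "q' = sn F G R * (nrm F G \<bullet> e) - cs F G R * q"
    by (simp add: q'_def q_def t(6) inner_diff_left)
  have ecomb: "sn F G R *\<^sub>R e = q' *\<^sub>R nrm F G + q *\<^sub>R nrm F (other F G R)"
    by (subst esplit, unfold q' t(5)) (simp add: scaleR_add_right scaleR_diff_left mult.commute)
  have "e \<bullet> x < e \<bullet> pt R" if x: "x \<in> F" "x \<notin> R" for x
  proof -
    have r: "pt R \<in> G" "pt R \<in> other F G R" using pt_in[OF R] facet_of_imp_subset[OF R] facet_of_imp_subset[OF o(2)] by blast+
    have "nrm F G \<bullet> (x - pt R) \<le> 0" "nrm F (other F G R) \<bullet> (x - pt R) \<le> 0"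
      using nrm_le[OF F G x(1) r(1)] nrm_le[OF F o(1) x(1) r(2)] by (simp_all add: inner_diff_right)
    moreover have "nrm F G \<bullet> (x - pt R) \<noteq> 0 \<or> nrm F (other F G R) \<bullet> (x - pt R) \<noteq> 0"
      using nrm_eq_iff[OF F G x(1) r(1)] nrm_eq_iff[OF F o(1) x(1) r(2)] x(2) o(4) by (auto simp: inner_diff_right)
    ultimately have "q' * (nrm F G \<bullet> (x - pt R)) + q * (nrm F (other F G R) \<bullet> (x - pt R)) < 0"
      using q by (smt (verit) mult_nonneg_nonpos mult_pos_neg)
    then have "sn F G R * (e \<bullet> (x - pt R)) < 0"
      by (metis ecomb inner_add_left inner_scaleR_left)
    then show ?thesis using t(1) by (simp add: mult_less_0_iff inner_diff_right)
  qed
  then show ?thesis using that[OF G R] q unfolding q_def q'_def by blast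
qed

text \<open>The signs again make \<open>e\<close> a positive combination of the two edge normals, so
  \<open>e\<close> is maximal at \<open>R\<close> and cannot be larger at \<open>Q\<close>.\<close>

lemma top_vertex_unique:
  assumes G: "G facet_of F" and R: "R facet_of G" and q: "nrm G R \<bullet> e > 0" "nrm (other F G R) R \<bullet> e > 0"
    and top: "Q facet_of H" "H facet_of F" "\<And>x. x \<in> F \<Longrightarrow> x \<notin> Q \<Longrightarrow> e \<bullet> x < e \<bullet> pt Q"
  shows "R = Q"
proof (rule ccontr)
  assume ne: "R \<noteq> Q"
  note o = other[OF F G R] and t = turn[OF F G R]
  have r: "pt R \<in> G" "pt R \<in> other F G R" "pt R \<in> F" "pt Q \<in> F"
    using pt_in R G top facet_of_imp_subset facet_of_imp_subset[OF o(2)] by (meson subsetD)+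
  have "pt R \<notin> Q"
  proof
    assume "pt R \<in> Q"
    moreover obtain a b where "R = {a}" "Q = {b}"
      using polygon_dims(2)[OF G R] polygon_dims(2)[OF top(2,1)] aff_dim_eq_0 by metis
    ultimately show False using ne pt_in[OF R] by auto
  qed
  then have less: "e \<bullet> pt R < e \<bullet> pt Q" using top(3) r by blast
  have esplit: "e = (nrm F G \<bullet> e) *\<^sub>R nrm F G + (nrm G R \<bullet> e) *\<^sub>R nrm G R"
    by (rule facet_plane_split[OF F G R e(1)]) (metis vertex_dir[OF polygon_dims(2)[OF G R]] inner_zero_right)
  have "sn F G R *\<^sub>R e = (nrm (other F G R) R \<bullet> e) *\<^sub>R nrm F G + (nrm G R \<bullet> e) *\<^sub>R nrm F (other F G R)"
    by (subst esplit, unfold t(5,6)) (simp add: scaleR_add_right scaleR_diff_left inner_diff_left mult.commute)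
  then have "sn F G R * (e \<bullet> (pt Q - pt R)) = (nrm (other F G R) R \<bullet> e) * (nrm F G \<bullet> (pt Q - pt R)) + (nrm G R \<bullet> e) * (nrm F (other F G R) \<bullet> (pt Q - pt R))"
    by (metis inner_add_left inner_scaleR_left)
  moreover have "nrm F G \<bullet> (pt Q - pt R) \<le> 0" "nrm F (other F G R) \<bullet> (pt Q - pt R) \<le> 0"
    using nrm_le[OF F G r(4) r(1)] nrm_le[OF F o(1) r(4) r(2)] by (simp_all add: inner_diff_right)
  ultimately have "sn F G R * (e \<bullet> (pt Q - pt R)) \<le> 0"
    using q by (smt (verit) mult_nonneg_nonpos)
  then show False using t(1) less by (simp add: mult_le_0_iff inner_diff_right)
qed

end

lemma xv_eq:
  assumes F: "polytope F" and G: "G facet_of F" "R facet_of G" and H: "H facet_of F" "R facet_of H"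
  shows "xv F G R f = xv F H R f"
proof (cases "H = G")
  case False
  then have "other F G R = H" using other_eqI[OF F G H(1) facet_of_imp_subset[OF H(2)]] by blast
  then show ?thesis using xv_other[OF F G, of f] by simp
qed simp

text \<open>\<open>L\<close> is the change of the width of \<open>F\<close> in direction
  \<open>e\<close>: the difference of the displacements of the top and the bottom vertex. Where it
  vanishes, one \<open>\<kappa>\<close> serves both vertices. So the form is nonpositive on the
  kernel of one linear functional.\<close>

lemma polygon_functional:
  assumes F: "polytope F" and dim: "aff_dim F = 2"
    and e: "e \<in> dir F" "\<And>G R. G facet_of F \<Longrightarrow> R facet_of G \<Longrightarrow> nrm G R \<bullet> e \<noteq> 0"
  obtains L where "\<And>a b f g. L (\<lambda>G. a * f G + b * g G) = a * L f + b * (L g :: real)"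
    "\<And>f. L f = 0 \<Longrightarrow> form 0 F f f \<le> 0 \<and> (form 0 F f f = 0 \<longrightarrow>
        (\<exists>\<kappa>. \<forall>G R. G facet_of F \<longrightarrow> R facet_of G \<longrightarrow> xv F G R f \<bullet> e = \<kappa>))"
proof -
  obtain G1 R1 where 1: "G1 facet_of F" "R1 facet_of G1" "nrm G1 R1 \<bullet> e > 0" "nrm (other F G1 R1) R1 \<bullet> e > 0"
    "\<And>x. x \<in> F \<Longrightarrow> x \<notin> R1 \<Longrightarrow> e \<bullet> x < e \<bullet> pt R1" using top_vertex[OF F dim e] by blast
  have e': "- e \<in> dir F" "\<And>G R. G facet_of F \<Longrightarrow> R facet_of G \<Longrightarrow> nrm G R \<bullet> - e \<noteq> 0"
    using e by (auto simp: subspace_neg)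
  obtain G2 R2 where 2: "G2 facet_of F" "R2 facet_of G2" "nrm G2 R2 \<bullet> - e > 0" "nrm (other F G2 R2) R2 \<bullet> - e > 0"
    "\<And>x. x \<in> F \<Longrightarrow> x \<notin> R2 \<Longrightarrow> - e \<bullet> x < - e \<bullet> pt R2" using top_vertex[OF F dim e'] by blast
  define L where "L f = xv F G1 R1 f \<bullet> e - xv F G2 R2 f \<bullet> e" for f
  have lin: "L (\<lambda>G. a * f G + b * g G) = a * L f + b * L g" for a b f g
    unfolding L_def xv_comb by (simp add: inner_add_left algebra_simps)
  have "form 0 F f f \<le> 0 \<and> (form 0 F f f = 0 \<longrightarrow>
        (\<exists>\<kappa>. \<forall>G R. G facet_of F \<longrightarrow> R facet_of G \<longrightarrow> xv F G R f \<bullet> e = \<kappa>))" if L: "L f = 0" for f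
  proof -
    have "form 0 F f f \<le> 0 \<and> (form 0 F f f = 0 \<longrightarrow> (\<forall>G R. G facet_of F \<longrightarrow> R facet_of G \<longrightarrow> xv F G R f \<bullet> e = xv F G1 R1 f \<bullet> e))"
    proof (rule polygon_form_nonpos[OF F dim e])
      fix G R assume G: "G facet_of F" and R: "R facet_of G"
        and q: "0 < (nrm G R \<bullet> e) * (nrm (other F G R) R \<bullet> e)"
      then consider "nrm G R \<bullet> e > 0" "nrm (other F G R) R \<bullet> e > 0" | "nrm G R \<bullet> - e > 0" "nrm (other F G R) R \<bullet> - e > 0"
        by (auto simp: zero_less_mult_iff)
      then show "xv F G R f \<bullet> e = xv F G1 R1 f \<bullet> e"
      proof cases
        case pos: 1
        have "R = R1" by (rule top_vertex_unique[OF F dim e G R pos 1(2,1,5)])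
        then show ?thesis using xv_eq[OF F G R 1(1)] 1(2) by metis
      next
        case neg: 2
        have "R = R2" by (rule top_vertex_unique[OF F dim e' G R neg 2(2,1,5)])
        then have "xv F G R f = xv F G2 R2 f" using xv_eq[OF F G R 2(1)] 2(2) by metis
        then show ?thesis using L by (simp add: L_def)
      qed
    qed (use e in auto)
    then show ?thesis by blast
  qed
  then show ?thesis using that[of L] lin by blast
qed

text \<open>The dilation \<open>h\<close> has positive form, so \<open>L\<close> does not vanish on
  it, and a multiple \<open>c\<close> of \<open>h\<close> moves \<open>f\<close> into the kernel of
  \<open>L\<close>. As \<open>f\<close> is orthogonal to \<open>h\<close>, this only adds
  \<open>c\<^sup>2\<close> times the form of \<open>h\<close>. In the equality case \<open>c\<close>
  vanishes, for every generic \<open>e\<close>.\<close>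

lemma hyperbolic_polygon:
  assumes F: "polytope F" and dim: "aff_dim F = 2"
  shows "hyperbolic 0 F"
  unfolding hyperbolic_def
proof (intro allI impI)
  fix f :: "'a set \<Rightarrow> real" assume f: "(\<Sum>G | G facet_of F. f G * vol (Suc 0) G) = 0"
  have dim2: "aff_dim F = int (Suc (Suc 0))" using dim by simp
  let ?N = "{nrm G R | G R. G facet_of F \<and> R facet_of G}"
  have "?N = (\<lambda>(G, R). nrm G R) ` (Sigma {G. G facet_of F} (\<lambda>G. {R. R facet_of G}))" by auto
  moreover have "finite (Sigma {G. G facet_of F} (\<lambda>G. {R. R facet_of G}))"
    using F polytope_facet[OF F] by (intro finite_SigmaI) simp_all
  ultimately have fin: "finite ?N" by simp
  have N: "?N \<subseteq> dir F"
    using nrm_in_dir[OF polytope_facet[OF F]] dir_mono[OF facet_of_imp_subset] by fastforce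
  have N0: "0 \<notin> ?N" using norm_nrm[OF polytope_facet[OF F]] by fastforce
  let ?h = "hgt F 0"
  have hpos: "form 0 F ?h ?h > 0" by (rule form_hgt_pos[OF F dim2])
  have key: "form 0 F f f \<le> 0 \<and> (form 0 F f f = 0 \<longrightarrow>
        (\<exists>\<kappa>. \<forall>G R. G facet_of F \<longrightarrow> R facet_of G \<longrightarrow> xv F G R f \<bullet> e = \<kappa>))"
    if e: "e \<in> dir F" "\<forall>n\<in>?N. e \<bullet> n \<noteq> 0" for e
  proof -
    have e': "nrm G R \<bullet> e \<noteq> 0" if "G facet_of F" "R facet_of G" for G R
    proof -
      have "nrm G R \<in> ?N" using that by blast
      then have "e \<bullet> nrm G R \<noteq> 0" by (rule bspec[OF e(2)])
      then show ?thesis unfolding inner_commute[of e] .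
    qed
    obtain L where L: "\<And>a b f g. L (\<lambda>G. a * f G + b * g G) = a * L f + b * (L g :: real)"
      "\<And>f. L f = 0 \<Longrightarrow> form 0 F f f \<le> 0 \<and> (form 0 F f f = 0 \<longrightarrow>
        (\<exists>\<kappa>. \<forall>G R. G facet_of F \<longrightarrow> R facet_of G \<longrightarrow> xv F G R f \<bullet> e = \<kappa>))"
      using polygon_functional[OF F dim e(1) e'] by blast
    have Lh: "L ?h \<noteq> 0" using L(2)[of ?h] hpos by linarith
    define c where "c = L f / L ?h"
    define g where "g = (\<lambda>G. 1 * f G + (- c) * ?h G)"
    have Lg: "L g = 0" unfolding g_def L(1) using Lh by (simp add: c_def)
    have fh: "form 0 F f ?h = 0" "form 0 F ?h f = 0" using form_hgt[OF F dim2, of f 0] f form_sym[OF F] by simp_all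
    have fg: "form 0 F g g = form 0 F f f + c\<^sup>2 * form 0 F ?h ?h"
      unfolding g_def form_comb_left form_comb_right using fh by (simp add: power2_eq_square)
    have gle: "form 0 F g g \<le> 0" using L(2)[OF Lg] by blast
    have cc: "c\<^sup>2 * form 0 F ?h ?h \<ge> 0" using hpos by simp
    have "c = 0" if "form 0 F f f = 0"
    proof -
      have "c\<^sup>2 * form 0 F ?h ?h = 0" using fg gle cc that by linarith
      then show ?thesis using hpos by simp
    qed
    then have "L f = 0" if "form 0 F f f = 0" using that Lh by (simp add: c_def)
    then show ?thesis using L(2)[of f] fg gle cc by auto
  qed
  obtain e0 where e0: "e0 \<in> dir F" "\<forall>n\<in>?N. e0 \<bullet> n \<noteq> 0"
    using generic_vector[OF fin subspace_dir N N0] by blast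
  have le: "form 0 F f f \<le> 0" using key[OF e0] by blast
  have "\<exists>t\<in>dir F. \<forall>G. G facet_of F \<longrightarrow> f G = nrm F G \<bullet> t" if z: "form 0 F f f = 0"
  proof -
    have same: "xv F G R f = xv F H Q f" if G: "G facet_of F" "R facet_of G" and H: "H facet_of F" "Q facet_of H" for G R H Q
    proof (rule ccontr)
      assume ne: "xv F G R f \<noteq> xv F H Q f"
      let ?w = "xv F G R f - xv F H Q f"
      have "?w \<in> dir F" using xv_in_dir[OF F] G H by (intro subspace_diff) auto
      \<comment> \<open>A generic direction can also be kept off the hyperplane orthogonal to the
        difference of two displacements, and then tells them apart.\<close>
      then have "\<exists>e\<in>dir F. \<forall>n\<in>insert ?w ?N. e \<bullet> n \<noteq> 0"
        using fin N N0 ne by (intro generic_vector) auto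
      then obtain e where e: "e \<in> dir F" "\<forall>n\<in>?N. e \<bullet> n \<noteq> 0" "e \<bullet> ?w \<noteq> 0" by auto
      then obtain \<kappa> where "\<And>G R. G facet_of F \<Longrightarrow> R facet_of G \<Longrightarrow> xv F G R f \<bullet> e = \<kappa>"
        using key[OF e(1,2)] z by blast
      from this[OF G] this[OF H] show False using e(3) by (simp add: inner_diff_right inner_commute)
    qed
    obtain G0 where G0: "G0 facet_of F" using facet_exists[OF F dim2] .
    have ex: "\<exists>R. R facet_of G" if "G facet_of F" for G
      using facet_exists[OF polytope_facet[OF F that] aff_dim_facet[OF that dim2]] by metis
    obtain R0 where R0: "R0 facet_of G0" using ex[OF G0] by blast
    have "f G = nrm F G \<bullet> xv F G0 R0 f" if G: "G facet_of F" for G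
    proof -
      obtain R where R: "R facet_of G" using ex[OF G] by blast
      show ?thesis using xv_nrm(1)[OF F G R, of f] same[OF G R G0 R0] by simp
    qed
    then show ?thesis using xv_in_dir[OF F G0 R0] by blast
  qed
  then show "form 0 F f f \<le> 0 \<and> (form 0 F f f = 0 \<longrightarrow> (\<exists>t\<in>dir F. \<forall>G. G facet_of F \<longrightarrow> f G = nrm F G \<bullet> t))"
    using le by blast
qed

section \<open>Faces of codimension three\<close>

definition flags_at :: "'a::euclidean_space set \<Rightarrow> 'a set \<Rightarrow> ('a set \<times> 'a set) set" where
  "flags_at F S = {(G, R). G facet_of F \<and> R facet_of G \<and> S facet_of R}"

text \<open>Compatible points \<open>x G\<close> have well-defined projections to the orthogonal complement of each ridge. Their
  defect turns out to be the error term of the Bochner formula at \<open>S\<close>, with \<open>z\<close> pointing from an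
  interior point of \<open>F\<close> to \<open>S\<close>.\<close>

definition compat :: "'a::euclidean_space set \<Rightarrow> 'a set \<Rightarrow> ('a set \<Rightarrow> 'a) \<Rightarrow> bool" where
  "compat F S x \<longleftrightarrow> (\<forall>(G, R)\<in>flags_at F S. nrm F G \<bullet> x (other F G R) = nrm F G \<bullet> x G \<and>
     nrm G R \<bullet> x (other F G R) = nrm G R \<bullet> x G)"

definition defect :: "'a::euclidean_space set \<Rightarrow> 'a set \<Rightarrow> ('a set \<Rightarrow> 'a) \<Rightarrow> 'a \<Rightarrow> real" where
  "defect F S x z = (\<Sum>(G, R)\<in>flags_at F S. (nrm G R \<bullet> x G) *
     ((nrm F G \<bullet> z) * (nrm R S \<bullet> x G) - (nrm R S \<bullet> z) * (nrm F G \<bullet> x G)))"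

lemma reflect_det:
  fixes s c :: real
  assumes "s\<^sup>2 + c\<^sup>2 = 1"
  shows "(c * a + s * b) * (s * a' - c * b') - (s * a - c * b) * (c * a' + s * b') = - (a * b' - b * a')"
  using assms by algebra

lemma reflect_inner:
  fixes s c :: real
  assumes "s\<^sup>2 + c\<^sup>2 = 1"
  shows "(c * a + s * b) * (c * a' + s * b') + (s * a - c * b) * (s * a' - c * b') = a * a' + b * b'"
  using assms by algebra

section \<open>Frames of flags and their two exchanges\<close>

context
  fixes F S :: "'a::euclidean_space set"
  assumes F: "polytope F"
begin

lemma flagD:
  assumes "(G, R) \<in> flags_at F S"
  shows "G facet_of F" "R facet_of G" "S facet_of R" "polytope G" "polytope R"
  using assms polytope_facet F unfolding flags_at_def by blast+

lemma finite_flags_at: "finite (flags_at F S)"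
proof (rule finite_subset)
  show "flags_at F S \<subseteq> Sigma {G. G facet_of F} (\<lambda>G. {R. R facet_of G})" by (auto simp: flags_at_def)
  show "finite (Sigma {G. G facet_of F} (\<lambda>G. {R. R facet_of G}))"
    using F polytope_facet[OF F] by (intro finite_SigmaI) simp_all
qed

lemma flag_turn_upper:
  assumes fl: "(G, R) \<in> flags_at F S"
  shows "(other F G R, R) \<in> flags_at F S" "other F (other F G R) R = G"
  using other[OF F flagD(1,2)[OF fl]] flagD(3)[OF fl] by (auto simp: flags_at_def)

lemma flag_turn_lower:
  assumes fl: "(G, R) \<in> flags_at F S"
  shows "(G, other G R S) \<in> flags_at F S" "other G (other G R S) S = R"
  using other[OF flagD(4,2,3)[OF fl]] flagD(1)[OF fl] by (auto simp: flags_at_def)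

lemma frame:
  assumes fl: "(G, R) \<in> flags_at F S"
  shows "nrm F G \<bullet> nrm F G = 1" "nrm G R \<bullet> nrm G R = 1" "nrm R S \<bullet> nrm R S = 1"
    "nrm F G \<bullet> nrm G R = 0" "nrm F G \<bullet> nrm R S = 0" "nrm G R \<bullet> nrm R S = 0"
    "nrm G R \<bullet> nrm F G = 0" "nrm R S \<bullet> nrm F G = 0" "nrm R S \<bullet> nrm G R = 0"
proof -
  note D = flagD[OF fl]
  note 1 = nrm_frame[OF F D(1,2)] and 2 = nrm_frame[OF D(4,2,3)]
  have "nrm R S \<in> dir G" using nrm_in_dir[OF D(5,3)] dir_mono[OF facet_of_imp_subset[OF D(2)]] by blast
  then have 3: "nrm F G \<bullet> nrm R S = 0" by (rule nrm_orth[OF F D(1)])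
  show "nrm F G \<bullet> nrm F G = 1" "nrm G R \<bullet> nrm G R = 1" "nrm R S \<bullet> nrm R S = 1"
    "nrm F G \<bullet> nrm G R = 0" "nrm F G \<bullet> nrm R S = 0" "nrm G R \<bullet> nrm R S = 0"
    "nrm G R \<bullet> nrm F G = 0" "nrm R S \<bullet> nrm F G = 0" "nrm R S \<bullet> nrm G R = 0"
    using 1 2 3 by (simp_all add: inner_commute[of "nrm R S" "nrm F G"])
qed

lemma frame_in_dir:
  assumes fl: "(G, R) \<in> flags_at F S"
  shows "nrm F G \<in> dir F" "nrm G R \<in> dir F" "nrm R S \<in> dir F"
  using nrm_in_dir[OF F flagD(1)[OF fl]] nrm_in_dir[OF flagD(4,2)[OF fl]] nrm_in_dir[OF flagD(5,3)[OF fl]]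
    dir_mono[OF facet_of_imp_subset[OF flagD(1)[OF fl]]] dir_mono[OF facet_of_imp_subset[OF flagD(2)[OF fl]]] by auto

lemma frame_orth:
  assumes fl: "(G, R) \<in> flags_at F S" and y: "y \<in> dir S"
  shows "nrm F G \<bullet> y = 0" "nrm G R \<bullet> y = 0" "nrm R S \<bullet> y = 0"
proof -
  have "y \<in> dir R" using y dir_mono[OF facet_of_imp_subset[OF flagD(3)[OF fl]]] by blast
  moreover then have "y \<in> dir G" using dir_mono[OF facet_of_imp_subset[OF flagD(2)[OF fl]]] by blast
  ultimately show "nrm F G \<bullet> y = 0" "nrm G R \<bullet> y = 0" "nrm R S \<bullet> y = 0"
    using nrm_orth[OF F flagD(1)[OF fl]] nrm_orth[OF flagD(4,2)[OF fl]] nrm_orth[OF flagD(5,3)[OF fl] y] by blast+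
qed

text \<open>Modulo \<open>dir S\<close> the space \<open>dir F\<close> has dimension three; removing
  one normal after the other drops the remainder successively into \<open>dir G\<close>,
  \<open>dir R\<close> and \<open>dir S\<close>.\<close>

lemma frame_split:
  assumes fl: "(G, R) \<in> flags_at F S" and w: "w \<in> dir F" and orth: "\<And>y. y \<in> dir S \<Longrightarrow> w \<bullet> y = 0"
  shows "w = (nrm F G \<bullet> w) *\<^sub>R nrm F G + (nrm G R \<bullet> w) *\<^sub>R nrm G R + (nrm R S \<bullet> w) *\<^sub>R nrm R S"
proof -
  note D = flagD[OF fl] and fr = frame[OF fl]
  define y where "y = w - ((nrm F G \<bullet> w) *\<^sub>R nrm F G + (nrm G R \<bullet> w) *\<^sub>R nrm G R + (nrm R S \<bullet> w) *\<^sub>R nrm R S)"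
  have o: "nrm F G \<bullet> y = 0" "nrm G R \<bullet> y = 0" "nrm R S \<bullet> y = 0"
    by (simp_all add: y_def inner_diff_right inner_add_right fr)
  have "y \<in> dir F" unfolding y_def using w frame_in_dir[OF fl] by (intro subspace_diff subspace_add subspace_scale) auto
  then have "y \<in> dir G" using o by (intro nrm_decomp[OF F D(1)])
  then have "y \<in> dir R" using o by (intro nrm_decomp[OF D(4,2)])
  then have "y \<in> dir S" using o by (intro nrm_decomp[OF D(5,3)])
  then have "w \<bullet> y = 0" by (rule orth)
  moreover have "y \<bullet> y = w \<bullet> y - ((nrm F G \<bullet> w) * (nrm F G \<bullet> y) + (nrm G R \<bullet> w) * (nrm G R \<bullet> y) + (nrm R S \<bullet> w) * (nrm R S \<bullet> y))"
    by (subst (1) y_def) (simp add: inner_diff_left inner_add_left)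
  ultimately have "y \<bullet> y = 0" using o by simp
  then show ?thesis by (simp add: y_def)
qed

lemma frame_inner:
  assumes fl: "(G, R) \<in> flags_at F S" and w: "w \<in> dir F" and orth: "\<And>y. y \<in> dir S \<Longrightarrow> w \<bullet> y = 0"
  shows "w \<bullet> v = (nrm F G \<bullet> w) * (nrm F G \<bullet> v) + (nrm G R \<bullet> w) * (nrm G R \<bullet> v) + (nrm R S \<bullet> w) * (nrm R S \<bullet> v)"
  using arg_cong[where f = "\<lambda>w. w \<bullet> v", OF frame_split[OF assms]] by (simp only: inner_add_left inner_scaleR_left)

text \<open>A flag at \<open>S\<close> can exchange its facet or its ridge. All cancellations around
  \<open>S\<close> come from these two involutions, this one and that of \<open>lower_zero\<close>;
  no cyclic order of the facets at \<open>S\<close> is chosen.\<close>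

lemma upper_zero:
  fixes \<phi> :: "'a set \<Rightarrow> 'a set \<Rightarrow> real"
  assumes "\<And>G R. (G, R) \<in> flags_at F S \<Longrightarrow> \<phi> G R + \<phi> (other F G R) R = 0"
  shows "(\<Sum>(G, R)\<in>flags_at F S. \<phi> G R) = 0"
  by (rule sum_involution_zero[where \<iota> = "\<lambda>(G, R). (other F G R, R)"])
     (auto simp: flag_turn_upper assms)

lemma lower_zero:
  fixes \<phi> :: "'a set \<Rightarrow> 'a set \<Rightarrow> real"
  assumes "\<And>G R. (G, R) \<in> flags_at F S \<Longrightarrow> \<phi> G R + \<phi> G (other G R S) = 0"
  shows "(\<Sum>(G, R)\<in>flags_at F S. \<phi> G R) = 0"
  by (rule sum_involution_zero[where \<iota> = "\<lambda>(G, R). (G, other G R S)"])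
     (auto simp: flag_turn_lower assms)

text \<open>The bracket is a determinant in the plane of \<open>nrm G R\<close> and
  \<open>nrm R S\<close>. Exchanging the two ridges of \<open>G\<close> at \<open>S\<close> reverses
  its sign and does not affect the weight \<open>c G\<close>.\<close>

lemma corner_sym:
  fixes c :: "'a set \<Rightarrow> real"
  shows "(\<Sum>(G, R)\<in>flags_at F S. c G * ((nrm G R \<bullet> a G) * (nrm R S \<bullet> b G) - (nrm G R \<bullet> b G) * (nrm R S \<bullet> a G))) = 0"
proof (rule lower_zero)
  fix G R assume fl: "(G, R) \<in> flags_at F S"
  note t = turn[OF flagD(4,2,3)[OF fl]]
  have "(nrm G R \<bullet> a G) * (nrm R S \<bullet> b G) - (nrm G R \<bullet> b G) * (nrm R S \<bullet> a G) +
     ((nrm G (other G R S) \<bullet> a G) * (nrm (other G R S) S \<bullet> b G) - (nrm G (other G R S) \<bullet> b G) * (nrm (other G R S) S \<bullet> a G)) = 0"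
    unfolding t(5,6) inner_add_left inner_diff_left inner_scaleR_left
    using reflect_sym[OF t(2), of "nrm G R \<bullet> a G" "nrm R S \<bullet> b G" "nrm R S \<bullet> a G" "nrm G R \<bullet> b G"] by (simp add: algebra_simps)
  then show "c G * ((nrm G R \<bullet> a G) * (nrm R S \<bullet> b G) - (nrm G R \<bullet> b G) * (nrm R S \<bullet> a G)) +
     c G * ((nrm G (other G R S) \<bullet> a G) * (nrm (other G R S) S \<bullet> b G) - (nrm G (other G R S) \<bullet> b G) * (nrm (other G R S) S \<bullet> a G)) = 0"
    by (metis distrib_left mult_zero_right)
qed

text \<open>Compatibility lets both facets at \<open>R\<close> use the same projection of
  \<open>x\<close> to the plane of \<open>nrm F G\<close> and \<open>nrm G R\<close>; the
  determinant of \<open>z\<close> with this projection changes sign with the orientation of the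
  frame.\<close>

lemma ridge_antisym:
  assumes x: "compat F S x" and fl: "(G, R) \<in> flags_at F S"
  shows "(nrm F (other F G R) \<bullet> z) * (nrm (other F G R) R \<bullet> x (other F G R)) - (nrm (other F G R) R \<bullet> z) * (nrm F (other F G R) \<bullet> x (other F G R))
    = - ((nrm F G \<bullet> z) * (nrm G R \<bullet> x G) - (nrm G R \<bullet> z) * (nrm F G \<bullet> x G))"
proof -
  note t = turn[OF F flagD(1,2)[OF fl]]
  have c: "nrm F G \<bullet> x (other F G R) = nrm F G \<bullet> x G" "nrm G R \<bullet> x (other F G R) = nrm G R \<bullet> x G"
    using x fl by (auto simp: compat_def)
  show ?thesis unfolding t(5,6) inner_add_left inner_diff_left inner_scaleR_left c
    by (rule reflect_det[OF t(2)])
qed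

lemma compat_const: "compat F S (\<lambda>_. t)"
  by (simp add: compat_def)

lemma compat_shift: "compat F S x \<Longrightarrow> compat F S (\<lambda>G. x G - t)"
  by (auto simp: compat_def inner_diff_right)

lemma ridge_zero:
  assumes x: "compat F S x"
  shows "(\<Sum>(G, R)\<in>flags_at F S. c R * ((nrm F G \<bullet> z) * (nrm G R \<bullet> x G) - (nrm G R \<bullet> z) * (nrm F G \<bullet> x G))) = (0::real)"
  by (rule upper_zero) (simp add: ridge_antisym[OF x] algebra_simps)

text \<open>The two expressions differ by a sum of the kind treated in \<open>corner_sym\<close>. In
  this form the bracket is the determinant that is odd under exchange of facets.\<close>

lemma defect_alt:
  "defect F S x z = (\<Sum>(G, R)\<in>flags_at F S. (nrm R S \<bullet> x G) * ((nrm F G \<bullet> z) * (nrm G R \<bullet> x G) - (nrm G R \<bullet> z) * (nrm F G \<bullet> x G)))"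
proof -
  have "defect F S x z - (\<Sum>(G, R)\<in>flags_at F S. (nrm R S \<bullet> x G) * ((nrm F G \<bullet> z) * (nrm G R \<bullet> x G) - (nrm G R \<bullet> z) * (nrm F G \<bullet> x G)))
    = (\<Sum>(G, R)\<in>flags_at F S. (nrm F G \<bullet> x G) * ((nrm G R \<bullet> z) * (nrm R S \<bullet> x G) - (nrm G R \<bullet> x G) * (nrm R S \<bullet> z)))"
    unfolding defect_def sum_subtractf[symmetric] by (rule sum.cong) (auto simp: algebra_simps)
  also have "\<dots> = 0" by (rule corner_sym[where a = "\<lambda>_. z" and b = x])
  finally show ?thesis by simp
qed

text \<open>This permits normalizing \<open>x\<close> at one ridge. The defect is quadratic in
  \<open>x\<close>, so a shift produces two mixed terms and one in \<open>t\<close> alone. In the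
  mixed term \<open>C\<close> the weight depends on both members of the flag; it is split into five
  sums, each of which cancels at a ridge or at a corner.\<close>

lemma defect_shift:
  assumes x: "compat F S x"
  shows "defect F S (\<lambda>G. x G - t) z = defect F S x z"
proof -
  let ?om = "\<lambda>y G R. (nrm F G \<bullet> z) * (nrm G R \<bullet> y G) - (nrm G R \<bullet> z) * (nrm F G \<bullet> y G)"
  have A: "(\<Sum>(G, R)\<in>flags_at F S. (nrm R S \<bullet> t) * ?om x G R) = 0" by (rule ridge_zero[OF x])
  have B: "(\<Sum>(G, R)\<in>flags_at F S. (nrm R S \<bullet> t) * ?om (\<lambda>_. t) G R) = 0" by (rule ridge_zero[OF compat_const])
  have C1: "(\<Sum>(G, R)\<in>flags_at F S. (nrm F G \<bullet> z) * ((nrm G R \<bullet> t) * (nrm R S \<bullet> x G) - (nrm G R \<bullet> x G) * (nrm R S \<bullet> t))) = 0"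
    by (rule corner_sym[where a = "\<lambda>_. t" and b = x])
  have C2: "(\<Sum>(G, R)\<in>flags_at F S. (nrm F G \<bullet> t) * ((nrm G R \<bullet> z) * (nrm R S \<bullet> x G) - (nrm G R \<bullet> x G) * (nrm R S \<bullet> z))) = 0"
    by (rule corner_sym[where a = "\<lambda>_. z" and b = x])
  have C3: "(\<Sum>(G, R)\<in>flags_at F S. (nrm R S \<bullet> z) * ((nrm F G \<bullet> t) * (nrm G R \<bullet> x G) - (nrm G R \<bullet> t) * (nrm F G \<bullet> x G))) = 0"
    by (rule ridge_zero[OF x])
  have C4: "(\<Sum>(G, R)\<in>flags_at F S. (nrm F G \<bullet> x G) * ((nrm G R \<bullet> z) * (nrm R S \<bullet> t) - (nrm G R \<bullet> t) * (nrm R S \<bullet> z))) = 0"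
    by (rule corner_sym[where a = "\<lambda>_. z" and b = "\<lambda>_. t"])
  have C: "(\<Sum>(G, R)\<in>flags_at F S. (nrm R S \<bullet> x G) * ?om (\<lambda>_. t) G R) = 0"
  proof -
    have "(\<Sum>(G, R)\<in>flags_at F S. (nrm R S \<bullet> x G) * ?om (\<lambda>_. t) G R) =
      (\<Sum>(G, R)\<in>flags_at F S. (nrm F G \<bullet> z) * ((nrm G R \<bullet> t) * (nrm R S \<bullet> x G) - (nrm G R \<bullet> x G) * (nrm R S \<bullet> t)))
      - (\<Sum>(G, R)\<in>flags_at F S. (nrm F G \<bullet> t) * ((nrm G R \<bullet> z) * (nrm R S \<bullet> x G) - (nrm G R \<bullet> x G) * (nrm R S \<bullet> z)))
      + (\<Sum>(G, R)\<in>flags_at F S. (nrm R S \<bullet> t) * ?om x G R)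
      - (\<Sum>(G, R)\<in>flags_at F S. (nrm R S \<bullet> z) * ((nrm F G \<bullet> t) * (nrm G R \<bullet> x G) - (nrm G R \<bullet> t) * (nrm F G \<bullet> x G)))
      + (\<Sum>(G, R)\<in>flags_at F S. (nrm F G \<bullet> x G) * ((nrm G R \<bullet> z) * (nrm R S \<bullet> t) - (nrm G R \<bullet> t) * (nrm R S \<bullet> z)))"
      unfolding sum_subtractf[symmetric] sum.distrib[symmetric] by (rule sum.cong) (auto simp: algebra_simps)
    then show ?thesis unfolding A C1 C2 C3 C4 by simp
  qed
  have "defect F S (\<lambda>G. x G - t) z = defect F S x z
      - (\<Sum>(G, R)\<in>flags_at F S. (nrm R S \<bullet> t) * ?om x G R)
      - (\<Sum>(G, R)\<in>flags_at F S. (nrm R S \<bullet> x G) * ?om (\<lambda>_. t) G R)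
      + (\<Sum>(G, R)\<in>flags_at F S. (nrm R S \<bullet> t) * ?om (\<lambda>_. t) G R)"
    unfolding defect_alt sum_subtractf[symmetric] sum.distrib[symmetric]
    by (rule sum.cong) (auto simp: algebra_simps)
  then show ?thesis unfolding A B C by simp
qed

text \<open>Modulo \<open>dir S\<close>, points of \<open>R\<close> seen from \<open>S\<close> are
  nonpositive multiples of \<open>nrm R S\<close>. So the normal points out of the cone of
  \<open>F\<close> at \<open>S\<close> along the ray of \<open>R\<close>, and the facet inequality
  of \<open>G\<close> on \<open>R\<close> becomes a sign.\<close>

lemma facet_inner_nrm:
  assumes G: "G facet_of F" "S \<subseteq> G" and R: "polytope R" "S facet_of R" "R \<subseteq> F"
  shows "nrm F G \<bullet> nrm R S \<ge> 0" "nrm F G \<bullet> nrm R S = 0 \<longleftrightarrow> R \<subseteq> G"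
proof -
  have ptS: "pt S \<in> S" "pt S \<in> R" "pt S \<in> G" using pt_in[OF R(2)] facet_of_imp_subset[OF R(2)] G by auto
  have key: "nrm F G \<bullet> (r - pt S) = (nrm R S \<bullet> (r - pt S)) * (nrm F G \<bullet> nrm R S)" if "r \<in> R" for r
  proof -
    let ?w = "r - pt S"
    have w: "?w \<in> dir R" using that ptS by (intro diff_in_dir)
    have "?w - (nrm R S \<bullet> ?w) *\<^sub>R nrm R S \<in> dir R"
      by (rule subspace_diff[OF subspace_dir w subspace_scale[OF subspace_dir nrm_in_dir[OF R(1,2)]]])
    moreover have "nrm R S \<bullet> (?w - (nrm R S \<bullet> ?w) *\<^sub>R nrm R S) = 0"
      using nrm_self[OF R(1,2)] by (simp add: inner_diff_right)
    ultimately have "?w - (nrm R S \<bullet> ?w) *\<^sub>R nrm R S \<in> dir S" by (rule nrm_decomp[OF R(1,2)])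
    then have "nrm F G \<bullet> (?w - (nrm R S \<bullet> ?w) *\<^sub>R nrm R S) = 0"
      using nrm_orth[OF F G(1)] dir_mono[OF G(2)] by blast
    then show ?thesis by (simp add: inner_diff_right)
  qed
  have "R \<noteq> S" using R(2) by auto
  then obtain r where r: "r \<in> R" "r \<notin> S" using facet_of_imp_subset[OF R(2)] by blast
  have neg: "nrm R S \<bullet> (r - pt S) < 0" using nrm_less[OF R(1,2) r ptS(1)] by (simp add: inner_diff_right)
  have "nrm F G \<bullet> (r - pt S) \<le> 0" using nrm_le[OF F G(1) _ ptS(3)] r R(3) by (simp add: inner_diff_right subset_iff)
  then have "(nrm R S \<bullet> (r - pt S)) * (nrm F G \<bullet> nrm R S) \<le> 0" using key[OF r(1)] by simp
  then show "nrm F G \<bullet> nrm R S \<ge> 0" using neg by (simp add: mult_le_0_iff)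
  show "nrm F G \<bullet> nrm R S = 0 \<longleftrightarrow> R \<subseteq> G"
  proof
    assume z: "nrm F G \<bullet> nrm R S = 0"
    show "R \<subseteq> G"
    proof
      fix x assume x: "x \<in> R"
      then have "nrm F G \<bullet> x = nrm F G \<bullet> pt S" using key[OF x] z by (simp add: inner_diff_right)
      then show "x \<in> G" using nrm_eq_iff[OF F G(1) _ ptS(3)] x R(3) by blast
    qed
  next
    assume "R \<subseteq> G"
    then have "nrm R S \<in> dir G" using nrm_in_dir[OF R(1,2)] dir_mono by blast
    then show "nrm F G \<bullet> nrm R S = 0" by (rule nrm_orth[OF F G(1)])
  qed
qed

lemma flag_subset:
  assumes "(G, R) \<in> flags_at F S"
  shows "R \<subseteq> G" "S \<subseteq> R" "S \<subseteq> G" "R \<subseteq> F" "G \<subseteq> F"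
  using assms facet_of_imp_subset unfolding flags_at_def by blast+

lemma ridge_subset_eq:
  assumes "(G, R) \<in> flags_at F S" "(G', R') \<in> flags_at F S" "R \<subseteq> R'"
  shows "R = R'"
proof (rule ccontr)
  assume ne: "R \<noteq> R'"
  have "R face_of F" using flagD(1,2)[OF assms(1)] face_of_trans facet_of_imp_face_of by blast
  then have "R face_of R'" using face_of_subset assms(3) flag_subset(4)[OF assms(2)] by blast
  then have "aff_dim R < aff_dim R'"
    using face_of_aff_dim_lt polytope_imp_convex[OF flagD(5)[OF assms(2)]] ne by blast
  moreover have "aff_dim R = aff_dim F - 2" "aff_dim R' = aff_dim F - 2"
    using flagD(1,2)[OF assms(1)] flagD(1,2)[OF assms(2)] by (simp_all add: facet_of_def)
  ultimately show False by simp
qed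

lemma facet_above_ridge:
  assumes "(G0, R0) \<in> flags_at F S" "G facet_of F" "R0 \<subseteq> G"
  shows "G = G0 \<or> G = other F G0 R0"
  using other_eqI[OF F flagD(1,2)[OF assms(1)] assms(2,3)] by blast

text \<open>The defect is linear in \<open>z\<close>, so it suffices to treat \<open>z = nrm R0 S\<close> for the ridges \<open>R0\<close> at \<open>S\<close>
  (\<open>cone_decomposition\<close>). The auxiliary direction \<open>e\<close> below lies between the normals of the two facets
  at \<open>R0\<close>; this makes \<open>nrm R S \<bullet> e\<close> positive for all other ridges and turns twice the defect into
  a sum of nonnegative squares.\<close>

context
  fixes x G0 R0 and \<alpha> \<beta> :: real
  assumes x: "compat F S x" and fl0: "(G0, R0) \<in> flags_at F S"
    and x0: "nrm F G0 \<bullet> x G0 = 0" "nrm G0 R0 \<bullet> x G0 = 0"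
    and pos: "\<alpha> > 0" "\<beta> > 0"
begin

private definition "e = \<alpha> *\<^sub>R nrm F G0 + \<beta> *\<^sub>R nrm F (other F G0 R0)"
private definition "z = nrm R0 S"

private lemma e_dir: "e \<in> dir F" and e_orth: "y \<in> dir S \<Longrightarrow> e \<bullet> y = 0" and e_z: "e \<bullet> z = 0"
proof -
  note fl1 = flag_turn_upper(1)[OF fl0]
  show "e \<in> dir F" unfolding e_def using frame_in_dir(1)[OF fl0] frame_in_dir(1)[OF fl1]
    by (simp add: subspace_add subspace_scale)
  show "y \<in> dir S \<Longrightarrow> e \<bullet> y = 0" unfolding e_def
    using frame_orth(1)[OF fl0] frame_orth(1)[OF fl1] by (simp add: inner_add_left)
  show "e \<bullet> z = 0" unfolding e_def z_def using frame(5)[OF fl0] frame(5)[OF fl1] by (simp add: inner_add_left)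
qed

private lemma e_inner:
  assumes fl: "(G, R) \<in> flags_at F S"
  shows "e \<bullet> v = (nrm F G \<bullet> e) * (nrm F G \<bullet> v) + (nrm G R \<bullet> e) * (nrm G R \<bullet> v) + (nrm R S \<bullet> e) * (nrm R S \<bullet> v)"
  by (rule frame_inner[OF fl e_dir e_orth])

text \<open>The two facets at \<open>R0\<close> meet in \<open>R0\<close> only, so another ridge
  misses at least one of them and has a positive product with its normal.\<close>

private lemma q_pos:
  assumes fl: "(G, R) \<in> flags_at F S" and ne: "R \<noteq> R0"
  shows "nrm R S \<bullet> e > 0"
proof -
  let ?G1 = "other F G0 R0"
  note fl1 = flag_turn_upper(1)[OF fl0] and D = flagD[OF fl]
  note i0 = facet_inner_nrm[OF flagD(1)[OF fl0] flag_subset(3)[OF fl0] D(5,3) flag_subset(4)[OF fl]]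
  note i1 = facet_inner_nrm[OF flagD(1)[OF fl1] flag_subset(3)[OF fl1] D(5,3) flag_subset(4)[OF fl]]
  have "\<not> (R \<subseteq> G0 \<and> R \<subseteq> ?G1)"
    using ridge_subset_eq[OF fl fl0] ne other(4)[OF F flagD(1,2)[OF fl0]] by blast
  then have "nrm F G0 \<bullet> nrm R S > 0 \<or> nrm F ?G1 \<bullet> nrm R S > 0" using i0 i1 by (metis order_le_less)
  then have "\<alpha> * (nrm F G0 \<bullet> nrm R S) + \<beta> * (nrm F ?G1 \<bullet> nrm R S) > 0"
    using i0(1) i1(1) pos by (smt (verit) mult_nonneg_nonneg mult_pos_pos)
  then show ?thesis by (simp add: e_def inner_add_right inner_commute)
qed

private lemma h_pos:
  assumes fl: "(G, R) \<in> flags_at F S" and ne: "\<not> R0 \<subseteq> G"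
  shows "nrm F G \<bullet> z > 0"
  using facet_inner_nrm[OF flagD(1)[OF fl] flag_subset(3)[OF fl] flagD(5,3)[OF fl0] flag_subset(4)[OF fl0]] ne
  unfolding z_def by linarith

private lemma at_ridge:
  assumes fl: "(G, R) \<in> flags_at F S" and sub: "R0 \<subseteq> G"
  shows "nrm F G \<bullet> z = 0" "nrm F G \<bullet> x G = 0"
proof -
  show "nrm F G \<bullet> z = 0"
    using facet_inner_nrm(2)[OF flagD(1)[OF fl] flag_subset(3)[OF fl] flagD(5,3)[OF fl0] flag_subset(4)[OF fl0]] sub
    unfolding z_def by blast
  have "nrm F (other F G0 R0) \<bullet> x (other F G0 R0) = 0"
  proof -
    have "nrm F G0 \<bullet> x (other F G0 R0) = 0" "nrm G0 R0 \<bullet> x (other F G0 R0) = 0"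
      using x fl0 x0 by (auto simp: compat_def)
    then show ?thesis unfolding turn(5)[OF F flagD(1,2)[OF fl0]] by (simp add: inner_add_left)
  qed
  then show "nrm F G \<bullet> x G = 0" using facet_above_ridge[OF fl0 flagD(1)[OF fl] sub] x0(1) by blast
qed

text \<open>If the facet of a flag contains \<open>R0\<close>, then \<open>z\<close> and
  \<open>x\<close> have no component along its normal and the flag contributes nothing to the
  defect. On the remaining flags both ridges of the facet differ from \<open>R0\<close>, so that all
  denominators below are positive.\<close>

private definition "B = {(G, R) \<in> flags_at F S. \<not> R0 \<subseteq> G}"

private abbreviation "om G R \<equiv> (nrm F G \<bullet> z) * (nrm G R \<bullet> x G) - (nrm G R \<bullet> z) * (nrm F G \<bullet> x G)"

private lemma B_D:
  assumes "(G, R) \<in> B"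
  shows "(G, R) \<in> flags_at F S" "\<not> R0 \<subseteq> G" "R \<noteq> R0" "nrm R S \<bullet> e > 0" "(G, other G R S) \<in> B"
    "nrm (other G R S) S \<bullet> e > 0"
proof -
  show 1: "(G, R) \<in> flags_at F S" "\<not> R0 \<subseteq> G" using assms by (auto simp: B_def)
  then show 2: "R \<noteq> R0" using flag_subset(1) by blast
  show "nrm R S \<bullet> e > 0" using q_pos 1 2 by blast
  show 3: "(G, other G R S) \<in> B" using 1 flag_turn_lower(1) by (auto simp: B_def)
  then have "other G R S \<noteq> R0" "(G, other G R S) \<in> flags_at F S" using flag_subset(1) by (auto simp: B_def)
  then show "nrm (other G R S) S \<bullet> e > 0" using q_pos by blast
qed

text \<open>The equation \<open>e \<bullet> z = 0\<close> and the expansion of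
  \<open>e \<bullet> x G\<close> eliminate the components along \<open>nrm R S\<close>, at the price
  of a division by \<open>nrm R S \<bullet> e\<close>.\<close>

private lemma defect_B:
  "defect F S x z = (\<Sum>(G, R)\<in>B. (nrm F G \<bullet> z) * (e \<bullet> x G) * ((nrm G R \<bullet> x G) / (nrm R S \<bullet> e))
     - (nrm G R \<bullet> e) * (nrm G R \<bullet> x G) * (om G R / (nrm R S \<bullet> e)))"
proof -
  have "defect F S x z = (\<Sum>(G, R)\<in>B. (nrm G R \<bullet> x G) *
     ((nrm F G \<bullet> z) * (nrm R S \<bullet> x G) - (nrm R S \<bullet> z) * (nrm F G \<bullet> x G)))"
    unfolding defect_def
    by (rule sum.mono_neutral_right[OF finite_flags_at]) (auto simp: B_def at_ridge)
  also have "\<dots> = (\<Sum>(G, R)\<in>B. (nrm F G \<bullet> z) * (e \<bullet> x G) * ((nrm G R \<bullet> x G) / (nrm R S \<bullet> e))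
     - (nrm G R \<bullet> e) * (nrm G R \<bullet> x G) * (om G R / (nrm R S \<bullet> e)))"
  proof (rule sum.cong[OF refl], clarify)
    fix G R assume "(G, R) \<in> B"
    note b = B_D[OF this]
    define q p e0 h gz \<zeta> f g t where "q = nrm R S \<bullet> e" and "p = nrm G R \<bullet> e" and "e0 = nrm F G \<bullet> e"
      and "h = nrm F G \<bullet> z" and "gz = nrm G R \<bullet> z" and "\<zeta> = nrm R S \<bullet> z"
      and "f = nrm F G \<bullet> x G" and "g = nrm G R \<bullet> x G" and "t = nrm R S \<bullet> x G"
    have q: "q > 0" using b(4) by (simp add: q_def)
    have ez: "e0 * h + p * gz + q * \<zeta> = 0" using e_inner[OF b(1), of z] e_z
      unfolding q_def p_def e0_def h_def gz_def \<zeta>_def by simp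
    have ex: "e \<bullet> x G = e0 * f + p * g + q * t" using e_inner[OF b(1), of "x G"]
      unfolding q_def p_def e0_def f_def g_def t_def by simp
    have "q * (g * (h * t - \<zeta> * f)) = h * (e \<bullet> x G) * g - p * g * (h * g - gz * f)"
      unfolding ex using ez by algebra
    then have "g * (h * t - \<zeta> * f) = (h * (e \<bullet> x G) * g - p * g * (h * g - gz * f)) / q"
      using q by (simp add: eq_divide_eq mult.commute)
    also have "\<dots> = h * (e \<bullet> x G) * (g / q) - p * g * ((h * g - gz * f) / q)"
      by (subst diff_divide_distrib) simp
    finally show "nrm G R \<bullet> x G * (nrm F G \<bullet> z * (nrm R S \<bullet> x G) - nrm R S \<bullet> z * (nrm F G \<bullet> x G)) =
       nrm F G \<bullet> z * (e \<bullet> x G) * (nrm G R \<bullet> x G / (nrm R S \<bullet> e)) -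
       nrm G R \<bullet> e * (nrm G R \<bullet> x G) * ((nrm F G \<bullet> z * (nrm G R \<bullet> x G) - nrm G R \<bullet> z * (nrm F G \<bullet> x G)) / (nrm R S \<bullet> e))"
      unfolding q_def p_def e0_def h_def gz_def \<zeta>_def f_def g_def t_def .
  qed
  finally show ?thesis .
qed

text \<open>When the facet is exchanged, the first factor persists, being the inner product of
  projections of \<open>e\<close> and \<open>x G\<close> to one plane; the determinant changes sign
  and the denominator depends on \<open>R\<close> alone. The exchange need not preserve
  \<open>B\<close>, so the sum is extended by vanishing terms to all flags with
  \<open>R \<noteq> R0\<close>.\<close>

private lemma ridge_cancel:
  "(\<Sum>(G, R)\<in>B. ((nrm F G \<bullet> e) * (nrm F G \<bullet> x G) + (nrm G R \<bullet> e) * (nrm G R \<bullet> x G)) * (om G R / (nrm R S \<bullet> e))) = 0"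
proof -
  let ?C = "{(G, R) \<in> flags_at F S. R \<noteq> R0}"
  let ?\<phi> = "\<lambda>(G, R). ((nrm F G \<bullet> e) * (nrm F G \<bullet> x G) + (nrm G R \<bullet> e) * (nrm G R \<bullet> x G)) * (om G R / (nrm R S \<bullet> e))"
  have "sum ?\<phi> ?C = sum ?\<phi> B"
  proof (rule sum.mono_neutral_right)
    show "finite ?C" by (rule finite_subset[OF _ finite_flags_at]) auto
    show "B \<subseteq> ?C" using B_D(1,3) by auto
    show "\<forall>i\<in>?C - B. ?\<phi> i = 0" by (auto simp: B_def at_ridge)
  qed
  moreover have "sum ?\<phi> ?C = 0"
  proof (rule sum_involution_zero[where \<iota> = "\<lambda>(G, R). (other F G R, R)"])
    fix GR assume "GR \<in> ?C"
    then obtain G R where GR: "GR = (G, R)" and fl: "(G, R) \<in> flags_at F S" and ne: "R \<noteq> R0" by auto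
    show "(case GR of (G, R) \<Rightarrow> (other F G R, R)) \<in> ?C" using GR flag_turn_upper[OF fl] ne by auto
    show "(case case GR of (G, R) \<Rightarrow> (other F G R, R) of (G, R) \<Rightarrow> (other F G R, R)) = GR"
      using GR flag_turn_upper[OF fl] by auto
    note t = turn[OF F flagD(1,2)[OF fl]]
    have c: "nrm F G \<bullet> x (other F G R) = nrm F G \<bullet> x G" "nrm G R \<bullet> x (other F G R) = nrm G R \<bullet> x G"
      using x fl by (auto simp: compat_def)
    have inner: "(nrm F (other F G R) \<bullet> e) * (nrm F (other F G R) \<bullet> x (other F G R)) + (nrm (other F G R) R \<bullet> e) * (nrm (other F G R) R \<bullet> x (other F G R))
      = (nrm F G \<bullet> e) * (nrm F G \<bullet> x G) + (nrm G R \<bullet> e) * (nrm G R \<bullet> x G)"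
      unfolding t(5,6) inner_add_left inner_diff_left inner_scaleR_left c by (rule reflect_inner[OF t(2)])
    show "?\<phi> GR + ?\<phi> (case GR of (G, R) \<Rightarrow> (other F G R, R)) = 0"
      unfolding GR prod.case inner ridge_antisym[OF x fl] by (simp only: minus_divide_left[symmetric] mult_minus_right add.right_inverse)
  qed
  ultimately show ?thesis by simp
qed

text \<open>After \<open>ridge_cancel\<close> is added, the two flags with the same facet are
  paired. Over the common denominator everything cancels except the square of
  \<open>e \<bullet> x G\<close>.\<close>

private lemma defect_twice:
  "2 * defect F S x z = (\<Sum>(G, R)\<in>B. (nrm F G \<bullet> z) * sn G R S * (e \<bullet> x G)\<^sup>2 / ((nrm R S \<bullet> e) * (nrm (other G R S) S \<bullet> e)))"
proof -
  define \<psi> where "\<psi> = (\<lambda>(G, R). (nrm F G \<bullet> z) * (e \<bullet> x G) * ((nrm G R \<bullet> x G) / (nrm R S \<bullet> e))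
     + (nrm F G \<bullet> e) * (nrm F G \<bullet> x G) * (om G R / (nrm R S \<bullet> e)))"
  let ?\<iota> = "\<lambda>(G, R). (G, other G R S)"
  have D: "defect F S x z = sum \<psi> B"
  proof -
    have "sum \<psi> B = defect F S x z + (\<Sum>(G, R)\<in>B. ((nrm F G \<bullet> e) * (nrm F G \<bullet> x G) + (nrm G R \<bullet> e) * (nrm G R \<bullet> x G)) * (om G R / (nrm R S \<bullet> e)))"
      unfolding defect_B \<psi>_def sum.distrib[symmetric] by (rule sum.cong) (auto simp: distrib_right add_divide_distrib)
    then show ?thesis using ridge_cancel by simp
  qed
  have "sum \<psi> B = (\<Sum>GR\<in>B. \<psi> (?\<iota> GR))"
    by (rule sum_involution) (auto simp: B_D(5) flag_turn_lower(2)[OF B_D(1)])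
  then have "2 * defect F S x z = (\<Sum>GR\<in>B. \<psi> GR + \<psi> (?\<iota> GR))" unfolding D sum.distrib by simp
  also have "\<dots> = (\<Sum>(G, R)\<in>B. (nrm F G \<bullet> z) * sn G R S * (e \<bullet> x G)\<^sup>2 / ((nrm R S \<bullet> e) * (nrm (other G R S) S \<bullet> e)))"
  proof (rule sum.cong[OF refl], clarify)
    fix G R assume "(G, R) \<in> B"
    note b = B_D[OF this]
    note t = turn[OF flagD(4,2,3)[OF b(1)]]
    define q p e0 h gz \<zeta> f g tt s c where "q = nrm R S \<bullet> e" and "p = nrm G R \<bullet> e" and "e0 = nrm F G \<bullet> e"
      and "h = nrm F G \<bullet> z" and "gz = nrm G R \<bullet> z" and "\<zeta> = nrm R S \<bullet> z"
      and "f = nrm F G \<bullet> x G" and "g = nrm G R \<bullet> x G" and "tt = nrm R S \<bullet> x G" and "s = sn G R S" and "c = cs G R S"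
    define q2 where "q2 = nrm (other G R S) S \<bullet> e"
    have q: "q > 0" "q2 > 0" using b(4,6) by (simp_all add: q_def q2_def)
    have q2: "q2 = s * p - c * q" by (simp add: q2_def t(6) inner_diff_left s_def p_def c_def q_def)
    have sc: "s\<^sup>2 + c\<^sup>2 = 1" using t(2) by (simp add: s_def c_def)
    have g2: "nrm G (other G R S) \<bullet> x G = c * g + s * tt" "nrm G (other G R S) \<bullet> z = c * gz + s * \<zeta>"
      by (simp_all add: t(5) inner_add_left s_def c_def g_def tt_def gz_def \<zeta>_def)
    have ez: "e0 * h + p * gz + q * \<zeta> = 0" using e_inner[OF b(1), of z] e_z
      unfolding q_def p_def e0_def h_def gz_def \<zeta>_def by simp
    have ex: "e \<bullet> x G = e0 * f + p * g + q * tt" using e_inner[OF b(1), of "x G"]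
      unfolding q_def p_def e0_def f_def g_def tt_def by simp
    have 1: "\<psi> (G, R) = (h * (e \<bullet> x G) * g + e0 * f * (h * g - gz * f)) / q"
      unfolding \<psi>_def prod.case q_def p_def e0_def h_def gz_def \<zeta>_def f_def g_def tt_def by (simp add: add_divide_distrib)
    have 2: "\<psi> (G, other G R S) = (h * (e \<bullet> x G) * (c * g + s * tt) + e0 * f * (h * (c * g + s * tt) - (c * gz + s * \<zeta>) * f)) / q2"
      unfolding \<psi>_def prod.case g2 unfolding q2_def p_def e0_def h_def f_def g_def tt_def
      by (simp only: times_divide_eq_right add_divide_distrib[symmetric])
    have "(h * (e \<bullet> x G) * g + e0 * f * (h * g - gz * f)) * q2 + (h * (e \<bullet> x G) * (c * g + s * tt) + e0 * f * (h * (c * g + s * tt) - (c * gz + s * \<zeta>) * f)) * q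
       = h * s * (e \<bullet> x G)\<^sup>2"
      unfolding ex q2 using ez by algebra
    then have "\<psi> (G, R) + \<psi> (G, other G R S) = h * s * (e \<bullet> x G)\<^sup>2 / (q * q2)"
      unfolding 1 2 using q by (simp add: add_frac_eq)
    then show "\<psi> (G, R) + \<psi> (G, other G R S) = nrm F G \<bullet> z * sn G R S * (e \<bullet> x G)\<^sup>2 / ((nrm R S \<bullet> e) * (nrm (other G R S) S \<bullet> e))"
      unfolding h_def s_def q_def q2_def .
  qed
  finally show ?thesis .
qed

lemma ridge_defect_aux:
  "defect F S x (nrm R0 S) \<ge> 0"
  "defect F S x (nrm R0 S) = 0 \<Longrightarrow> (G, R) \<in> flags_at F S \<Longrightarrow> \<not> R0 \<subseteq> G \<Longrightarrow>
     \<alpha> * (nrm F G0 \<bullet> x G) + \<beta> * (nrm F (other F G0 R0) \<bullet> x G) = 0"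
proof -
  let ?T = "\<lambda>(G, R). (nrm F G \<bullet> z) * sn G R S * (e \<bullet> x G)\<^sup>2 / ((nrm R S \<bullet> e) * (nrm (other G R S) S \<bullet> e))"
  have c: "(nrm F G \<bullet> z) * sn G R S > 0" "(nrm R S \<bullet> e) * (nrm (other G R S) S \<bullet> e) > 0" if "(G, R) \<in> B" for G R
    using B_D[OF that] h_pos turn(1)[OF flagD(4,2,3)] by simp_all
  have nn: "?T GR \<ge> 0" if "GR \<in> B" for GR
    using that c[of "fst GR" "snd GR"] by (cases GR) (auto intro!: divide_nonneg_pos)
  show "defect F S x (nrm R0 S) \<ge> 0"
    using defect_twice sum_nonneg[of B ?T, OF nn] unfolding z_def by linarith
  assume z0: "defect F S x (nrm R0 S) = 0" and fl: "(G, R) \<in> flags_at F S" and ne: "\<not> R0 \<subseteq> G"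
  have inB: "(G, R) \<in> B" using fl ne by (simp add: B_def)
  have "finite B" unfolding B_def by (rule finite_subset[OF _ finite_flags_at]) auto
  then have "?T (G, R) = 0"
    using sum_nonneg_eq_0_iff[of B ?T] nn defect_twice z0 inB unfolding z_def by fastforce
  then have "e \<bullet> x G = 0" using c[OF inB] by (simp only: prod.case divide_eq_0_iff mult_eq_0_iff power2_eq_square) auto
  then show "\<alpha> * (nrm F G0 \<bullet> x G) + \<beta> * (nrm F (other F G0 R0) \<bullet> x G) = 0"
    by (simp add: e_def inner_add_left)
qed

end

lemma ridge_defect:
  assumes x: "compat F S x" and fl0: "(G0, R0) \<in> flags_at F S"
  shows "defect F S x (nrm R0 S) \<ge> 0"
    "defect F S x (nrm R0 S) = 0 \<Longrightarrow> (G, R) \<in> flags_at F S \<Longrightarrow> nrm F G0 \<bullet> x G = nrm F G0 \<bullet> x G0"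
proof -
  note fr = frame[OF fl0]
  define t where "t = (nrm F G0 \<bullet> x G0) *\<^sub>R nrm F G0 + (nrm G0 R0 \<bullet> x G0) *\<^sub>R nrm G0 R0"
  define y where "y = (\<lambda>G. x G - t)"
  have t: "nrm F G0 \<bullet> t = nrm F G0 \<bullet> x G0" "nrm G0 R0 \<bullet> t = nrm G0 R0 \<bullet> x G0"
    by (simp_all add: t_def inner_add_right fr)
  have y: "compat F S y" unfolding y_def by (rule compat_shift[OF x])
  have y0: "nrm F G0 \<bullet> y G0 = 0" "nrm G0 R0 \<bullet> y G0 = 0" using t by (simp_all add: y_def inner_diff_right)
  have eq: "defect F S y z = defect F S x z" for z unfolding y_def by (rule defect_shift[OF x])
  show "defect F S x (nrm R0 S) \<ge> 0"
    using ridge_defect_aux(1)[OF y fl0 y0, of 1 1] eq by simp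
  assume z0: "defect F S x (nrm R0 S) = 0" and fl: "(G, R) \<in> flags_at F S"
  show "nrm F G0 \<bullet> x G = nrm F G0 \<bullet> x G0"
  proof (cases "R0 \<subseteq> G")
    case True
    then have "G = G0 \<or> G = other F G0 R0" by (rule facet_above_ridge[OF fl0 flagD(1)[OF fl]])
    then show ?thesis using x fl0 by (auto simp: compat_def)
  next
    case False
    have z0': "defect F S y (nrm R0 S) = 0" using z0 eq by simp
    \<comment> \<open>Two independent choices of \<open>\<alpha>\<close> and \<open>\<beta>\<close>
      separate the two normals at \<open>R0\<close>.\<close>
    have "1 * (nrm F G0 \<bullet> y G) + 1 * (nrm F (other F G0 R0) \<bullet> y G) = 0"
      by (rule ridge_defect_aux(2)[OF y fl0 y0 _ _ z0' fl False]) simp_all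
    moreover have "2 * (nrm F G0 \<bullet> y G) + 1 * (nrm F (other F G0 R0) \<bullet> y G) = 0"
      by (rule ridge_defect_aux(2)[OF y fl0 y0 _ _ z0' fl False]) simp_all
    ultimately have "nrm F G0 \<bullet> y G = 0" by simp
    then show ?thesis using t(1) by (simp add: y_def inner_diff_right)
  qed
qed

text \<open>Moving from \<open>p\<close> in the direction \<open>nrm R0 S\<close> one leaves the cone of \<open>F\<close> at \<open>S\<close> through a facet \<open>G1\<close>,
  whose cone at \<open>S\<close> is spanned by its two ridges. As \<open>R0\<close> is arbitrary and its coefficient is
  positive, a vanishing defect is detected at every ridge.\<close>

lemma cone_decomposition:
  assumes fl0: "(G0, R0) \<in> flags_at F S" and p: "p \<in> rel_interior F"
  obtains l0 a b G1 R1 R2 where "l0 > 0" "a \<ge> 0" "b \<ge> 0" "(G1, R1) \<in> flags_at F S" "(G1, R2) \<in> flags_at F S"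
    "\<And>v. v \<in> dir F \<Longrightarrow> (\<And>y. y \<in> dir S \<Longrightarrow> v \<bullet> y = 0) \<Longrightarrow>
       v \<bullet> (pt S - p) = l0 * (v \<bullet> nrm R0 S) + a * (v \<bullet> nrm R1 S) + b * (v \<bullet> nrm R2 S)"
proof -
  define z where "z = pt S - p"
  define N where "N = fst ` flags_at F S"
  have hpos: "nrm F G \<bullet> z > 0" if "(G, R) \<in> flags_at F S" for G R
  proof -
    note D = flagD[OF that]
    have "pt S \<in> G" using pt_in[OF D(3)] flag_subset(3)[OF that] by blast
    then have "nrm F G \<bullet> pt G = nrm F G \<bullet> pt S" by (rule nrm_pt[OF F D(1)])
    then show ?thesis using rel_interior_nrm_less[OF F p D(1)] by (simp add: z_def inner_diff_right)
  qed
  have tau: "nrm F G \<bullet> nrm R0 S \<ge> 0" "nrm F G \<bullet> nrm R0 S = 0 \<longleftrightarrow> R0 \<subseteq> G" if "(G, R) \<in> flags_at F S" for G R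
    by (rule facet_inner_nrm[OF flagD(1)[OF that] flag_subset(3)[OF that] flagD(5,3)[OF fl0] flag_subset(4)[OF fl0]])+
  \<comment> \<open>The facets at \<open>S\<close> that do not contain \<open>R0\<close>; only these
    can bound the motion along \<open>nrm R0 S\<close>. One of them lies across the other ridge of
    \<open>G0\<close>.\<close>
  define M where "M = {G \<in> N. nrm F G \<bullet> nrm R0 S > 0}"
  have finM: "finite M" unfolding M_def N_def using finite_flags_at by simp
  have "M \<noteq> {}"
  proof -
    let ?R1 = "other G0 R0 S" and ?G1 = "other F G0 (other G0 R0 S)"
    note f1 = flag_turn_lower(1)[OF fl0]
    note f2 = flag_turn_upper(1)[OF f1]
    have "\<not> R0 \<subseteq> ?G1"
    proof
      assume "R0 \<subseteq> ?G1"
      then have "R0 \<subseteq> ?R1" using other(4)[OF F flagD(1,2)[OF f1]] flag_subset(1)[OF fl0] by blast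
      then have "R0 = ?R1" by (rule ridge_subset_eq[OF fl0 f1])
      then show False using other(3)[OF flagD(4,2,3)[OF fl0]] by simp
    qed
    then have "nrm F ?G1 \<bullet> nrm R0 S > 0" using tau[OF f2] by linarith
    then have "?G1 \<in> M" using f2 unfolding M_def N_def by force
    then show ?thesis by blast
  qed
  define r where "r = (\<lambda>G. (nrm F G \<bullet> z) / (nrm F G \<bullet> nrm R0 S))"
  define l0 where "l0 = Min (r ` M)"
  have "l0 \<in> r ` M" unfolding l0_def using finM \<open>M \<noteq> {}\<close> by (intro Min_in) auto
  then obtain G1 where G1: "G1 \<in> M" "l0 = r G1" by blast
  have min: "l0 \<le> r G" if "G \<in> M" for G unfolding l0_def using finM that by (intro Min_le) auto
  obtain R1 where fl1: "(G1, R1) \<in> flags_at F S" using G1(1) unfolding M_def N_def by force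
  have lpos: "l0 > 0" using hpos[OF fl1] G1 by (simp add: r_def M_def)
  define w where "w = z - l0 *\<^sub>R nrm R0 S"
  have w1: "nrm F G1 \<bullet> w = 0" using G1 by (simp add: w_def inner_diff_right r_def M_def)
  have wnn: "nrm F G \<bullet> w \<ge> 0" if fl: "(G, R) \<in> flags_at F S" for G R
  proof (cases "nrm F G \<bullet> nrm R0 S > 0")
    case True
    have "G \<in> N" using fl unfolding N_def by force
    then have "l0 \<le> r G" using True min by (simp add: M_def)
    then show ?thesis using True by (simp add: w_def inner_diff_right r_def pos_le_divide_eq)
  next
    case False
    then have "nrm F G \<bullet> nrm R0 S = 0" using tau(1)[OF fl] by simp
    then show ?thesis using hpos[OF fl] by (simp add: w_def inner_diff_right)
  qed
  have rid: "nrm G1 R \<bullet> w \<ge> 0" if fl: "(G1, R) \<in> flags_at F S" for R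
  proof -
    note t = turn[OF F flagD(1,2)[OF fl]]
    have "nrm F (other F G1 R) \<bullet> w \<ge> 0" by (rule wnn[OF flag_turn_upper(1)[OF fl]])
    then have "sn F G1 R * (nrm G1 R \<bullet> w) \<ge> 0" unfolding t(5) using w1 by (simp add: inner_add_left)
    then show ?thesis using t(1) by (simp add: zero_le_mult_iff)
  qed
  define R2 where "R2 = other G1 R1 S"
  have fl2: "(G1, R2) \<in> flags_at F S" unfolding R2_def by (rule flag_turn_lower(1)[OF fl1])
  note t = turn[OF flagD(4,2,3)[OF fl1], folded R2_def]
  define s c where "s = sn G1 R1 S" and "c = cs G1 R1 S"
  have s: "s > 0" using t(1) by (simp add: s_def)
  \<comment> \<open>In \<open>G1\<close> the normal of one ridge is orthogonal to the direction of
    that ridge and has product \<open>s\<close> with the direction of the other, so each coefficient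
    is read off from the opposite ridge.\<close>
  define a b where "a = (nrm G1 R2 \<bullet> w) / s" and "b = (nrm G1 R1 \<bullet> w) / s"
  have ab: "a \<ge> 0" "b \<ge> 0" using rid[OF fl1] rid[OF fl2] s by (simp_all add: a_def b_def)
  define w' where "w' = w - a *\<^sub>R nrm R1 S - b *\<^sub>R nrm R2 S"
  note fr = frame[OF fl1] and fr2 = frame[OF fl2]
  have o1: "nrm F G1 \<bullet> w' = 0" by (simp add: w'_def inner_diff_right w1 fr fr2)
  have o2: "nrm G1 R1 \<bullet> w' = 0"
    using s by (simp add: w'_def inner_diff_right fr t(6) b_def s_def)
  have o3: "nrm R1 S \<bullet> w' = 0"
  proof -
    have "nrm R1 S \<bullet> w' = nrm R1 S \<bullet> w - a + b * c"
      by (simp add: w'_def inner_diff_right fr t(6) c_def)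
    moreover have "a * s = c * (nrm G1 R1 \<bullet> w) + s * (nrm R1 S \<bullet> w)"
      unfolding a_def using s by (simp add: t(5) inner_add_left c_def s_def)
    then have "a = c * b + nrm R1 S \<bullet> w" using s by (simp add: b_def field_simps)
    ultimately show ?thesis by simp
  qed
  have "v \<bullet> (pt S - p) = l0 * (v \<bullet> nrm R0 S) + a * (v \<bullet> nrm R1 S) + b * (v \<bullet> nrm R2 S)"
    if v: "v \<in> dir F" "\<And>y. y \<in> dir S \<Longrightarrow> v \<bullet> y = 0" for v
  proof -
    have "v \<bullet> w' = 0" using frame_inner[OF fl1 v, of w'] o1 o2 o3 by simp
    then show ?thesis unfolding z_def[symmetric] by (simp add: w'_def w_def inner_diff_right)
  qed
  then show ?thesis using that[OF lpos ab fl1 fl2] by blast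
qed

lemma defect_comb:
  assumes "\<And>v. v \<in> dir F \<Longrightarrow> (\<And>y. y \<in> dir S \<Longrightarrow> v \<bullet> y = 0) \<Longrightarrow>
       v \<bullet> z = l0 * (v \<bullet> z0) + a * (v \<bullet> z1) + b * (v \<bullet> z2)"
  shows "defect F S x z = l0 * defect F S x z0 + a * defect F S x z1 + b * defect F S x z2"
  unfolding defect_def sum_distrib_left sum.distrib[symmetric]
proof (rule sum.cong[OF refl], clarify)
  fix G R assume fl: "(G, R) \<in> flags_at F S"
  have "nrm F G \<bullet> z = l0 * (nrm F G \<bullet> z0) + a * (nrm F G \<bullet> z1) + b * (nrm F G \<bullet> z2)"
    by (rule assms[OF frame_in_dir(1)[OF fl] frame_orth(1)[OF fl]])
  moreover have "nrm R S \<bullet> z = l0 * (nrm R S \<bullet> z0) + a * (nrm R S \<bullet> z1) + b * (nrm R S \<bullet> z2)"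
    by (rule assms[OF frame_in_dir(3)[OF fl] frame_orth(3)[OF fl]])
  ultimately show "nrm G R \<bullet> x G * (nrm F G \<bullet> z * (nrm R S \<bullet> x G) - nrm R S \<bullet> z * (nrm F G \<bullet> x G)) =
       l0 * (nrm G R \<bullet> x G * (nrm F G \<bullet> z0 * (nrm R S \<bullet> x G) - nrm R S \<bullet> z0 * (nrm F G \<bullet> x G))) +
       a * (nrm G R \<bullet> x G * (nrm F G \<bullet> z1 * (nrm R S \<bullet> x G) - nrm R S \<bullet> z1 * (nrm F G \<bullet> x G))) +
       b * (nrm G R \<bullet> x G * (nrm F G \<bullet> z2 * (nrm R S \<bullet> x G) - nrm R S \<bullet> z2 * (nrm F G \<bullet> x G)))"
    by (simp add: algebra_simps)
qed

text \<open>In the equality case the jump of \<open>x\<close> across a ridge is orthogonal to the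
  normals of all facets at \<open>S\<close>. By \<open>turn\<close> these generate the ridge normals
  inside \<open>G\<close>, and those generate \<open>nrm R S\<close>.\<close>

lemma defect_nonneg:
  assumes x: "compat F S x" and p: "p \<in> rel_interior F"
  shows "defect F S x (pt S - p) \<ge> 0"
    "defect F S x (pt S - p) = 0 \<Longrightarrow> (G, R) \<in> flags_at F S \<Longrightarrow> nrm R S \<bullet> x (other F G R) = nrm R S \<bullet> x G"
proof -
  have main: "defect F S x (pt S - p) \<ge> 0 \<and> (defect F S x (pt S - p) = 0 \<longrightarrow>
      (\<forall>(G, R)\<in>flags_at F S. nrm F G0 \<bullet> x G = nrm F G0 \<bullet> x G0))" if fl0: "(G0, R0) \<in> flags_at F S" for G0 R0
  proof -
    obtain l0 a b G1 R1 R2 where l: "l0 > 0" "a \<ge> 0" "b \<ge> 0" "(G1, R1) \<in> flags_at F S" "(G1, R2) \<in> flags_at F S"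
      and comb: "\<And>v. v \<in> dir F \<Longrightarrow> (\<And>y. y \<in> dir S \<Longrightarrow> v \<bullet> y = 0) \<Longrightarrow>
       v \<bullet> (pt S - p) = l0 * (v \<bullet> nrm R0 S) + a * (v \<bullet> nrm R1 S) + b * (v \<bullet> nrm R2 S)"
      using cone_decomposition[OF fl0 p] by blast
    have eq: "defect F S x (pt S - p) = l0 * defect F S x (nrm R0 S) + a * defect F S x (nrm R1 S) + b * defect F S x (nrm R2 S)"
      by (rule defect_comb[OF comb])
    have nn: "defect F S x (nrm R0 S) \<ge> 0" "a * defect F S x (nrm R1 S) \<ge> 0" "b * defect F S x (nrm R2 S) \<ge> 0"
      using ridge_defect(1)[OF x fl0] ridge_defect(1)[OF x l(4)] ridge_defect(1)[OF x l(5)] l by simp_all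
    then have "defect F S x (pt S - p) \<ge> 0" unfolding eq using l(1) by simp
    moreover have "defect F S x (nrm R0 S) = 0" if "defect F S x (pt S - p) = 0"
    proof -
      have "l0 * defect F S x (nrm R0 S) \<ge> 0" using nn l(1) by simp
      then have "l0 * defect F S x (nrm R0 S) = 0" using nn that unfolding eq by linarith
      then show ?thesis using l(1) by simp
    qed
    ultimately show ?thesis using ridge_defect(2)[OF x fl0] by blast
  qed
  show "defect F S x (pt S - p) \<ge> 0"
  proof (cases "flags_at F S = {}")
    case True
    then show ?thesis by (simp add: defect_def)
  next
    case False
    then obtain G0 R0 where "(G0, R0) \<in> flags_at F S" by auto
    then show ?thesis using main by blast
  qed
  assume z: "defect F S x (pt S - p) = 0" and fl: "(G, R) \<in> flags_at F S"
  let ?w = "x (other F G R) - x G"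
  have u: "nrm F H \<bullet> ?w = 0" if "(H, Q) \<in> flags_at F S" for H Q
  proof -
    have "\<forall>(G, R)\<in>flags_at F S. nrm F H \<bullet> x G = nrm F H \<bullet> x H" using main[OF that] z by blast
    then have "nrm F H \<bullet> x G = nrm F H \<bullet> x H" "nrm F H \<bullet> x (other F G R) = nrm F H \<bullet> x H"
      using fl flag_turn_upper(1)[OF fl] by blast+
    then show ?thesis by (simp add: inner_diff_right)
  qed
  have n: "nrm G Q \<bullet> ?w = 0" if f: "(G, Q) \<in> flags_at F S" for Q
  proof -
    note t = turn[OF F flagD(1,2)[OF f]]
    have "nrm F (other F G Q) \<bullet> ?w = 0" "nrm F G \<bullet> ?w = 0" using u[OF flag_turn_upper(1)[OF f]] u[OF f] by auto
    then have "sn F G Q * (nrm G Q \<bullet> ?w) = 0" unfolding t(5) by (simp add: inner_add_left)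
    then show ?thesis using t(1) by simp
  qed
  note t = turn[OF flagD(4,2,3)[OF fl]]
  have "nrm G (other G R S) \<bullet> ?w = 0" "nrm G R \<bullet> ?w = 0" using n[OF flag_turn_lower(1)[OF fl]] n[OF fl] by auto
  then have "sn G R S * (nrm R S \<bullet> ?w) = 0" unfolding t(5) by (simp add: inner_add_left)
  then have "nrm R S \<bullet> ?w = 0" using t(1) by simp
  then show "nrm R S \<bullet> x (other F G R) = nrm R S \<bullet> x G" by (simp add: inner_diff_right)
qed

end

section \<open>Spectral estimate and connectedness of the facets\<close>

lemma linear_coeff_zero:
  fixes b c :: real
  assumes "\<And>t. 0 \<le> b * t + c * t\<^sup>2"
  shows "b = 0"
proof (rule ccontr)
  assume b: "b \<noteq> 0"
  define d where "d = \<bar>c\<bar> + 1"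
  have d: "d > 0" "c < d" by (auto simp: d_def)
  have "b * (- b / d) + c * (- b / d)\<^sup>2 = (b\<^sup>2 / d) * (c / d - 1)"
    using d by (simp add: power2_eq_square field_simps)
  also have "\<dots> < 0" using b d by (intro mult_pos_neg) (auto simp: divide_simps)
  finally show False using assms[of "- b / d"] by linarith
qed

text \<open>Functions carry the product topology over the whole type, so the coordinates outside
  \<open>I\<close> are pinned to \<open>0\<close> and Tychonoff's theorem applies.\<close>

lemma compact_box_fun:
  fixes B :: "'i \<Rightarrow> real"
  shows "compact {g. \<forall>i. g i \<in> (if i \<in> I then {- B i..B i} else {0})}"
proof -
  have "compactin (product_topology (\<lambda>i. euclidean) UNIV) (PiE UNIV (\<lambda>i. if i \<in> I then {- B i..B i} else {0}))"
    unfolding compactin_PiE by auto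
  then show ?thesis by (simp add: euclidean_product_topology PiE_UNIV_domain Pi_def)
qed

text \<open>If the largest value \<open>l\<close> of the normalized form on the complement of \<open>h\<close> were positive, it would be
  an eigenvalue with \<open>l \<le> l\<^sup>2\<close> by \<open>bochner\<close>, and \<open>l < 1\<close> by \<open>gap\<close> and \<open>gap_eq\<close>.\<close>

lemma negative_on_complement:
  fixes a :: "'i \<Rightarrow> 'i \<Rightarrow> real" and p h :: "'i \<Rightarrow> real" and I :: "'i set"
  defines "A \<equiv> \<lambda>f i. \<Sum>j\<in>I. a i j * f j"
  defines "Q \<equiv> \<lambda>f. \<Sum>i\<in>I. f i * A f i"
  assumes fin: "finite I" and sym: "\<And>i j. i \<in> I \<Longrightarrow> j \<in> I \<Longrightarrow> a i j = a j i"
    and p: "\<And>i. i \<in> I \<Longrightarrow> p i > 0" and h: "\<And>i. i \<in> I \<Longrightarrow> h i > 0"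
    and eig: "\<And>i. i \<in> I \<Longrightarrow> A h i = p i * h i"
    and gap: "\<And>f. Q f \<le> (\<Sum>i\<in>I. p i * (f i)\<^sup>2)"
    and gap_eq: "\<And>f. Q f = (\<Sum>i\<in>I. p i * (f i)\<^sup>2) \<Longrightarrow> \<exists>c. \<forall>i\<in>I. f i = c * h i"
    and bochner: "\<And>f. Q f \<le> (\<Sum>i\<in>I. (A f i)\<^sup>2 / p i)"
    and f: "(\<Sum>i\<in>I. p i * (h i * f i)) = 0"
  shows "Q f \<le> 0"
proof (rule ccontr)
  assume "\<not> Q f \<le> 0"
  then have Qf: "Q f > 0" by simp
  define B where "B = (\<lambda>f g. \<Sum>i\<in>I. f i * A g i)"
  define N where "N = (\<lambda>f g. \<Sum>i\<in>I. p i * (f i * g i))"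
  have QB: "Q f = B f f" for f by (simp add: Q_def B_def)
  have A_comb: "A (\<lambda>i. f i + t * g i) i = A f i + t * A g i" for f g t i
    by (simp add: A_def sum.distrib sum_distrib_left algebra_simps)
  have B_right: "B k (\<lambda>i. f i + t * g i) = B k f + t * B k g" for f g k t
    by (simp add: B_def A_comb sum.distrib sum_distrib_left algebra_simps)
  have B_left: "B (\<lambda>i. f i + t * g i) k = B f k + t * B g k" for f g k t
    by (simp add: B_def sum.distrib sum_distrib_left algebra_simps)
  have B_sym: "B f g = B g f" for f g
  proof -
    have "B f g = (\<Sum>i\<in>I. \<Sum>j\<in>I. f i * (a i j * g j))" by (simp add: B_def A_def sum_distrib_left)
    also have "\<dots> = (\<Sum>j\<in>I. \<Sum>i\<in>I. f i * (a i j * g j))" by (rule sum.swap)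
    also have "\<dots> = B g f" by (simp add: B_def A_def sum_distrib_left) (intro sum.cong refl, simp add: sym)
    finally show ?thesis .
  qed
  have N_right: "N k (\<lambda>i. f i + t * g i) = N k f + t * N k g" for f g k t
    by (simp add: N_def sum.distrib sum_distrib_left algebra_simps)
  have N_sym: "N f g = N g f" for f g by (simp add: N_def mult.commute)
  have N_left: "N (\<lambda>i. f i + t * g i) k = N f k + t * N g k" for f g k t
    using N_right N_sym by metis
  have NN: "N f f = (\<Sum>i\<in>I. p i * (f i)\<^sup>2)" for f by (simp add: N_def power2_eq_square)
  have N_nonneg: "N f f \<ge> 0" for f unfolding NN using p by (intro sum_nonneg) (simp add: less_imp_le)
  have N_zero: "f i = 0" if "N f f = 0" "i \<in> I" for f i
  proof -
    have "p i * (f i)\<^sup>2 = 0"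
      using that fin p unfolding NN by (subst (asm) sum_nonneg_eq_0_iff) (auto simp: less_imp_le)
    then show ?thesis using p[OF that(2)] by simp
  qed
  \<comment> \<open>The unit sphere of the weighted norm in the complement of \<open>h\<close>. The
    box holds it because \<open>p i * (g i)\<^sup>2 \<le> 1\<close> and an absolute value is at most
    one plus the square.\<close>
  define K where "K = {g. \<forall>i. g i \<in> (if i \<in> I then {- (1 + 1 / p i)..1 + 1 / p i} else {0})} \<inter> {g. N g g = 1} \<inter> {g. N h g = 0}"
  have contN: "continuous_on UNIV (\<lambda>g. N (k g) g)" if "\<And>i. continuous_on UNIV (\<lambda>g. k g i)" for k :: "('i \<Rightarrow> real) \<Rightarrow> 'i \<Rightarrow> real"
    unfolding N_def using that by (intro continuous_intros) auto
  have cl: "closed {g. N g g = 1}" "closed {g. N h g = 0}"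
    using contN[of "\<lambda>g. g"] contN[of "\<lambda>g. h"] by (auto intro!: closed_Collect_eq continuous_intros)
  have compK: "compact K" unfolding K_def
    by (intro compact_Int_closed[OF compact_Int_closed[OF compact_box_fun]] cl)
  have normalize: "\<exists>g'\<in>K. \<exists>c>0. \<forall>i\<in>I. g i = c * g' i" if "N h g = 0" "N g g > 0" for g
  proof -
    define c where "c = sqrt (N g g)"
    have c: "c > 0" "c\<^sup>2 = N g g" using that by (simp_all add: c_def)
    define g' where "g' = (\<lambda>i. if i \<in> I then g i / c else 0)"
    have "N g' g' = N g g / c\<^sup>2" unfolding NN by (simp add: g'_def power_divide sum_divide_distrib)
    then have 1: "N g' g' = 1" using c that by simp
    have "N h g' = N h g / c" by (simp add: N_def g'_def sum_divide_distrib)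
    then have 2: "N h g' = 0" using that by simp
    have "\<bar>g' i\<bar> \<le> 1 + 1 / p i" if i: "i \<in> I" for i
    proof -
      have "p i * (g' i)\<^sup>2 \<le> N g' g'" unfolding NN
        using fin i p by (intro member_le_sum) (simp_all add: less_imp_le)
      then have "(g' i)\<^sup>2 \<le> 1 / p i" using 1 p[OF i] by (simp add: field_simps)
      moreover have "\<bar>g' i\<bar> \<le> 1 + (g' i)\<^sup>2"
        using sum_squares_bound[of 1 "\<bar>g' i\<bar>"] by simp
      ultimately show ?thesis by linarith
    qed
    then have "g' i \<in> {- (1 + 1 / p i)..1 + 1 / p i}" if "i \<in> I" for i
      using that unfolding abs_le_iff atLeastAtMost_iff by (metis minus_le_iff)
    moreover have "g' i = 0" if "i \<notin> I" for i using that by (simp add: g'_def)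
    ultimately have "\<forall>i. g' i \<in> (if i \<in> I then {- (1 + 1 / p i)..1 + 1 / p i} else {0})"
      by (simp del: atLeastAtMost_iff)
    then have "g' \<in> K" using 1 2 by (simp add: K_def)
    moreover have "\<forall>i\<in>I. g i = c * g' i" using c by (simp add: g'_def)
    ultimately show ?thesis using c by blast
  qed
  have scale: "Q g = c\<^sup>2 * Q g'" "N g g = c\<^sup>2 * N g' g'" if "\<forall>i\<in>I. g i = c * g' i" for g g' c
    using that unfolding Q_def A_def NN
    by (auto simp: sum_distrib_left power2_eq_square algebra_simps intro!: sum.cong)
  have "N f f \<noteq> 0"
  proof
    assume "N f f = 0"
    then have "Q f = 0" using N_zero[of f] by (simp add: Q_def)
    then show False using Qf by simp
  qed
  then have Nf: "N f f > 0" using N_nonneg[of f] by simp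
  have fK: "N h f = 0" using f by (simp add: N_def)
  obtain f' c where f': "f' \<in> K" "c > 0" "\<forall>i\<in>I. f i = c * f' i" using normalize[OF fK Nf] by blast
  have contQ: "continuous_on K Q" unfolding Q_def A_def
    by (intro continuous_intros continuous_on_subset[OF continuous_on_product_coordinates]) auto
  obtain g where g: "g \<in> K" "\<And>k. k \<in> K \<Longrightarrow> Q k \<le> Q g"
    using continuous_attains_sup[OF compK _ contQ] f' by blast
  define l where "l = Q g"
  have gN: "N g g = 1" "N h g = 0" using g(1) by (auto simp: K_def)
  have "c\<^sup>2 * Q f' > 0" using Qf scale(1)[OF f'(3)] by simp
  then have "Q f' > 0" using f'(2) by (simp add: zero_less_mult_iff)
  then have l: "l > 0" using g(2)[OF f'(1)] by (simp add: l_def)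
  have max: "Q k \<le> l * N k k" if k: "N h k = 0" for k
  proof (cases "N k k = 0")
    case True
    then have "Q k = 0" using N_zero[of k] by (simp add: Q_def)
    then show ?thesis using True by simp
  next
    case False
    then have "N k k > 0" using N_nonneg[of k] by simp
    then obtain k' c where k': "k' \<in> K" "\<forall>i\<in>I. k i = c * k' i" using normalize[OF k] by blast
    have "Q k = c\<^sup>2 * Q k'" "N k k = c\<^sup>2" using scale[OF k'(2)] k'(1) by (auto simp: K_def)
    then show ?thesis using g(2)[OF k'(1)] by (simp add: l_def mult.commute mult_right_mono)
  qed
  \<comment> \<open>First variation: along \<open>g + t k\<close> the inequality \<open>max\<close>
    is an equality at \<open>t = 0\<close>, so its linear coefficient vanishes.\<close>
  have lagrange: "B g k = l * N g k" if k: "N h k = 0" for k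
  proof -
    have "0 \<le> (2 * (l * N g k - B g k)) * t + (l * N k k - Q k) * t\<^sup>2" for t
    proof -
      have "N h (\<lambda>i. g i + t * k i) = 0" using k gN by (simp add: N_right)
      from max[OF this] have "B g g + t * B k g + t * (B g k + t * B k k) \<le> l * (N g g + t * N k g + t * (N g k + t * N k k))"
        unfolding QB B_right B_left N_right N_left by (simp add: algebra_simps)
      moreover have "B g g = l" "N g g = 1" "B k g = B g k" "N k g = N g k" using B_sym N_sym gN by (auto simp: l_def QB)
      ultimately show ?thesis unfolding QB by (simp add: algebra_simps power2_eq_square)
    qed
    from linear_coeff_zero[OF this] show ?thesis by simp
  qed
  have "I \<noteq> {}" using Qf by (auto simp: Q_def)
  then have Nh: "N h h > 0" unfolding NN using fin p h by (intro sum_pos mult_pos_pos zero_less_power) auto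
  have Bh: "B g h = 0"
  proof -
    have "B g h = N h g" unfolding B_def N_def by (rule sum.cong) (simp_all add: eig mult.commute mult.left_commute)
    then show ?thesis using gN by simp
  qed
  have all: "B g k = l * N g k" for k
  proof -
    define t where "t = - (N h k / N h h)"
    have "N h (\<lambda>i. k i + t * h i) = 0" unfolding N_right using Nh by (simp add: t_def)
    from lagrange[OF this] show ?thesis using Bh gN(2) N_sym[of g h] by (simp add: B_right N_right)
  qed
  have Ag: "A g i = l * (p i * g i)" if i: "i \<in> I" for i
  proof -
    let ?d = "\<lambda>j. if j = i then 1 else 0 :: real"
    have "B ?d g = A g i" unfolding B_def using fin i by (simp add: if_distrib[of "\<lambda>x. x * _"] sum.delta cong: if_cong)
    moreover have "N g ?d = p i * g i" unfolding N_def using fin i by (simp add: if_distrib[of "\<lambda>x. _ * x"] sum.delta cong: if_cong)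
    ultimately show ?thesis using all[of ?d] B_sym by metis
  qed
  have "(\<Sum>i\<in>I. (A g i)\<^sup>2 / p i) = (\<Sum>i\<in>I. l\<^sup>2 * (p i * (g i)\<^sup>2))"
    using Ag p by (intro sum.cong refl) (simp add: power2_eq_square field_simps order.strict_implies_not_eq)
  also have "\<dots> = l\<^sup>2" using gN(1) unfolding NN by (simp add: sum_distrib_left[symmetric])
  finally have "l \<le> l * l" using bochner[of g] by (simp add: l_def power2_eq_square)
  then have "l \<ge> 1" using l by simp
  moreover have "l \<le> 1" using gap[of g] gN(1) unfolding NN l_def by simp
  ultimately have "Q g = (\<Sum>i\<in>I. p i * (g i)\<^sup>2)" using gN(1) unfolding NN l_def by simp
  then obtain t where t: "\<forall>i\<in>I. g i = t * h i" using gap_eq by blast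
  then have "N h g = t * N h h" by (simp add: N_def sum_distrib_left algebra_simps cong: sum.cong)
  then have "t = 0" using gN Nh by simp
  then have "N g g = 0" using t by (simp add: N_def)
  then show False using gN by simp
qed

section \<open>Rays through a polytope and adjacency of facets\<close>

lemma facet_beyond:
  assumes F: "polytope F" "F \<noteq> {}" and x: "x \<in> affine hull F" "x \<notin> F"
  obtains G where "G facet_of F" "nrm F G \<bullet> (x - pt G) > 0"
proof -
  obtain q where q: "q \<in> rel_interior F" using F rel_interior_eq_empty[OF polytope_imp_convex[OF F(1)]] by blast
  have qF: "q \<in> F" using q rel_interior_subset by blast
  have "q + (x - q) \<in> affine hull F" "x - q \<noteq> 0" using x qF by auto
  then obtain d where d: "0 < d" "q + d *\<^sub>R (x - q) \<in> rel_frontier F"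
     "\<And>e. 0 \<le> e \<Longrightarrow> e < d \<Longrightarrow> q + e *\<^sub>R (x - q) \<in> rel_interior F"
    using ray_to_rel_frontier[OF polytope_imp_bounded[OF F(1)] q] by metis
  have fr: "rel_frontier F \<subseteq> F" using polytope_imp_closed[OF F(1)] by (auto simp: rel_frontier_def)
  have "\<not> 1 < d" using d(3)[of 1] x(2) rel_interior_subset by auto
  moreover have "d \<noteq> 1" using d(2) fr x(2) by auto
  ultimately have d1: "d < 1" by simp
  obtain G where G: "G facet_of F" "q + d *\<^sub>R (x - q) \<in> G"
    using d(2) rel_frontier_of_polyhedron[OF polytope_imp_polyhedron[OF F(1)]] by auto
  have "nrm F G \<bullet> (pt G - q) > 0" by (rule rel_interior_nrm_less[OF F(1) q G(1)])
  moreover have eq: "nrm F G \<bullet> pt G = nrm F G \<bullet> (q + d *\<^sub>R (x - q))" by (rule nrm_pt[OF F(1) G])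
  ultimately have 1: "d * (nrm F G \<bullet> (x - q)) > 0" by (simp add: inner_diff_right inner_add_right)
  then have "nrm F G \<bullet> (x - q) > 0" using d(1) by (simp add: zero_less_mult_iff)
  then have "nrm F G \<bullet> (x - q) > d * (nrm F G \<bullet> (x - q))" using d1 by simp
  then have "nrm F G \<bullet> (x - pt G) > 0" using eq by (simp add: inner_diff_right inner_add_right algebra_simps)
  then show ?thesis using that G(1) by blast
qed

text \<open>A step of the simplex method on the polar side: unless the ray from \<open>p\<close> through \<open>g\<close> leaves \<open>F\<close>
  through \<open>G\<close>, some adjacent facet is hit earlier.\<close>

lemma facet_improve:
  assumes F: "polytope F" and dim: "aff_dim F = int (Suc (Suc m))" and p: "p \<in> rel_interior F"
    and Gs: "Gs facet_of F" "g \<in> Gs" and G: "G facet_of F" and less: "(nrm F G \<bullet> (g - p)) / hgt F p G < 1"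
  obtains R where "R facet_of G" "(nrm F (other F G R) \<bullet> (g - p)) / hgt F p (other F G R) > (nrm F G \<bullet> (g - p)) / hgt F p G"
proof -
  define e where "e = g - p"
  define \<psi> where "\<psi> = (nrm F G \<bullet> e) / hgt F p G"
  have hpos: "hgt F p H > 0" if "H facet_of F" for H
    unfolding hgt_def by (rule rel_interior_nrm_less[OF F p that])
  have pF: "p \<in> F" "g \<in> F" using p rel_interior_subset Gs facet_of_imp_subset by blast+
  have e: "e \<in> dir F" unfolding e_def by (rule diff_in_dir[OF pF(2,1)])
  have pGs: "nrm F Gs \<bullet> e = hgt F p Gs" using nrm_pt[OF F Gs] by (simp add: e_def hgt_def inner_diff_right)
  have ue: "nrm F G \<bullet> e = \<psi> * hgt F p G" using hpos[OF G] by (simp add: \<psi>_def)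
  note PG = polytope_facet[OF F G] and dimG = aff_dim_facet[OF G dim]
  have "\<exists>R. R facet_of G \<and> nrm G R \<bullet> (e - \<psi> *\<^sub>R (pt R - p)) > 0"
  proof (rule ccontr)
    assume "\<not> ?thesis"
    then have le: "\<And>R. R facet_of G \<Longrightarrow> nrm G R \<bullet> (e - \<psi> *\<^sub>R (pt R - p)) \<le> 0" by (meson not_le)
    consider "\<psi> < 0" | "\<psi> = 0" | "\<psi> > 0" by linarith
    then show False
    proof cases
      case 1
      \<comment> \<open>For negative \<open>\<psi>\<close> no particular ridge is singled out; the
        average with weights \<open>vol m R\<close> is positive by the Minkowski relation and the
        volume formula of \<open>G\<close>.\<close>
      have "(\<Sum>R | R facet_of G. vol m R * (nrm G R \<bullet> (e - \<psi> *\<^sub>R (pt R - p)))) \<le> 0"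
        using le vol_pos[OF polytope_facet[OF PG] aff_dim_facet[OF _ dimG]]
        by (intro sum_nonpos) (simp add: mult_le_0_iff less_imp_le)
      moreover have "(\<Sum>R | R facet_of G. vol m R * (nrm G R \<bullet> (e - \<psi> *\<^sub>R (pt R - p))))
        = (\<Sum>R | R facet_of G. vol m R *\<^sub>R nrm G R) \<bullet> e - \<psi> * (\<Sum>R | R facet_of G. vol m R * (nrm G R \<bullet> (pt R - p)))"
        by (simp add: inner_diff_right right_diff_distrib sum_subtractf inner_sum_left sum_distrib_left mult.left_commute)
      moreover have "\<dots> = - \<psi> * (real (Suc m) * vol (Suc m) G)"
        unfolding minkowski[OF PG dimG] vol_from[OF PG dimG, of p] by simp
      moreover have "\<dots> > 0" using 1 vol_pos[OF PG dimG] by (intro mult_pos_pos) auto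
      ultimately show False by linarith
    next
      case 2
      then have "e \<in> dir G" using ue by (intro nrm_decomp[OF F G e]) simp
      moreover have "e \<noteq> 0" using pGs hpos[OF Gs(1)] by auto
      ultimately obtain R where "R facet_of G" "nrm G R \<bullet> e > 0" using facet_toward[OF PG] by blast
      then show False using le[of R] 2 by simp
    next
      case 3
      \<comment> \<open>The point where the ray meets the affine hull of \<open>G\<close>. Since
        \<open>\<psi> < 1\<close>, it lies beyond \<open>Gs\<close> and hence outside
        \<open>F\<close>.\<close>
      define x where "x = p + e /\<^sub>R \<psi>"
      have "x - pt G \<in> dir F" using diff_in_dir[OF pF(1), of "pt G"] pt_in[OF G] facet_of_imp_subset[OF G] e
          subspace_add[OF subspace_dir, of "p - pt G" F "e /\<^sub>R \<psi>"] subspace_scale[OF subspace_dir e]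
        by (auto simp: x_def algebra_simps)
      moreover have "nrm F G \<bullet> (x - pt G) = 0"
        using ue 3 by (simp add: x_def inner_diff_right inner_add_right hgt_def mult.assoc[symmetric])
      ultimately have "x - pt G \<in> dir G" by (rule nrm_decomp[OF F G])
      then have xa: "x \<in> affine hull G" using affine_hull_dir[OF hull_inc[OF pt_in[OF G]]] by blast
      have "x \<notin> F"
      proof
        assume "x \<in> F"
        then have "nrm F Gs \<bullet> x \<le> nrm F Gs \<bullet> pt Gs" by (rule nrm_le[OF F Gs(1) _ pt_in[OF Gs(1)]])
        then have "hgt F p Gs / \<psi> \<le> hgt F p Gs" using pGs by (simp add: x_def hgt_def inner_diff_right inner_add_right field_simps)
        then have "\<psi> \<ge> 1" using 3 hpos[OF Gs(1)] by (simp add: field_simps)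
        then show False using less by (simp add: \<psi>_def e_def)
      qed
      then have "x \<notin> G" using facet_of_imp_subset[OF G] by blast
      moreover have "G \<noteq> {}" using pt_in[OF G] by blast
      ultimately obtain R where R: "R facet_of G" "nrm G R \<bullet> (x - pt R) > 0" using facet_beyond[OF PG _ xa] by blast
      have "e - \<psi> *\<^sub>R (pt R - p) = \<psi> *\<^sub>R (x - pt R)" using 3 by (simp add: x_def algebra_simps)
      then have "nrm G R \<bullet> (e - \<psi> *\<^sub>R (pt R - p)) > 0" using R(2) 3 by simp
      then show False using le[OF R(1)] by simp
    qed
  qed
  then obtain R where R: "R facet_of G" "nrm G R \<bullet> (e - \<psi> *\<^sub>R (pt R - p)) > 0" by blast
  note t = turn[OF F G R(1)] and o = other[OF F G R(1)] and h = hgt_eq[OF F G R(1), of p]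
  have "nrm F (other F G R) \<bullet> (e - \<psi> *\<^sub>R (pt R - p)) =
      cs F G R * (nrm F G \<bullet> e - \<psi> * hgt F p G) + sn F G R * (nrm G R \<bullet> (e - \<psi> *\<^sub>R (pt R - p)))"
    unfolding t(5) h by (simp add: inner_add_left inner_diff_right) (simp add: algebra_simps)
  also have "\<dots> > 0" using ue R(2) t(1) by simp
  finally have "nrm F (other F G R) \<bullet> e > \<psi> * hgt F p (other F G R)" unfolding h by (simp add: inner_diff_right)
  then have "(nrm F (other F G R) \<bullet> e) / hgt F p (other F G R) > \<psi>" using hpos[OF o(1)] by (simp add: pos_less_divide_eq)
  then show ?thesis using that[OF R(1)] unfolding \<psi>_def e_def by blast
qed

text \<open>With \<open>g\<close> in the relative interior of \<open>H\<close>, the quantity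
  \<open>\<psi>\<close> is below one on all other facets. A maximizer of \<open>\<psi>\<close> among
  the facets sharing the value of \<open>G\<close> must therefore be \<open>H\<close>, since
  otherwise \<open>facet_improve\<close> passes to an adjacent facet with the same value and larger
  \<open>\<psi>\<close>.\<close>

lemma facets_connected:
  assumes F: "polytope F" and dim: "aff_dim F = int (Suc (Suc m))"
    and adj: "\<And>G R. G facet_of F \<Longrightarrow> R facet_of G \<Longrightarrow> \<phi> (other F G R) = \<phi> G"
    and G: "G facet_of F" and H: "H facet_of F"
  shows "\<phi> G = \<phi> H"
proof -
  obtain p where p: "p \<in> rel_interior F" using rel_interior_point[OF F dim] .
  obtain g where g: "g \<in> rel_interior H"
    using rel_interior_point[OF polytope_facet[OF F H] aff_dim_facet[OF H dim]] .
  have gH: "g \<in> H" using g rel_interior_subset by blast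
  then have gF: "g \<in> F" using facet_of_imp_subset[OF H] by blast
  define \<psi> where "\<psi> = (\<lambda>G. (nrm F G \<bullet> (g - p)) / hgt F p G)"
  have less: "\<psi> K < 1" if K: "K facet_of F" "K \<noteq> H" for K
  proof -
    have "g \<notin> K"
    proof
      assume "g \<in> K"
      then have "H \<subseteq> K" using subset_of_face_of[OF facet_of_imp_face_of[OF K(1)] facet_of_imp_subset[OF H]] g by blast
      then show False using facet_subset_eq[OF polytope_imp_convex[OF F] H K(1)] K(2) by blast
    qed
    then have "nrm F K \<bullet> g < nrm F K \<bullet> pt K" using nrm_less[OF F K(1) gF _ pt_in[OF K(1)]] by blast
    moreover have "hgt F p K > 0" unfolding hgt_def by (rule rel_interior_nrm_less[OF F p K(1)])
    ultimately show ?thesis unfolding \<psi>_def by (simp add: hgt_def inner_diff_right)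
  qed
  define C where "C = {K. K facet_of F \<and> \<phi> K = \<phi> G}"
  have fin: "finite C" unfolding C_def using finite_subset[OF _ finite_facets[OF F]] by auto
  have "C \<noteq> {}" using G unfolding C_def by blast
  then have "Max (\<psi> ` C) \<in> \<psi> ` C" using fin by (intro Max_in) auto
  then obtain K where K: "K \<in> C" "Max (\<psi> ` C) = \<psi> K" by (rule imageE)
  have KF: "K facet_of F" "\<phi> K = \<phi> G" using K(1) by (simp_all add: C_def)
  have "K = H"
  proof (rule ccontr)
    assume "K \<noteq> H"
    then have "\<psi> K < 1" by (rule less[OF KF(1)])
    then obtain R where R: "R facet_of K" "\<psi> (other F K R) > \<psi> K"
      using facet_improve[OF F dim p H gH KF(1)] unfolding \<psi>_def by blast
    have "other F K R \<in> C" using adj[OF KF(1) R(1)] other(1)[OF F KF(1) R(1)] KF(2) by (simp add: C_def)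
    then have "\<psi> (other F K R) \<le> Max (\<psi> ` C)" using fin by (intro Max_ge) auto
    then show False using R(2) K(2) by simp
  qed
  then show ?thesis using KF(2) by simp
qed

section \<open>The Bochner inequality\<close>

text \<open>The point at which the moved hyperplane of \<open>G\<close> meets those of its two neighbours around \<open>S\<close>. If \<open>F\<close> is
  not simple at \<open>S\<close>, it depends on \<open>G\<close>.\<close>

definition corner_vec :: "'a::euclidean_space set \<Rightarrow> ('a set \<Rightarrow> real) \<Rightarrow> 'a set \<Rightarrow> 'a set \<Rightarrow> 'a" where
  "corner_vec F f S G = f G *\<^sub>R nrm F G + xv G (SOME R. R facet_of G \<and> S facet_of R) S (res F f G)"

lemma corner_vec_eq:
  assumes F: "polytope F" and fl: "(G, R) \<in> flags_at F S"
  shows "corner_vec F f S G = f G *\<^sub>R nrm F G + res F f G R *\<^sub>R nrm G R + res G (res F f G) R S *\<^sub>R nrm R S"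
proof -
  note D = flagD[OF F fl]
  let ?Q = "SOME R. R facet_of G \<and> S facet_of R"
  have "?Q facet_of G \<and> S facet_of ?Q" by (rule someI[of _ R]) (use D in blast)
  then have "xv G ?Q S (res F f G) = xv G R S (res F f G)" by (intro xv_eq[OF D(4)] D) auto
  then show ?thesis by (simp add: corner_vec_def xv_def)
qed

lemma corner_vec_nrm:
  assumes F: "polytope F" and fl: "(G, R) \<in> flags_at F S"
  shows "nrm F G \<bullet> corner_vec F f S G = f G" "nrm G R \<bullet> corner_vec F f S G = res F f G R"
    "nrm R S \<bullet> corner_vec F f S G = res G (res F f G) R S"
  unfolding corner_vec_eq[OF assms] by (simp_all add: inner_add_right frame[OF assms])

text \<open>The first two coordinates transform across \<open>R\<close> as the frame does. The third
  one may jump, and such a jump is what the defect detects.\<close>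

lemma compat_corner_vec:
  assumes F: "polytope F" shows "compat F S (corner_vec F f S)"
  unfolding compat_def
proof clarify
  fix G R assume fl: "(G, R) \<in> flags_at F S"
  note D = flagD[OF F fl] and fl' = flag_turn_upper[OF F fl]
  note D' = flagD[OF F fl'(1)]
  note t = turn[OF F D(1,2)] and t' = turn[OF F D'(1,2), unfolded fl'(2)]
  have "nrm F G \<bullet> corner_vec F f S (other F G R) = f G"
    unfolding t'(5) inner_add_left inner_scaleR_left corner_vec_nrm[OF F fl'(1)]
    using val_other[OF F D'(1,2), of f, unfolded fl'(2)] by simp
  moreover have "nrm G R \<bullet> corner_vec F f S (other F G R) = res F f G R"
    unfolding t'(6) inner_diff_left inner_scaleR_left corner_vec_nrm[OF F fl'(1)]
    using res_other[OF F D'(1,2), of f, unfolded fl'(2)] by simp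
  ultimately show "nrm F G \<bullet> corner_vec F f S (other F G R) = nrm F G \<bullet> corner_vec F f S G \<and>
      nrm G R \<bullet> corner_vec F f S (other F G R) = nrm G R \<bullet> corner_vec F f S G"
    unfolding corner_vec_nrm[OF F fl] by simp
qed

definition codim3 :: "'a::euclidean_space set \<Rightarrow> 'a set set" where
  "codim3 F = {S. \<exists>G R. (G, R) \<in> flags_at F S}"

lemma finite_codim3:
  assumes F: "polytope F" shows "finite (codim3 F)"
proof (rule finite_subset)
  show "codim3 F \<subseteq> {S. S face_of F}"
    unfolding codim3_def flags_at_def using facet_of_imp_face_of face_of_trans by blast
  show "finite {S. S face_of F}" by (rule finite_polytope_faces[OF F])
qed

lemma sum_codim3:
  assumes F: "polytope F"
  shows "(\<Sum>G | G facet_of F. \<Sum>R | R facet_of G. \<Sum>S | S facet_of R. \<phi> G R S)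
    = (\<Sum>S\<in>codim3 F. \<Sum>(G, R)\<in>flags_at F S. \<phi> G R S)"
proof -
  have fR: "finite {R. R facet_of G}" if "G facet_of F" for G
    by (rule finite_facets[OF polytope_facet[OF F that]])
  have fS: "finite {S. S facet_of R}" if "G facet_of F" "R facet_of G" for G R
    by (rule finite_facets[OF polytope_facet[OF polytope_facet[OF F that(1)] that(2)]])
  have fRS: "finite (Sigma {R. R facet_of G} (\<lambda>R. {S. S facet_of R}))" if "G facet_of F" for G
    by (rule finite_SigmaI[OF fR[OF that] fS[OF that]]) simp
  have "(\<Sum>G | G facet_of F. \<Sum>R | R facet_of G. \<Sum>S | S facet_of R. \<phi> G R S) =
    (\<Sum>G | G facet_of F. \<Sum>(R, S)\<in>Sigma {R. R facet_of G} (\<lambda>R. {S. S facet_of R}). \<phi> G R S)"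
    by (rule sum.cong[OF refl], rule sum.Sigma) (simp_all add: fR fS)
  also have "\<dots> = (\<Sum>(G, R, S)\<in>Sigma {G. G facet_of F} (\<lambda>G. Sigma {R. R facet_of G} (\<lambda>R. {S. S facet_of R})). \<phi> G R S)"
    by (rule sum.Sigma) (simp_all add: fRS F)
  also have "\<dots> = (\<Sum>(S, G, R)\<in>Sigma (codim3 F) (flags_at F). \<phi> G R S)"
    by (rule sum.reindex_bij_witness[of _ "\<lambda>(S, G, R). (G, R, S)" "\<lambda>(G, R, S). (S, G, R)"])
       (auto simp: codim3_def flags_at_def)
  also have "\<dots> = (\<Sum>S\<in>codim3 F. \<Sum>(G, R)\<in>flags_at F S. \<phi> G R S)"
    using finite_codim3[OF F] finite_flags_at[OF F] by (subst sum.Sigma) simp_all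
  finally show ?thesis .
qed

context
  fixes F :: "'a::euclidean_space set" and m :: nat and p :: 'a
  assumes F: "polytope F" and dim: "aff_dim F = int (Suc (Suc (Suc m)))" and p: "p \<in> rel_interior F"
begin

lemma dims:
  "G facet_of F \<Longrightarrow> aff_dim G = int (Suc (Suc m))"
  "G facet_of F \<Longrightarrow> R facet_of G \<Longrightarrow> aff_dim R = int (Suc m)"
  "G facet_of F \<Longrightarrow> R facet_of G \<Longrightarrow> S facet_of R \<Longrightarrow> aff_dim S = int m"
  using dim by (auto simp: facet_of_def)

text \<open>Expanding \<open>vol (Suc m) R\<close> into pyramids with apex \<open>p\<close> turns
  both terms into sums over triples \<open>G\<close>, \<open>R\<close>, \<open>S\<close>. The
  coordinates of \<open>corner_vec\<close> are \<open>f G\<close> and its first and second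
  restrictions, so the difference collected at \<open>S\<close> is the defect.\<close>

lemma bochner_identity:
  "(\<Sum>G | G facet_of F. hgt F p G * form m G (res F f G) (res F f G)) - real (Suc m) * form (Suc m) F f f
    = (\<Sum>S\<in>codim3 F. vol m S * defect F S (corner_vec F f S) (pt S - p))"
proof -
  have 1: "(\<Sum>G | G facet_of F. hgt F p G * form m G (res F f G) (res F f G))
    = (\<Sum>G | G facet_of F. \<Sum>R | R facet_of G. \<Sum>S | S facet_of R. vol m S * (res F f G R * (hgt F p G * res G (res F f G) R S)))"
    by (simp add: form_def facet_row_def sum_distrib_left mult.commute mult.left_commute)
  have "real (Suc m) * form (Suc m) F f f = (\<Sum>G | G facet_of F. \<Sum>R | R facet_of G. (real (Suc m) * vol (Suc m) R) * (res F f G R * f G))"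
    by (simp only: form_def facet_row_def sum_distrib_left mult.assoc mult.commute mult.left_commute)
  also have "\<dots> = (\<Sum>G | G facet_of F. \<Sum>R | R facet_of G. \<Sum>S | S facet_of R. vol m S * (res F f G R * ((nrm R S \<bullet> (pt S - p)) * f G)))"
  proof (intro sum.cong refl)
    fix G R assume "G \<in> {G. G facet_of F}" "R \<in> {R. R facet_of G}"
    then have G: "G facet_of F" and R: "R facet_of G" by auto
    have "real (Suc m) * vol (Suc m) R = (\<Sum>S | S facet_of R. vol m S * (nrm R S \<bullet> (pt S - p)))"
      by (rule vol_from[OF polytope_facet[OF polytope_facet[OF F G] R] dims(2)[OF G R]])
    then have "real (Suc m) * vol (Suc m) R * (res F f G R * f G) =
       (\<Sum>S | S facet_of R. vol m S * (nrm R S \<bullet> (pt S - p)) * (res F f G R * f G))"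
      by (simp only: sum_distrib_right)
    also have "\<dots> = (\<Sum>S | S facet_of R. vol m S * (res F f G R * ((nrm R S \<bullet> (pt S - p)) * f G)))"
      by (simp only: mult.assoc mult.commute mult.left_commute)
    finally show "real (Suc m) * vol (Suc m) R * (res F f G R * f G) =
       (\<Sum>S | S facet_of R. vol m S * (res F f G R * ((nrm R S \<bullet> (pt S - p)) * f G)))" .
  qed
  finally have "(\<Sum>G | G facet_of F. hgt F p G * form m G (res F f G) (res F f G)) - real (Suc m) * form (Suc m) F f f
    = (\<Sum>G | G facet_of F. \<Sum>R | R facet_of G. \<Sum>S | S facet_of R. vol m S * (res F f G R * (hgt F p G * res G (res F f G) R S - (nrm R S \<bullet> (pt S - p)) * f G)))"
    unfolding 1 right_diff_distrib sum_subtractf by (simp only:)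
  also have "\<dots> = (\<Sum>S\<in>codim3 F. \<Sum>(G, R)\<in>flags_at F S. vol m S * (res F f G R * (hgt F p G * res G (res F f G) R S - (nrm R S \<bullet> (pt S - p)) * f G)))"
    by (rule sum_codim3[OF F])
  also have "\<dots> = (\<Sum>S\<in>codim3 F. vol m S * defect F S (corner_vec F f S) (pt S - p))"
    unfolding defect_def sum_distrib_left
  proof (intro sum.cong refl, clarify)
    fix S G R assume fl: "(G, R) \<in> flags_at F S"
    note D = flagD[OF F fl]
    have "pt S \<in> G" using pt_in[OF D(3)] flag_subset(3)[OF F fl] by blast
    then have "hgt F p G = nrm F G \<bullet> (pt S - p)" using nrm_pt[OF F D(1)] by (simp add: hgt_def inner_diff_right)
    then show "vol m S * (res F f G R * (hgt F p G * res G (res F f G) R S - nrm R S \<bullet> (pt S - p) * f G)) =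
       vol m S * (nrm G R \<bullet> corner_vec F f S G * (nrm F G \<bullet> (pt S - p) * (nrm R S \<bullet> corner_vec F f S G) - nrm R S \<bullet> (pt S - p) * (nrm F G \<bullet> corner_vec F f S G)))"
      unfolding corner_vec_nrm[OF F fl] by simp
  qed
  finally show ?thesis .
qed

lemma codim3_defect:
  assumes "S \<in> codim3 F"
  shows "vol m S > 0" "defect F S (corner_vec F f S) (pt S - p) \<ge> 0"
proof -
  obtain G R where fl: "(G, R) \<in> flags_at F S" using assms by (auto simp: codim3_def)
  note D = flagD[OF F fl]
  show "vol m S > 0" by (rule vol_pos[OF polytope_facet[OF D(5,3)] dims(3)[OF D(1-3)]])
  show "defect F S (corner_vec F f S) (pt S - p) \<ge> 0"
    by (rule defect_nonneg(1)[OF F compat_corner_vec[OF F] p])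
qed

lemma row_pos: "G facet_of F \<Longrightarrow> facet_row (Suc m) F (hgt F p) G > 0"
  unfolding row_hgt[OF F dim] using vol_pos[OF polytope_facet[OF F] dims(1)] by simp

lemma hgt_pos: "G facet_of F \<Longrightarrow> hgt F p G > 0"
  unfolding hgt_def by (rule rel_interior_nrm_less[OF F p])

lemma facet_form_hgt:
  assumes G: "G facet_of F"
  shows "form m G (res F f G) (hgt G p) = real (Suc m) * facet_row (Suc m) F f G"
    "form m G (hgt G p) (hgt G p) = real (Suc m) * facet_row (Suc m) F (hgt F p) G"
proof -
  note PG = polytope_facet[OF F G]
  show "form m G (res F f G) (hgt G p) = real (Suc m) * facet_row (Suc m) F f G"
    unfolding form_hgt[OF PG dims(1)[OF G]] by (simp add: facet_row_def mult.commute)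
  show "form m G (hgt G p) (hgt G p) = real (Suc m) * facet_row (Suc m) F (hgt F p) G"
    unfolding form_hgt_hgt[OF PG dims(1)[OF G]] row_hgt[OF F dim G] ..
qed

text \<open>The reverse Cauchy--Schwarz inequality in the facet \<open>G\<close>, with the dilation as second argument.\<close>

lemma facet_form_le:
  assumes G: "G facet_of F" and hyp: "hyperbolic m G"
  shows "form m G (res F f G) (res F f G) \<le> real (Suc m) * ((facet_row (Suc m) F f G)\<^sup>2 / facet_row (Suc m) F (hgt F p) G)"
proof -
  note PG = polytope_facet[OF F G]
  define \<phi> h where "\<phi> = res F f G" and "h = hgt G p"
  define r where "r = facet_row (Suc m) F (hgt F p) G"
  define c where "c = facet_row (Suc m) F f G / r"
  have r: "r > 0" using row_pos[OF G] by (simp add: r_def)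
  have hh: "form m G h h = real (Suc m) * r" and fh: "form m G \<phi> h = real (Suc m) * facet_row (Suc m) F f G"
    unfolding \<phi>_def h_def r_def by (rule facet_form_hgt[OF G])+
  define g where "g = (\<lambda>R. 1 * \<phi> R + (- c) * h R)"
  have "form m G g h = 0" unfolding g_def form_comb_left hh fh using r by (simp add: c_def)
  then have "(\<Sum>R | R facet_of G. g R * vol (Suc m) R) = 0"
    unfolding h_def form_hgt[OF PG dims(1)[OF G]] by simp
  then have "form m G g g \<le> 0" using hyp unfolding hyperbolic_def by blast
  moreover have "form m G g g = form m G \<phi> \<phi> - 2 * c * form m G \<phi> h + c\<^sup>2 * form m G h h"
    unfolding g_def form_comb_left form_comb_right using form_sym[OF PG, of m h \<phi>] by (simp add: power2_eq_square algebra_simps)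
  moreover have "- 2 * c * form m G \<phi> h + c\<^sup>2 * form m G h h = - (real (Suc m) * ((facet_row (Suc m) F f G)\<^sup>2 / r))"
    unfolding hh fh c_def using r by (simp add: power2_eq_square field_simps)
  ultimately show ?thesis unfolding \<phi>_def r_def by linarith
qed

lemma bochner_inequality:
  assumes hyp: "\<And>G. G facet_of F \<Longrightarrow> hyperbolic m G"
  shows "form (Suc m) F f f \<le> (\<Sum>G | G facet_of F. hgt F p G * ((facet_row (Suc m) F f G)\<^sup>2 / facet_row (Suc m) F (hgt F p) G))"
proof -
  have "0 \<le> (\<Sum>S\<in>codim3 F. vol m S * defect F S (corner_vec F f S) (pt S - p))"
    using codim3_defect by (intro sum_nonneg) (simp add: less_imp_le)
  then have "real (Suc m) * form (Suc m) F f f \<le> (\<Sum>G | G facet_of F. hgt F p G * form m G (res F f G) (res F f G))"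
    unfolding bochner_identity[symmetric] by simp
  also have "\<dots> \<le> (\<Sum>G | G facet_of F. hgt F p G * (real (Suc m) * ((facet_row (Suc m) F f G)\<^sup>2 / facet_row (Suc m) F (hgt F p) G)))"
    using facet_form_le hyp hgt_pos by (intro sum_mono mult_left_mono) (simp_all add: less_imp_le)
  also have "\<dots> = real (Suc m) * (\<Sum>G | G facet_of F. hgt F p G * ((facet_row (Suc m) F f G)\<^sup>2 / facet_row (Suc m) F (hgt F p) G))"
    by (simp only: sum_distrib_left mult.left_commute)
  finally show ?thesis by (simp only: mult_le_cancel_left_pos[of "real (Suc m)"] of_nat_0_less_iff zero_less_Suc)
qed

text \<open>Ground state substitution: \<open>hgt F p\<close> is a positive eigenvector with
  eigenvalue one for these weights. In terms of the quotient of \<open>f\<close> by it, the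
  difference is an energy made of squared jumps across ridges.\<close>

lemma dirichlet:
  "(\<Sum>G | G facet_of F. facet_row (Suc m) F (hgt F p) G / hgt F p G * (f G)\<^sup>2) - form (Suc m) F f f
    = (\<Sum>G | G facet_of F. \<Sum>R | R facet_of G. vol (Suc m) R *
        ((f G * hgt F p (other F G R) - f (other F G R) * hgt F p G)\<^sup>2 / (2 * sn F G R * hgt F p G * hgt F p (other F G R))))"
proof -
  have "(\<Sum>G | G facet_of F. facet_row (Suc m) F (hgt F p) G / hgt F p G * (f G)\<^sup>2) - form (Suc m) F f f
    = (\<Sum>G | G facet_of F. \<Sum>R | R facet_of G. vol (Suc m) R * ((f G)\<^sup>2 * res F (hgt F p) G R / hgt F p G - f G * res F f G R))"
    unfolding form_def facet_row_def sum_subtractf[symmetric] sum_divide_distrib sum_distrib_left sum_distrib_right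
    by (intro sum.cong refl) (simp add: algebra_simps)
  also have "\<dots> = (\<Sum>G | G facet_of F. \<Sum>R | R facet_of G. vol (Suc m) R *
        ((f G * hgt F p (other F G R) - f (other F G R) * hgt F p G)\<^sup>2 / (2 * sn F G R * hgt F p G * hgt F p (other F G R))))"
  proof (rule flag_sum_eq[OF F])
    fix G R assume G: "G facet_of F" and R: "R facet_of G"
    note o = other[OF F G R] and t = turn[OF F G R]
    define s c h h' a a' where "s = sn F G R" and "c = cs F G R" and "h = hgt F p G" and "h' = hgt F p (other F G R)"
      and "a = f G" and "a' = f (other F G R)"
    have pos: "s > 0" "h > 0" "h' > 0" using t(1) hgt_pos[OF G] hgt_pos[OF o(1)] by (simp_all add: s_def h_def h'_def)
    have r: "res F f G R = (a' - c * a) / s" "res F (hgt F p) G R = (h' - c * h) / s"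
      "res F f (other F G R) R = (a - c * a') / s" "res F (hgt F p) (other F G R) R = (h - c * h') / s"
      unfolding res_def o(5) t(3,4) by (simp_all add: s_def c_def h_def h'_def a_def a'_def)
    have "(a\<^sup>2 * ((h' - c * h) / s) / h - a * ((a' - c * a) / s)) + (a'\<^sup>2 * ((h - c * h') / s) / h' - a' * ((a - c * a') / s))
      = (a * h' - a' * h)\<^sup>2 / (2 * s * h * h') + (a' * h - a * h')\<^sup>2 / (2 * s * h' * h)"
      using pos by (simp add: field_simps power2_eq_square)
    then have "vol (Suc m) R * ((a\<^sup>2 * ((h' - c * h) / s) / h - a * ((a' - c * a) / s)) + (a'\<^sup>2 * ((h - c * h') / s) / h' - a' * ((a - c * a') / s)))
      = vol (Suc m) R * ((a * h' - a' * h)\<^sup>2 / (2 * s * h * h') + (a' * h - a * h')\<^sup>2 / (2 * s * h' * h))" by simp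
    then show "vol (Suc m) R * ((f G)\<^sup>2 * res F (hgt F p) G R / hgt F p G - f G * res F f G R) +
       vol (Suc m) R * ((f (other F G R))\<^sup>2 * res F (hgt F p) (other F G R) R / hgt F p (other F G R) - f (other F G R) * res F f (other F G R) R) =
       vol (Suc m) R * ((f G * hgt F p (other F G R) - f (other F G R) * hgt F p G)\<^sup>2 / (2 * sn F G R * hgt F p G * hgt F p (other F G R))) +
       vol (Suc m) R * ((f (other F G R) * hgt F p (other F (other F G R) R) - f (other F (other F G R) R) * hgt F p (other F G R))\<^sup>2 /
        (2 * sn F (other F G R) R * hgt F p (other F G R) * hgt F p (other F (other F G R) R)))"
      unfolding r o(5) t(4) distrib_left[symmetric] s_def c_def h_def h'_def a_def a'_def .
  qed
  finally show ?thesis .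
qed

text \<open>Equality makes all jumps of the quotient vanish, and the facets are connected through
  ridges.\<close>

lemma spectral_gap:
  "form (Suc m) F f f \<le> (\<Sum>G | G facet_of F. facet_row (Suc m) F (hgt F p) G / hgt F p G * (f G)\<^sup>2)"
  "form (Suc m) F f f = (\<Sum>G | G facet_of F. facet_row (Suc m) F (hgt F p) G / hgt F p G * (f G)\<^sup>2) \<Longrightarrow>
     \<exists>c. \<forall>G. G facet_of F \<longrightarrow> f G = c * hgt F p G"
proof -
  define T where "T G R = vol (Suc m) R *
        ((f G * hgt F p (other F G R) - f (other F G R) * hgt F p G)\<^sup>2 / (2 * sn F G R * hgt F p G * hgt F p (other F G R)))" for G R
  have T: "T G R \<ge> 0 \<and> (T G R = 0 \<longrightarrow> f (other F G R) / hgt F p (other F G R) = f G / hgt F p G)"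
    if G: "G facet_of F" and R: "R facet_of G" for G R
  proof -
    have pos: "2 * sn F G R * hgt F p G * hgt F p (other F G R) > 0" "vol (Suc m) R > 0"
      "hgt F p G > 0" "hgt F p (other F G R) > 0"
      using turn(1)[OF F G R] hgt_pos[OF G] hgt_pos[OF other(1)[OF F G R]]
        vol_pos[OF polytope_facet[OF polytope_facet[OF F G] R] dims(2)[OF G R]] by simp_all
    have "T G R \<ge> 0" unfolding T_def using pos by (intro mult_nonneg_nonneg divide_nonneg_pos) (simp_all add: less_imp_le)
    moreover have "f (other F G R) / hgt F p (other F G R) = f G / hgt F p G" if "T G R = 0"
    proof -
      have "f G * hgt F p (other F G R) - f (other F G R) * hgt F p G = 0"
        using that pos turn(1)[OF F G R] unfolding T_def by simp
      then show ?thesis using pos(3,4) by (simp add: field_simps)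
    qed
    ultimately show ?thesis by blast
  qed
  have inner: "(\<Sum>R | R facet_of G. T G R) \<ge> 0" if "G facet_of F" for G
    using T that by (intro sum_nonneg) auto
  have eq: "(\<Sum>G | G facet_of F. facet_row (Suc m) F (hgt F p) G / hgt F p G * (f G)\<^sup>2) - form (Suc m) F f f = (\<Sum>G | G facet_of F. \<Sum>R | R facet_of G. T G R)"
    unfolding T_def by (rule dirichlet)
  have "(\<Sum>G | G facet_of F. \<Sum>R | R facet_of G. T G R) \<ge> 0" by (rule sum_nonneg) (use inner in auto)
  then show "form (Suc m) F f f \<le> (\<Sum>G | G facet_of F. facet_row (Suc m) F (hgt F p) G / hgt F p G * (f G)\<^sup>2)"
    using eq by linarith
  assume "form (Suc m) F f f = (\<Sum>G | G facet_of F. facet_row (Suc m) F (hgt F p) G / hgt F p G * (f G)\<^sup>2)"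
  then have z: "(\<Sum>G | G facet_of F. \<Sum>R | R facet_of G. T G R) = 0" using eq by linarith
  have adj: "f (other F G R) / hgt F p (other F G R) = f G / hgt F p G" if G: "G facet_of F" and R: "R facet_of G" for G R
  proof -
    have "(\<Sum>R | R facet_of G. T G R) = 0"
      using z inner F G by (subst (asm) sum_nonneg_eq_0_iff) auto
    then have "T G R = 0"
      using T[OF G] polytope_facet[OF F G] R by (subst (asm) sum_nonneg_eq_0_iff) auto
    then show ?thesis using T[OF G R] by blast
  qed
  obtain G0 where G0: "G0 facet_of F" using facet_exists[OF F dim] .
  have "f G = f G0 / hgt F p G0 * hgt F p G" if G: "G facet_of F" for G
  proof -
    have "f G / hgt F p G = f G0 / hgt F p G0"
      by (rule facets_connected[OF F dim, where \<phi> = "\<lambda>G. f G / hgt F p G", OF adj G G0])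
    then show ?thesis using hgt_pos[OF G] by (simp add: field_simps)
  qed
  then show "\<exists>c. \<forall>G. G facet_of F \<longrightarrow> f G = c * hgt F p G" by blast
qed

end

section \<open>Induction over the dimension\<close>

lemma row_cong: "polytope F \<Longrightarrow> G facet_of F \<Longrightarrow> (\<And>H. H facet_of F \<Longrightarrow> f H = g H) \<Longrightarrow> facet_row m F f G = facet_row m F g G"
  unfolding facet_row_def res_def by (intro sum.cong refl) (simp add: other(1))

lemma row_matrix:
  assumes F: "polytope F" and G: "G facet_of F"
  shows "facet_row m F f G = (\<Sum>H | H facet_of F. facet_row m F (\<lambda>K. if K = H then 1 else 0) G * f H)"
proof -
  have gen: "facet_row m F (\<lambda>K. \<Sum>H\<in>X. g H K) G = (\<Sum>H\<in>X. facet_row m F (g H) G)" if "finite X" for X :: "'a set set" and g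
    using that
  proof (induction X)
    case empty
    show ?case by (simp add: facet_row_def res_def)
  next
    case (insert x X)
    have "facet_row m F (\<lambda>K. 1 * g x K + 1 * (\<Sum>H\<in>X. g H K)) G = 1 * facet_row m F (g x) G + 1 * facet_row m F (\<lambda>K. \<Sum>H\<in>X. g H K) G"
      by (rule row_comb)
    then show ?case using insert by simp
  qed
  have "facet_row m F f G = facet_row m F (\<lambda>K. \<Sum>H | H facet_of F. f H * (if K = H then 1 else 0)) G"
    using F by (intro row_cong[OF F G]) (simp add: if_distrib[of "\<lambda>x. _ * x"] cong: if_cong)
  also have "\<dots> = (\<Sum>H | H facet_of F. facet_row m F (\<lambda>K. f H * (if K = H then 1 else 0)) G)"
    using F by (intro gen) simp
  also have "\<dots> = (\<Sum>H | H facet_of F. facet_row m F (\<lambda>K. if K = H then 1 else 0) G * f H)"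
    using row_comb[of m F "f _" "\<lambda>K. if K = _ then 1 else 0" 0 "\<lambda>_. 0"] by (simp add: mult.commute)
  finally show ?thesis .
qed

text \<open>In the equality case the rows of \<open>f\<close> vanish. The Bochner identity then
  equates a sum of nonpositive facet terms with a sum of nonnegative defects, so all of them are
  zero. The facet terms give a translation on each facet by hypothesis, the defects match these
  across ridges, and connectedness leaves a single translation.\<close>

lemma hyperbolic_step:
  assumes F: "polytope F" and dim: "aff_dim F = int (Suc (Suc (Suc m)))"
    and hyp: "\<And>G. G facet_of F \<Longrightarrow> hyperbolic m G"
  shows "hyperbolic (Suc m) F"
  unfolding hyperbolic_def
proof (intro allI impI)
  fix f :: "'a set \<Rightarrow> real" assume "(\<Sum>G | G facet_of F. f G * vol (Suc (Suc m)) G) = 0"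
  obtain p where p: "p \<in> rel_interior F" using rel_interior_point[OF F dim] .
  define I where "I = {G. G facet_of F}"
  define h where "h = hgt F p"
  \<comment> \<open>These weights make \<open>h\<close> an eigenvector with eigenvalue one.\<close>
  define q where "q = (\<lambda>G. facet_row (Suc m) F h G / h G)"
  define a where "a = (\<lambda>G H. facet_row (Suc m) F (\<lambda>K. if K = H then 1 else 0) G)"
  have fin: "finite I" using F by (simp add: I_def)
  have hpos: "h G > 0" and rpos: "facet_row (Suc m) F h G > 0" if "G \<in> I" for G
    using that hgt_pos[OF F dim p] row_pos[OF F dim p] by (simp_all add: I_def h_def)
  have row: "facet_row (Suc m) F f G = (\<Sum>H\<in>I. a G H * f H)" if "G \<in> I" for f G
    unfolding I_def a_def by (rule row_matrix[OF F]) (use that in \<open>simp add: I_def\<close>)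
  have form: "form (Suc m) F f f = (\<Sum>G\<in>I. f G * (\<Sum>H\<in>I. a G H * f H))" for f
    unfolding form_def I_def[symmetric] using row by simp
  have a_sym: "a G H = a H G" if "G \<in> I" "H \<in> I" for G H
  proof -
    have *: "form (Suc m) F (\<lambda>K. if K = G then 1 else 0) (\<lambda>K. if K = H then 1 else 0) = a G H" if "G \<in> I" for G H
      unfolding form_def I_def[symmetric] a_def using that fin by (simp add: if_distrib[of "\<lambda>x. x * _"] cong: if_cong)
    show ?thesis using *[OF that(1), of H] *[OF that(2), of G] form_sym[OF F] by metis
  qed
  have le: "form (Suc m) F f f \<le> 0" if f: "(\<Sum>G\<in>I. facet_row (Suc m) F h G * f G) = 0" for f
  proof -
    have "(\<Sum>G\<in>I. f G * (\<Sum>H\<in>I. a G H * f H)) \<le> 0"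
    proof (rule negative_on_complement[where p = q and h = h])
      show "finite I" "\<And>i j. i \<in> I \<Longrightarrow> j \<in> I \<Longrightarrow> a i j = a j i" "\<And>i. i \<in> I \<Longrightarrow> q i > 0" "\<And>i. i \<in> I \<Longrightarrow> h i > 0"
        using fin a_sym hpos rpos by (simp_all add: q_def)
      show "(\<Sum>j\<in>I. a i j * h j) = q i * h i" if "i \<in> I" for i
        using row[OF that, of h] hpos[OF that] by (simp add: q_def)
      show "(\<Sum>G\<in>I. f G * (\<Sum>H\<in>I. a G H * f H)) \<le> (\<Sum>G\<in>I. q G * (f G)\<^sup>2)" for f
      proof -
        have "form (Suc m) F f f \<le> (\<Sum>G\<in>I. q G * (f G)\<^sup>2)"
          unfolding q_def I_def h_def by (rule spectral_gap(1)[OF F dim p])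
        then show ?thesis unfolding form .
      qed
      show "\<exists>c. \<forall>i\<in>I. f i = c * h i" if "(\<Sum>G\<in>I. f G * (\<Sum>H\<in>I. a G H * f H)) = (\<Sum>G\<in>I. q G * (f G)\<^sup>2)" for f
      proof -
        have "form (Suc m) F f f = (\<Sum>G\<in>I. q G * (f G)\<^sup>2)" using that unfolding form .
        then show ?thesis using spectral_gap(2)[OF F dim p, of f] unfolding q_def I_def h_def by simp
      qed
      show "(\<Sum>G\<in>I. f G * (\<Sum>H\<in>I. a G H * f H)) \<le> (\<Sum>G\<in>I. (\<Sum>H\<in>I. a G H * f H)\<^sup>2 / q G)" for f
      proof -
        have "(\<Sum>G\<in>I. (\<Sum>H\<in>I. a G H * f H)\<^sup>2 / q G) = (\<Sum>G\<in>I. h G * ((facet_row (Suc m) F f G)\<^sup>2 / facet_row (Suc m) F h G))"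
          by (intro sum.cong refl) (simp add: row q_def)
        moreover have "form (Suc m) F f f \<le> (\<Sum>G\<in>I. h G * ((facet_row (Suc m) F f G)\<^sup>2 / facet_row (Suc m) F h G))"
          unfolding I_def h_def by (rule bochner_inequality[OF F dim p hyp])
        ultimately show ?thesis unfolding form by (simp only:)
      qed
      have "(\<Sum>G\<in>I. q G * (h G * f G)) = (\<Sum>G\<in>I. facet_row (Suc m) F h G * f G)"
        by (intro sum.cong refl) (use hpos in \<open>fastforce simp: q_def\<close>)
      then show "(\<Sum>G\<in>I. q G * (h G * f G)) = 0" using f by simp
    qed
    then show ?thesis unfolding form .
  qed
  have perp: "(\<Sum>G\<in>I. facet_row (Suc m) F h G * f G) = form (Suc m) F f h" for f
    by (simp add: form_def I_def mult.commute)
  assume "(\<Sum>G | G facet_of F. f G * vol (Suc (Suc m)) G) = 0"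
  then have fh: "form (Suc m) F f h = 0" unfolding h_def form_hgt[OF F dim] by simp
  have f_le: "form (Suc m) F f f \<le> 0" using le perp fh by simp
  have "\<exists>t\<in>dir F. \<forall>G. G facet_of F \<longrightarrow> f G = nrm F G \<bullet> t" if z: "form (Suc m) F f f = 0"
  proof -
    have hh: "form (Suc m) F h h > 0" unfolding h_def by (rule form_hgt_pos[OF F dim])
    \<comment> \<open>The form is nonpositive on the complement of \<open>h\<close>, so a vector of
      zero form there is orthogonal to the whole complement.\<close>
    have fg: "form (Suc m) F g f = 0" if g: "form (Suc m) F g h = 0" for g
    proof -
      have "0 \<le> (- 2 * form (Suc m) F g f) * t + (- form (Suc m) F g g) * t\<^sup>2" for t
      proof -
        have "form (Suc m) F (\<lambda>G. 1 * f G + t * g G) h = 0" unfolding form_comb_left using fh g by simp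
        then have "form (Suc m) F (\<lambda>G. 1 * f G + t * g G) (\<lambda>G. 1 * f G + t * g G) \<le> 0" using le perp by metis
        then show ?thesis unfolding form_comb_left form_comb_right using z form_sym[OF F, of "Suc m" f g]
          by (simp add: power2_eq_square algebra_simps)
      qed
      from linear_coeff_zero[OF this] show ?thesis by simp
    qed
    have fall: "form (Suc m) F g f = 0" for g
    proof -
      define c where "c = - (form (Suc m) F g h / form (Suc m) F h h)"
      have "form (Suc m) F (\<lambda>G. 1 * g G + c * h G) h = 0" unfolding form_comb_left using hh by (simp add: c_def)
      from fg[OF this] show ?thesis unfolding form_comb_left using fh form_sym[OF F, of "Suc m" h f] by simp
    qed
    have row0: "facet_row (Suc m) F f G = 0" if "G facet_of F" for G
      using fall[of "\<lambda>K. if K = G then 1 else 0"] that F unfolding form_def by (simp add: if_distrib[of "\<lambda>x. x * _"] cong: if_cong)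
    define T where "T G = form m G (res F f G) (res F f G)" for G
    have T_le: "T G \<le> 0" if "G facet_of F" for G
      using facet_form_le[OF F dim p that hyp[OF that], of f] row0[OF that] by (simp add: T_def)
    define D where "D S = vol m S * defect F S (corner_vec F f S) (pt S - p)" for S
    have D_nn: "D S \<ge> 0" if "S \<in> codim3 F" for S using codim3_defect(1)[OF F dim p that] codim3_defect(2)[OF F dim p that, of f] by (simp add: D_def)
    have id: "(\<Sum>G | G facet_of F. h G * T G) = (\<Sum>S\<in>codim3 F. D S)"
      using bochner_identity[OF F dim p, of f] z by (simp add: T_def D_def h_def)
    have hT: "h G * T G \<le> 0" if "G facet_of F" for G
      using T_le[OF that] hpos[of G] that by (simp add: I_def mult_le_0_iff less_imp_le)
    have "(\<Sum>G | G facet_of F. h G * T G) \<le> 0" by (rule sum_nonpos) (use hT in auto)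
    moreover have "(\<Sum>S\<in>codim3 F. D S) \<ge> 0" by (rule sum_nonneg) (use D_nn in auto)
    ultimately have s0: "(\<Sum>G | G facet_of F. - (h G * T G)) = 0" "(\<Sum>S\<in>codim3 F. D S) = 0"
      using id by (simp_all add: sum_negf)
    have T0: "T G = 0" if G: "G facet_of F" for G
    proof -
      have "- (h G * T G) = 0" using s0(1) hT F G by (subst (asm) sum_nonneg_eq_0_iff) auto
      then show ?thesis using hpos[of G] G by (simp add: I_def)
    qed
    have D0: "defect F S (corner_vec F f S) (pt S - p) = 0" if S: "S \<in> codim3 F" for S
    proof -
      have "D S = 0" using s0(2) D_nn finite_codim3[OF F] S by (subst (asm) sum_nonneg_eq_0_iff) auto
      then show ?thesis using codim3_defect(1)[OF F dim p S] by (simp add: D_def)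
    qed
    have "\<exists>t. t \<in> dir G \<and> (\<forall>R. R facet_of G \<longrightarrow> res F f G R = nrm G R \<bullet> t)" if G: "G facet_of F" for G
    proof -
      have "(\<Sum>R | R facet_of G. res F f G R * vol (Suc m) R) = 0"
        using row0[OF G] by (simp add: facet_row_def mult.commute)
      then show ?thesis using hyp[OF G] T0[OF G] unfolding hyperbolic_def T_def by blast
    qed
    then obtain t where t: "\<And>G. G facet_of F \<Longrightarrow> t G \<in> dir G"
      "\<And>G R. G facet_of F \<Longrightarrow> R facet_of G \<Longrightarrow> res F f G R = nrm G R \<bullet> t G" by metis
    \<comment> \<open>The translation as seen from \<open>G\<close>: its normal component is
      prescribed by \<open>f\<close>, its tangential one by the equality case in
      \<open>G\<close>.\<close>
    define x where "x G = f G *\<^sub>R nrm F G + t G" for G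
    have x_dir: "x G \<in> dir F" if G: "G facet_of F" for G
      unfolding x_def using nrm_in_dir[OF F G] t(1)[OF G] dir_mono[OF facet_of_imp_subset[OF G]]
      by (intro subspace_add subspace_scale) auto
    have xu: "nrm F G \<bullet> x G = f G" if G: "G facet_of F" for G
      using nrm_orth[OF F G t(1)[OF G]] nrm_self[OF F G] by (simp add: x_def inner_add_right)
    have xn: "nrm G R \<bullet> x G = res F f G R" if G: "G facet_of F" and R: "R facet_of G" for G R
      using t(2)[OF G R] nrm_frame(4)[OF F G R] by (simp add: x_def inner_add_right)
    have xt: "nrm R S \<bullet> x G = nrm R S \<bullet> corner_vec F f S G" if fl: "(G, R) \<in> flags_at F S" for G R S
    proof -
      note D = flagD[OF F fl] and o = other[OF D(4,2,3)]
      have "res G (res F f G) R S = res G (lin_val G (t G)) R S"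
        unfolding res_def[of G] lin_val_def using t(2)[OF D(1,2)] t(2)[OF D(1) o(1)] by simp
      also have "\<dots> = nrm R S \<bullet> t G" by (rule res_lin[OF D(4,2,3)])
      finally show ?thesis
        unfolding corner_vec_nrm[OF F fl] using frame(8)[OF F fl] by (simp add: x_def inner_add_right)
    qed
    have adj: "x (other F G R) = x G" if G: "G facet_of F" and R: "R facet_of G" for G R
    proof (rule ccontr)
      assume ne: "x (other F G R) \<noteq> x G"
      note o = other[OF F G R] and tn = turn[OF F G R] and PG = polytope_facet[OF F G]
      note to = turn[OF F o(1,2), unfolded o(5)]
      let ?w = "x (other F G R) - x G"
      have "nrm F G \<bullet> x (other F G R) = f G"
        unfolding to(5) inner_add_left inner_scaleR_left xu[OF o(1)] xn[OF o(1,2)]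
        using val_other[OF F o(1,2), of f, unfolded o(5)] by simp
      then have w1: "nrm F G \<bullet> ?w = 0" using xu[OF G] by (simp add: inner_diff_right)
      have "nrm G R \<bullet> x (other F G R) = res F f G R"
        unfolding to(6) inner_diff_left inner_scaleR_left xu[OF o(1)] xn[OF o(1,2)]
        using res_other[OF F o(1,2), of f, unfolded o(5)] by simp
      then have w2: "nrm G R \<bullet> ?w = 0" using xn[OF G R] by (simp add: inner_diff_right)
      have "?w \<in> dir F" using x_dir[OF o(1)] x_dir[OF G] by (rule subspace_diff[OF subspace_dir])
      then have "?w \<in> dir G" using w1 by (rule nrm_decomp[OF F G])
      then have "?w \<in> dir R" using w2 by (rule nrm_decomp[OF PG R])
      \<comment> \<open>A nonzero jump inside \<open>dir R\<close> has a positive component along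
        the normal of some facet \<open>S\<close> of \<open>R\<close>, which the vanishing defect at
        \<open>S\<close> rules out.\<close>
      then obtain S where S: "S facet_of R" "nrm R S \<bullet> ?w > 0"
        using facet_toward[OF polytope_facet[OF PG R]] ne by (metis right_minus_eq)
      have fl: "(G, R) \<in> flags_at F S" using G R S(1) by (simp add: flags_at_def)
      then have "S \<in> codim3 F" by (auto simp: codim3_def)
      then have "nrm R S \<bullet> corner_vec F f S (other F G R) = nrm R S \<bullet> corner_vec F f S G"
        by (intro defect_nonneg(2)[OF F compat_corner_vec[OF F] p _ fl] D0)
      then have "nrm R S \<bullet> x (other F G R) = nrm R S \<bullet> x G"
        using xt[OF fl] xt[OF flag_turn_upper(1)[OF F fl]] by simp
      then show False using S(2) by (simp add: inner_diff_right)
    qed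
    obtain G0 where G0: "G0 facet_of F" using facet_exists[OF F dim] .
    have "f G = nrm F G \<bullet> x G0" if G: "G facet_of F" for G
      using xu[OF G] facets_connected[OF F dim, where \<phi> = x, OF adj G G0] by simp
    then show ?thesis using x_dir[OF G0] by blast
  qed
  then show "form (Suc m) F f f \<le> 0 \<and> (form (Suc m) F f f = 0 \<longrightarrow> (\<exists>t\<in>dir F. \<forall>G. G facet_of F \<longrightarrow> f G = nrm F G \<bullet> t))"
    using f_le by blast
qed

theorem hyperbolic_polytope:
  "polytope F \<Longrightarrow> aff_dim F = int (Suc (Suc m)) \<Longrightarrow> hyperbolic m F"
proof (induction m arbitrary: F)
  case 0
  then show ?case by (intro hyperbolic_polygon) auto
next
  case (Suc m)
  show ?case
    by (rule hyperbolic_step[OF Suc.prems Suc.IH[OF polytope_facet[OF Suc.prems(1)] aff_dim_facet[OF _ Suc.prems(2)]]])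
qed

section \<open>The polar polytope\<close>

context
  fixes O' :: "'a::euclidean_space \<Rightarrow> 'a"
  assumes orth: "orthogonal_transformation O'"
begin

private lemma lin_O: "linear O'" and inj_O: "inj O'" and inner_O: "O' x \<bullet> O' y = x \<bullet> y"
  using orth orthogonal_transformation_inj by (auto simp: orthogonal_transformation_def)

private lemma image_inject: "O' ` A = O' ` B \<longleftrightarrow> A = B"
  by (rule inj_image_eq_iff[OF inj_O])

lemma facet_of_orthogonal_image: "O' ` G facet_of O' ` F \<longleftrightarrow> G facet_of F"
  unfolding facet_of_def by (simp add: face_of_linear_image lin_O inj_O)

lemma facets_orthogonal_image: "{G. G facet_of O' ` F} = (`) O' ` {G. G facet_of F}"
proof (intro Set.set_eqI iffI)
  fix G assume "G \<in> {G. G facet_of O' ` F}"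
  then have G: "G facet_of O' ` F" by simp
  then obtain H where "G = O' ` H" using facet_of_imp_subset[OF G] subset_imageE by metis
  then show "G \<in> (`) O' ` {G. G facet_of F}" using G facet_of_orthogonal_image by auto
qed (auto simp: facet_of_orthogonal_image)

lemma sum_facets_orthogonal_image:
  "(\<Sum>G | G facet_of O' ` F. \<phi> G) = (\<Sum>G | G facet_of F. \<phi> (O' ` G))"
  unfolding facets_orthogonal_image by (subst sum.reindex) (auto simp: inj_on_def image_inject)

lemma dir_orthogonal_image: "dir (O' ` F) = O' ` dir F"
proof -
  have "{x - y |x y. x \<in> O' ` F \<and> y \<in> O' ` F} = O' ` {x - y |x y. x \<in> F \<and> y \<in> F}"
  proof (intro equalityI subsetI)
    fix z assume "z \<in> {x - y |x y. x \<in> O' ` F \<and> y \<in> O' ` F}"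
    then obtain x y where "x \<in> F" "y \<in> F" "z = O' (x - y)" by (auto simp: linear_diff[OF lin_O])
    then show "z \<in> O' ` {x - y |x y. x \<in> F \<and> y \<in> F}" by blast
  next
    fix z assume "z \<in> O' ` {x - y |x y. x \<in> F \<and> y \<in> F}"
    then obtain x y where "x \<in> F" "y \<in> F" "z = O' x - O' y" by (auto simp: linear_diff[OF lin_O])
    then show "z \<in> {x - y |x y. x \<in> O' ` F \<and> y \<in> O' ` F}" by blast
  qed
  then show ?thesis unfolding dir_def by (simp add: linear_span_image[OF lin_O])
qed

context
  fixes F :: "'a set" assumes F: "polytope F"
begin

private lemma OF: "polytope (O' ` F)" by (rule polytope_linear_image[OF lin_O F])

lemma nrm_orthogonal_image:
  assumes G: "G facet_of F" shows "nrm (O' ` F) (O' ` G) = O' (nrm F G)"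
proof (rule nrm_eqI[OF OF])
  show "O' ` G facet_of O' ` F" using G facet_of_orthogonal_image by blast
  have n: "is_nrm F G (nrm F G)" by (rule is_nrm_nrm[OF F G])
  then obtain b where b: "\<forall>x\<in>F. nrm F G \<bullet> x \<le> b" "G = F \<inter> {x. nrm F G \<bullet> x = b}" "norm (nrm F G) = 1" "nrm F G \<in> dir F"
    by (auto simp: is_nrm_def)
  have "norm (O' (nrm F G)) = 1" using b(3) orth by (simp add: orthogonal_transformation_norm)
  moreover have "O' (nrm F G) \<in> dir (O' ` F)" using b(4) by (simp add: dir_orthogonal_image)
  moreover have "\<forall>x\<in>O' ` F. O' (nrm F G) \<bullet> x \<le> b" using b(1) by (simp add: inner_O)
  moreover have "O' ` G = O' ` F \<inter> {x. O' (nrm F G) \<bullet> x = b}" by (subst (1) b(2)) (auto simp: inner_O)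
  ultimately show "is_nrm (O' ` F) (O' ` G) (O' (nrm F G))" unfolding is_nrm_def by blast
qed

lemma other_orthogonal_image:
  assumes G: "G facet_of F" and R: "R facet_of G"
  shows "other (O' ` F) (O' ` G) (O' ` R) = O' ` other F G R"
proof (rule other_eqI[OF OF])
  note o = other[OF F G R]
  show "O' ` G facet_of O' ` F" "O' ` R facet_of O' ` G" "O' ` other F G R facet_of O' ` F"
    using G R o(1) facet_of_orthogonal_image by blast+
  show "O' ` R \<subseteq> O' ` other F G R" using facet_of_imp_subset[OF o(2)] by (rule image_mono)
  show "O' ` other F G R \<noteq> O' ` G" using o(3) image_inject by blast
qed

end

lemma vol_orthogonal_image: "polytope F \<Longrightarrow> vol m (O' ` F) = vol m F"
proof (induction m arbitrary: F)
  case (Suc m)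
  note F = Suc.prems
  have "real (Suc m) * vol (Suc m) (O' ` F) = (\<Sum>G | G facet_of F. vol m (O' ` G) * (nrm (O' ` F) (O' ` G) \<bullet> pt (O' ` G)))"
    unfolding vol_Suc sum_facets_orthogonal_image ..
  also have "\<dots> = (\<Sum>G | G facet_of F. vol m G * (nrm F G \<bullet> pt G))"
  proof (rule sum.cong[OF refl])
    fix G assume "G \<in> {G. G facet_of F}"
    then have G: "G facet_of F" by simp
    \<comment> \<open>\<open>pt\<close> is an arbitrary choice and need not commute with
      \<open>O'\<close>, but the height does not depend on the chosen point.\<close>
    have "nrm (O' ` F) (O' ` G) \<bullet> pt (O' ` G) = nrm (O' ` F) (O' ` G) \<bullet> O' (pt G)"
      by (rule nrm_pt[OF polytope_linear_image[OF lin_O F]]) (use G facet_of_orthogonal_image imageI[OF pt_in[OF G]] in auto)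
    then show "vol m (O' ` G) * (nrm (O' ` F) (O' ` G) \<bullet> pt (O' ` G)) = vol m G * (nrm F G \<bullet> pt G)"
      using Suc.IH[OF polytope_facet[OF F G]] by (simp add: nrm_orthogonal_image[OF F G] inner_O)
  qed
  finally have "real (Suc m) * vol (Suc m) (O' ` F) = real (Suc m) * vol (Suc m) F" unfolding vol_Suc .
  then show ?case by (simp only: mult_cancel_left of_nat_eq_0_iff nat.distinct) simp
qed simp

lemma row_orthogonal_image:
  assumes F: "polytope F" and G: "G facet_of F"
  shows "facet_row m (O' ` F) f (O' ` G) = facet_row m F (\<lambda>H. f (O' ` H)) G"
  unfolding facet_row_def sum_facets_orthogonal_image
proof (rule sum.cong[OF refl])
  fix R assume "R \<in> {R. R facet_of G}"
  then have R: "R facet_of G" by simp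
  note o = other[OF F G R] and PG = polytope_facet[OF F G]
  have "res (O' ` F) f (O' ` G) (O' ` R) = res F (\<lambda>H. f (O' ` H)) G R"
    unfolding res_def cs_def sn_def other_orthogonal_image[OF F G R] nrm_orthogonal_image[OF F G]
      nrm_orthogonal_image[OF F o(1)] nrm_orthogonal_image[OF PG R] inner_O ..
  then show "vol m (O' ` R) * res (O' ` F) f (O' ` G) (O' ` R) = vol m R * res F (\<lambda>H. f (O' ` H)) G R"
    using vol_orthogonal_image[OF polytope_facet[OF PG R]] by simp
qed

end

definition indic :: "'b \<Rightarrow> 'b \<Rightarrow> real" where "indic H = (\<lambda>K. if K = H then 1 else 0)"

lemma form_indic_left:
  assumes "polytope F" "G facet_of F" shows "form m F (indic G) f = facet_row m F f G"
  unfolding form_def indic_def using assms by (simp add: if_distrib[of "\<lambda>x. x * _"] cong: if_cong)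

section \<open>Facets and ridges of the polar\<close>

locale centered_polytope =
  fixes P :: "'a::euclidean_space set" and V :: "'a set"
  assumes P: "polytope P" and int0: "0 \<in> interior P" and V_def: "V = {x. x extreme_point_of P}"
begin

lemma finV: "finite V" and hullV: "P = convex hull V" and VP: "V \<subseteq> P"
proof -
  show "finite V" unfolding V_def by (rule finite_polyhedron_extreme_points[OF polytope_imp_polyhedron[OF P]])
  show "P = convex hull V" unfolding V_def
    by (rule Krein_Milman_Minkowski[OF polytope_imp_compact[OF P] polytope_imp_convex[OF P]])
  show "V \<subseteq> P" unfolding V_def by (auto simp: extreme_point_of_def)
qed

lemma V_nonzero: "v \<in> V \<Longrightarrow> v \<noteq> 0"
  using int0 extreme_point_not_in_interior unfolding V_def by blast

definition polar :: "'a set" where "polar = {y. \<forall>v\<in>V. v \<bullet> y \<le> 1}"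
definition pfacet :: "'a \<Rightarrow> 'a set" where "pfacet v = polar \<inter> {y. v \<bullet> y = 1}"

lemma polar_le: "y \<in> polar \<Longrightarrow> x \<in> P \<Longrightarrow> x \<bullet> y \<le> 1"
proof -
  assume y: "y \<in> polar" and x: "x \<in> P"
  have "convex hull V \<subseteq> {x. y \<bullet> x \<le> 1}"
    using y by (intro hull_minimal convex_halfspace_le) (auto simp: polar_def inner_commute)
  then show ?thesis using x hullV by (auto simp: inner_commute)
qed

lemma polytope_polar: "polytope polar"
proof -
  have "polar = \<Inter>((\<lambda>v. {y. v \<bullet> y \<le> 1}) ` V)" by (auto simp: polar_def)
  moreover have "polyhedron (\<Inter>((\<lambda>v. {y. v \<bullet> y \<le> 1}) ` V))"
    using finV by (intro polyhedron_Inter) (auto simp: polyhedron_halfspace_le)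
  ultimately have poly: "polyhedron polar" by simp
  obtain e where e: "e > 0" "cball 0 e \<subseteq> P" using int0 by (auto simp: mem_interior_cball)
  have "norm y \<le> 1 / e" if y: "y \<in> polar" for y
  proof (cases "y = 0")
    case False
    have "(e / norm y) *\<^sub>R y \<in> P" using e False by (intro subsetD[OF e(2)]) simp
    then have "((e / norm y) *\<^sub>R y) \<bullet> y \<le> 1" using polar_le[OF y] by blast
    then have "e * norm y \<le> 1" using False by (simp add: dot_square_norm power2_eq_square)
    then show ?thesis using e(1) by (simp add: field_simps)
  qed (use e in simp)
  then have "bounded polar" by (intro boundedI)
  then show ?thesis using poly polytope_eq_bounded_polyhedron by blast
qed

lemma interior_polar: "0 \<in> interior polar"
proof -
  obtain B where B: "B > 0" "\<And>v. v \<in> V \<Longrightarrow> norm v \<le> B" using finite_imp_bounded[OF finV] by (auto simp: bounded_pos)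
  have "cball 0 (1 / B) \<subseteq> polar"
  proof
    fix y :: 'a assume "y \<in> cball 0 (1 / B)"
    then have y: "norm y \<le> 1 / B" by simp
    have "v \<bullet> y \<le> 1" if "v \<in> V" for v
    proof -
      have "v \<bullet> y \<le> norm v * norm y" by (rule norm_cauchy_schwarz)
      also have "\<dots> \<le> B * (1 / B)" using B y that by (intro mult_mono) auto
      finally show ?thesis using B by simp
    qed
    then show "y \<in> polar" by (simp add: polar_def)
  qed
  then show ?thesis using B(1) by (auto simp: mem_interior_cball intro!: exI[of _ "1 / B"])
qed

lemma dim_polar: "aff_dim polar = int DIM('a)"
  using interior_polar aff_dim_nonempty_interior[of polar] by blast

lemma dir_polar: "dir polar = UNIV"
proof -
  have "polar \<noteq> {}" using interior_polar interior_subset by blast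
  then have "dim (dir polar) = DIM('a)" using dim_dir[of polar] dim_polar by simp
  then show ?thesis using dim_eq_full[of "dir polar"] by (metis subspace_dir span_eq_iff)
qed

text \<open>The inequality of \<open>v\<close> is irredundant in \<open>polar\<close>: an extreme
  point is not in the hull of \<open>0\<close> and the other vertices. Adding \<open>0\<close> to
  that hull makes the separating level \<open>b\<close> negative, so the functional can be divided
  by it.\<close>

lemma separate_vertex:
  assumes v: "v \<in> V"
  obtains y where "v \<bullet> y > 1" "\<And>w. w \<in> V \<Longrightarrow> w \<noteq> v \<Longrightarrow> w \<bullet> y \<le> 1"
proof -
  let ?W = "convex hull (insert 0 (V - {v}))"
  have "0 \<in> P" using int0 interior_subset by blast
  then have "insert 0 (V - {v}) \<subseteq> P" using VP by blast
  then have WP: "?W \<subseteq> P" using polytope_imp_convex[OF P] by (simp add: hull_minimal)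
  have "v \<notin> ?W"
  proof
    assume "v \<in> ?W"
    then have "v extreme_point_of ?W" using v WP unfolding V_def extreme_point_of_def by blast
    then have "v \<in> insert 0 (V - {v})" by (rule extreme_point_of_convex_hull)
    then show False using V_nonzero[OF v] by blast
  qed
  moreover have "closed ?W" using finV by (intro compact_imp_closed finite_imp_compact_convex_hull) simp
  ultimately obtain a b where ab: "a \<bullet> v < b" "\<And>x. x \<in> ?W \<Longrightarrow> b < a \<bullet> x"
    using separating_hyperplane_closed_point[OF convex_convex_hull] by metis
  have b: "b < 0" using ab(2)[of 0] by (simp add: hull_inc)
  have "w \<bullet> (a /\<^sub>R b) \<le> 1" if "w \<in> V" "w \<noteq> v" for w
  proof -
    have "b < a \<bullet> w" using that by (intro ab(2) hull_inc) simp
    then show ?thesis using b by (simp add: inner_commute field_simps)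
  qed
  moreover have "v \<bullet> (a /\<^sub>R b) > 1" using ab(1) b by (simp add: inner_commute field_simps)
  ultimately show ?thesis using that by blast
qed

text \<open>By \<open>separate_vertex\<close> the description of \<open>polar\<close> by halfspaces
  is irredundant. The library theorem indexes facets by halfspaces, so the vertex is recovered
  through the inverse \<open>a\<close> of \<open>H\<close>.\<close>

lemma facets_polar: "C facet_of polar \<longleftrightarrow> (\<exists>v\<in>V. C = pfacet v)"
proof -
  define H where "H = (\<lambda>v::'a. {y. v \<bullet> y \<le> 1})"
  have injH: "inj_on H V"
  proof (rule inj_onI, rule ccontr)
    fix v w assume vw: "v \<in> V" "w \<in> V" "H v = H w" "v \<noteq> w"
    obtain y where "v \<bullet> y > 1" "w \<bullet> y \<le> 1" using separate_vertex[OF vw(1)] vw by metis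
    then have "y \<in> H w" "y \<notin> H v" by (simp_all add: H_def)
    then show False using vw(3) by simp
  qed
  define a where "a = inv_into V H"
  have aH: "a (H v) = v" if "v \<in> V" for v unfolding a_def by (rule inv_into_f_f[OF injH that])
  have "polar \<noteq> {}" "interior polar \<noteq> {}" using interior_polar interior_subset by blast+
  then have aff: "affine hull polar = UNIV" by (intro affine_hull_nonempty_interior)
  have "C facet_of polar \<longleftrightarrow> (\<exists>h. h \<in> H ` V \<and> C = polar \<inter> {x. a h \<bullet> x = 1})"
  proof (rule facet_of_polyhedron_explicit[where b = "\<lambda>_. 1"])
    show "finite (H ` V)" using finV by simp
    show "polar = affine hull polar \<inter> \<Inter> (H ` V)" unfolding aff by (auto simp: polar_def H_def)
    show "a h \<noteq> 0 \<and> h = {x. a h \<bullet> x \<le> 1}" if "h \<in> H ` V" for h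
      using that aH V_nonzero by (auto simp: H_def)
    show "polar \<subset> affine hull polar \<inter> \<Inter> F'" if F': "F' \<subset> H ` V" for F'
    proof -
      obtain v where v: "v \<in> V" "H v \<notin> F'" using F' by blast
      obtain y where y: "v \<bullet> y > 1" "\<And>w. w \<in> V \<Longrightarrow> w \<noteq> v \<Longrightarrow> w \<bullet> y \<le> 1" using separate_vertex[OF v(1)] by blast
      have "y \<in> h" if hF: "h \<in> F'" for h
      proof -
        obtain w where "w \<in> V" "h = H w" using subsetD[OF psubset_imp_subset[OF F'] hF] by blast
        then show ?thesis using y(2)[of w] v(2) hF by (auto simp: H_def)
      qed
      moreover have "y \<notin> polar" using y(1) v(1) by (auto simp: polar_def not_le)
      moreover have "polar \<subseteq> h" if "h \<in> F'" for h using F' that by (auto simp: polar_def H_def)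
      ultimately show ?thesis unfolding aff by blast
    qed
  qed
  then show ?thesis using aH by (auto simp: pfacet_def)
qed

lemma nrm_polar:
  assumes v: "v \<in> V" shows "nrm polar (pfacet v) = v /\<^sub>R norm v"
proof (rule nrm_eqI[OF polytope_polar])
  show "pfacet v facet_of polar" using facets_polar v by blast
  have nz: "norm v > 0" using V_nonzero[OF v] by simp
  have "\<forall>x\<in>polar. (v /\<^sub>R norm v) \<bullet> x \<le> 1 / norm v" using v nz by (auto simp: polar_def field_simps)
  moreover have "pfacet v = polar \<inter> {x. (v /\<^sub>R norm v) \<bullet> x = 1 / norm v}" using nz by (auto simp: pfacet_def field_simps)
  moreover have "norm (v /\<^sub>R norm v) = 1" using nz by simp
  ultimately show "is_nrm polar (pfacet v) (v /\<^sub>R norm v)" unfolding is_nrm_def dir_polar by blast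
qed

lemma inj_pfacet: "inj_on pfacet V"
proof (rule inj_onI)
  fix v w assume v: "v \<in> V" and w: "w \<in> V" and eq: "pfacet v = pfacet w"
  have n: "v /\<^sub>R norm v = w /\<^sub>R norm w" using nrm_polar[OF v] nrm_polar[OF w] eq by simp
  have "pfacet v facet_of polar" using facets_polar v by blast
  then obtain y where "y \<in> pfacet v" using pt_in by blast
  then have y: "v \<bullet> y = 1" "w \<bullet> y = 1" using eq by (auto simp: pfacet_def)
  have "(v /\<^sub>R norm v) \<bullet> y = (w /\<^sub>R norm w) \<bullet> y" using n by simp
  then have "norm v = norm w" using y by simp
  then show "v = w" using n V_nonzero[OF v] V_nonzero[OF w] by simp
qed

lemma facets_polar_image: "{C. C facet_of polar} = pfacet ` V"
  using facets_polar by auto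

lemma pfacet_facet: "v \<in> V \<Longrightarrow> pfacet v facet_of polar"
  using facets_polar by blast

text \<open>A relative interior point \<open>r\<close> of \<open>R\<close> defines a face of
  \<open>P\<close> by \<open>r \<bullet> x = 1\<close>. Each vertex \<open>x\<close> of this face
  yields a facet \<open>pfacet x\<close> through \<open>r\<close>, hence through \<open>R\<close>,
  and only two facets contain \<open>R\<close>.\<close>

lemma ridge_edge:
  assumes v: "v \<in> V" and w: "w \<in> V" and vw: "v \<noteq> w" and R: "R facet_of pfacet v" "R \<subseteq> pfacet w"
  shows "convex hull {v, w} edge_of P"
proof -
  have GG: "pfacet w \<noteq> pfacet v" using inj_pfacet v w vw by (auto dest: inj_onD)
  have "R \<noteq> {}" using R(1) by (auto simp: facet_of_def)
  moreover have "convex R" using polytope_facet[OF polytope_facet[OF polytope_polar pfacet_facet[OF v]] R(1)] polytope_imp_convex by blast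
  ultimately obtain r where r: "r \<in> rel_interior R" using rel_interior_eq_empty by blast
  have rR: "r \<in> R" using r rel_interior_subset by blast
  have rv: "r \<in> pfacet v" "r \<in> pfacet w" using rR R facet_of_imp_subset by blast+
  then have rK: "r \<in> polar" by (simp add: pfacet_def)
  define \<Phi> where "\<Phi> = P \<inter> {x. r \<bullet> x = 1}"
  have face: "\<Phi> face_of P" unfolding \<Phi>_def
    by (rule face_of_Int_supporting_hyperplane_le[OF polytope_imp_convex[OF P]]) (use polar_le[OF rK] in \<open>simp add: inner_commute\<close>)
  have only: "x = v \<or> x = w" if x: "x extreme_point_of \<Phi>" for x
  proof -
    have "x extreme_point_of P" "x \<in> \<Phi>" using x extreme_point_of_face[OF face] by (auto simp: extreme_point_of_def)
    then have xV: "x \<in> V" and "r \<bullet> x = 1" by (simp_all add: V_def \<Phi>_def)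
    then have "r \<in> pfacet x" using rK by (simp add: pfacet_def inner_commute)
    then have "R \<subseteq> pfacet x"
      using subset_of_face_of[OF facet_of_imp_face_of[OF pfacet_facet[OF xV]], of R] r facet_of_imp_subset[OF R(1)] by (auto simp: pfacet_def)
    then have "pfacet x = pfacet v \<or> pfacet x = pfacet w"
      using diamond_unique[OF polytope_polar pfacet_facet[OF v] R(1) pfacet_facet[OF xV] _ _ pfacet_facet[OF w] R(2) GG] by blast
    then show ?thesis using inj_pfacet v w xV by (auto dest: inj_onD)
  qed
  have "compact \<Phi>" "convex \<Phi>" using face face_of_imp_compact polytope_imp_compact[OF P] polytope_imp_convex[OF P] face_of_imp_convex by blast+
  then have "\<Phi> = convex hull {x. x extreme_point_of \<Phi>}" by (rule Krein_Milman_Minkowski)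
  also have "\<dots> \<subseteq> convex hull {v, w}" by (rule hull_mono) (use only in blast)
  finally have 1: "\<Phi> \<subseteq> convex hull {v, w}" .
  have "{v, w} \<subseteq> \<Phi>" using v w VP rv by (auto simp: \<Phi>_def pfacet_def inner_commute)
  then have "convex hull {v, w} \<subseteq> \<Phi>" using \<open>convex \<Phi>\<close> by (simp add: hull_minimal)
  then have "convex hull {v, w} = \<Phi>" using 1 by blast
  moreover have "aff_dim (convex hull {v, w}) = 1" using vw by (simp add: aff_dim_convex_hull aff_dim_2)
  ultimately show ?thesis using face by (simp add: edge_of_def)
qed

lemma orthogonal_image_V:
  assumes O: "orthogonal_transformation O'" and OP: "O' ` P = P"
  shows "O' ` V = V" "O' ` polar = polar" "v \<in> V \<Longrightarrow> O' ` pfacet v = pfacet (O' v)"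
proof -
  have lin: "linear O'" and inj: "inj O'" and inner: "O' x \<bullet> O' y = x \<bullet> y" for x y
    using O orthogonal_transformation_inj by (auto simp: orthogonal_transformation_def)
  have ext: "O' x \<in> V \<longleftrightarrow> x \<in> V" for x
    using face_of_linear_image[OF lin inj, of "{x}" P] OP by (simp add: V_def face_of_singleton)
  show VV: "O' ` V = V"
  proof
    show "V \<subseteq> O' ` V"
    proof
      fix x assume x: "x \<in> V"
      then have "x \<in> O' ` P" using VP OP by blast
      then show "x \<in> O' ` V" using x ext by blast
    qed
  qed (use ext in blast)
  have KO: "O' y \<in> polar \<longleftrightarrow> y \<in> polar" for y
  proof -
    have "O' y \<in> polar \<longleftrightarrow> (\<forall>v\<in>O' ` V. v \<bullet> O' y \<le> 1)" unfolding VV by (simp add: polar_def)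
    then show ?thesis by (simp add: polar_def inner)
  qed
  have surj: "\<exists>y. x = O' y" for x
    using linear_injective_imp_surjective[OF lin inj] by (metis surjD)
  show "O' ` polar = polar"
  proof (intro equalityI subsetI)
    fix z assume z: "z \<in> polar"
    obtain y where "z = O' y" using surj by blast
    then show "z \<in> O' ` polar" using z KO by simp
  qed (use KO in auto)
  show "O' ` pfacet v = pfacet (O' v)" if "v \<in> V"
  proof (intro equalityI subsetI)
    fix z assume "z \<in> O' ` pfacet v"
    then show "z \<in> pfacet (O' v)" using KO by (auto simp: pfacet_def inner)
  next
    fix z assume z: "z \<in> pfacet (O' v)"
    obtain y where "z = O' y" using surj by blast
    then show "z \<in> O' ` pfacet v" using z KO by (auto simp: pfacet_def inner)
  qed
qed

text \<open>The unit normals of \<open>polar\<close> are \<open>v /\<^sub>R norm v\<close>; dividing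
  by the norms turns functionals of the unit normals into functionals of the vertices. A vector with
  vanishing rows is in particular orthogonal to the dilation, which is the constraint in
  \<open>hyperbolic\<close>.\<close>

lemma kernel_matrix_high:
  assumes dim: "DIM('a) = Suc (Suc m)"
  defines "M \<equiv> \<lambda>v w. form m polar (indic (pfacet v)) (indic (pfacet w)) / (norm v * norm w)"
  shows "v \<in> V \<Longrightarrow> w \<in> V \<Longrightarrow> M v w = M w v"
    and "v \<in> V \<Longrightarrow> w \<in> V \<Longrightarrow> v \<noteq> w \<Longrightarrow> \<not> convex hull {v, w} edge_of P \<Longrightarrow> M v w = 0"
    and "(\<forall>v\<in>V. (\<Sum>w\<in>V. M v w * f w) = 0) \<longleftrightarrow> (\<exists>t. \<forall>v\<in>V. f v = v \<bullet> t)"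
    and "orthogonal_transformation O' \<Longrightarrow> O' ` P = P \<Longrightarrow> v \<in> V \<Longrightarrow> w \<in> V \<Longrightarrow> M (O' v) (O' w) = M v w"
proof -
  have dimK: "aff_dim polar = int (Suc (Suc m))" using dim_polar dim by simp
  show "M v w = M w v" if "v \<in> V" "w \<in> V" for v w
    unfolding M_def using form_sym[OF polytope_polar] by (simp add: mult.commute)
  have Mrow: "M v w = facet_row m polar (indic (pfacet w)) (pfacet v) / (norm v * norm w)" if "v \<in> V" for v w
    unfolding M_def form_indic_left[OF polytope_polar pfacet_facet[OF that]] ..
  show "M v w = 0" if v: "v \<in> V" and w: "w \<in> V" and vw: "v \<noteq> w" and ne: "\<not> convex hull {v, w} edge_of P"
  proof -
    have GG: "pfacet v \<noteq> pfacet w" using inj_pfacet v w vw by (auto dest: inj_onD)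
    have "res polar (indic (pfacet w)) (pfacet v) R = 0" if R: "R facet_of pfacet v" for R
    proof -
      note o = other[OF polytope_polar pfacet_facet[OF v] R]
      have "other polar (pfacet v) R \<noteq> pfacet w" using ridge_edge[OF v w vw R] facet_of_imp_subset[OF o(2)] ne by metis
      then show ?thesis using GG by (simp add: res_def indic_def)
    qed
    then have "facet_row m polar (indic (pfacet w)) (pfacet v) = 0" by (simp add: facet_row_def)
    then show ?thesis using Mrow[OF v] by simp
  qed
  show "(\<forall>v\<in>V. (\<Sum>w\<in>V. M v w * f w) = 0) \<longleftrightarrow> (\<exists>t. \<forall>v\<in>V. f v = v \<bullet> t)"
  proof -
    define F where "F = (\<lambda>C. f (inv_into V pfacet C) / norm (inv_into V pfacet C))"
    have F: "F (pfacet v) = f v / norm v" if "v \<in> V" for v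
      using that by (simp add: F_def inv_into_f_f[OF inj_pfacet])
    have sum: "(\<Sum>w\<in>V. M v w * f w) = facet_row m polar F (pfacet v) / norm v" if v: "v \<in> V" for v
    proof -
      have "facet_row m polar F (pfacet v) = (\<Sum>C\<in>pfacet ` V. facet_row m polar (indic C) (pfacet v) * F C)"
        using row_matrix[OF polytope_polar pfacet_facet[OF v], of m F] unfolding facets_polar_image indic_def .
      also have "\<dots> = (\<Sum>w\<in>V. facet_row m polar (indic (pfacet w)) (pfacet v) * (f w / norm w))"
        by (subst sum.reindex[OF inj_pfacet]) (simp add: F)
      finally show ?thesis using Mrow[OF v] by (simp add: sum_divide_distrib mult.commute)
    qed
    have "(\<forall>v\<in>V. (\<Sum>w\<in>V. M v w * f w) = 0) \<longleftrightarrow> (\<forall>C. C facet_of polar \<longrightarrow> facet_row m polar F C = 0)"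
      using sum V_nonzero facets_polar by auto
    also have "\<dots> \<longleftrightarrow> (\<exists>t. \<forall>C. C facet_of polar \<longrightarrow> F C = nrm polar C \<bullet> t)"
    proof
      assume r: "\<forall>C. C facet_of polar \<longrightarrow> facet_row m polar F C = 0"
      then have z: "form m polar g F = 0" for g unfolding form_def by (intro sum.neutral) simp
      have "form m polar F (hgt polar 0) = 0" using z form_sym[OF polytope_polar] by metis
      then have "(\<Sum>C | C facet_of polar. F C * vol (Suc m) C) = 0" unfolding form_hgt[OF polytope_polar dimK] by simp
      then show "\<exists>t. \<forall>C. C facet_of polar \<longrightarrow> F C = nrm polar C \<bullet> t"
        using hyperbolic_polytope[OF polytope_polar dimK] z[of F] unfolding hyperbolic_def by blast
    next
      assume "\<exists>t. \<forall>C. C facet_of polar \<longrightarrow> F C = nrm polar C \<bullet> t"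
      then obtain t where t: "\<And>C. C facet_of polar \<Longrightarrow> F C = lin_val polar t C" by (auto simp: lin_val_def)
      show "\<forall>C. C facet_of polar \<longrightarrow> facet_row m polar F C = 0"
        using row_cong[OF polytope_polar _ t] row_lin[OF polytope_polar dimK] by simp
    qed
    also have "\<dots> \<longleftrightarrow> (\<exists>t. \<forall>v\<in>V. F (pfacet v) = nrm polar (pfacet v) \<bullet> t)"
      unfolding facets_polar by blast
    also have "\<dots> \<longleftrightarrow> (\<exists>t. \<forall>v\<in>V. f v = v \<bullet> t)"
    proof -
      have "F (pfacet v) = nrm polar (pfacet v) \<bullet> t \<longleftrightarrow> f v = v \<bullet> t" if "v \<in> V" for v t
        using F[OF that] nrm_polar[OF that] V_nonzero[OF that] by (simp add: field_simps)
      then show ?thesis by simp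
    qed
    finally show ?thesis .
  qed
  show "M (O' v) (O' w) = M v w" if O: "orthogonal_transformation O'" "O' ` P = P" and v: "v \<in> V" and w: "w \<in> V"
  proof -
    note o = orthogonal_image_V[OF O]
    have inj: "inj O'" using O(1) orthogonal_transformation_inj by blast
    have Ov: "O' v \<in> V" using o(1) v by blast
    have "facet_row m polar (indic (pfacet (O' w))) (pfacet (O' v)) = facet_row m (O' ` polar) (indic (O' ` pfacet w)) (O' ` pfacet v)"
      using o v w by simp
    also have "\<dots> = facet_row m polar (\<lambda>H. indic (O' ` pfacet w) (O' ` H)) (pfacet v)"
      by (rule row_orthogonal_image[OF O(1) polytope_polar pfacet_facet[OF v]])
    also have "(\<lambda>H. indic (O' ` pfacet w) (O' ` H)) = indic (pfacet w)"
      by (simp add: indic_def inj_image_eq_iff[OF inj])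
    finally show ?thesis unfolding Mrow[OF Ov] Mrow[OF v] using O(1) by (simp add: orthogonal_transformation_norm)
  qed
qed

text \<open>Of two distinct vertices on the same side of \<open>0\<close>, the nearer one would lie
  in the open segment from \<open>0\<close> to the other.\<close>

lemma line_vertices:
  assumes dim: "DIM('a) = 1"
  obtains b v w where "norm b = 1" "\<And>x::'a. x = (x \<bullet> b) *\<^sub>R b" "v \<bullet> b > 0" "w \<bullet> b < 0" "V = {v, w}"
proof -
  obtain b :: 'a where B: "Basis = {b}" using dim by (metis card_1_singletonE)
  have "b \<in> Basis" unfolding B by (rule singletonI)
  then have b: "norm b = 1" by (rule norm_Basis)
  have exp: "x = (x \<bullet> b) *\<^sub>R b" for x :: 'a using euclidean_representation[of x] unfolding B by simp
  have P0: "0 \<in> P" using int0 interior_subset by blast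
  have uniq: "x = y" if xy: "x \<in> V" "y \<in> V" "(x \<bullet> b) * (y \<bullet> b) > 0" for x y
  proof -
    have less: "\<not> (x \<bullet> b) / (y \<bullet> b) < 1" if xy: "x \<in> V" "y \<in> V" "(x \<bullet> b) / (y \<bullet> b) > 0" for x y
    proof
      define k where "k = (x \<bullet> b) / (y \<bullet> b)"
      assume "(x \<bullet> b) / (y \<bullet> b) < 1"
      then have k: "0 < k" "k < 1" using xy(3) by (simp_all add: k_def)
      have yb: "y \<bullet> b \<noteq> 0" using xy(3) by auto
      have "x = k *\<^sub>R y" using yb by (subst exp[of x], subst exp[of y]) (simp add: k_def)
      moreover have "y \<noteq> 0" using V_nonzero[OF xy(2)] .
      ultimately have "x \<in> open_segment 0 y" using k by (auto simp: in_segment)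
      moreover have "x extreme_point_of P" "y \<in> P" using xy VP by (auto simp: V_def)
      ultimately show False using P0 by (auto simp: extreme_point_of_def)
    qed
    have nz: "x \<bullet> b \<noteq> 0" "y \<bullet> b \<noteq> 0" using xy(3) by auto
    have pos: "(x \<bullet> b) / (y \<bullet> b) > 0" "(y \<bullet> b) / (x \<bullet> b) > 0" using xy(3) by (auto simp: zero_less_mult_iff zero_less_divide_iff)
    have "\<not> (x \<bullet> b) / (y \<bullet> b) < 1" "\<not> (y \<bullet> b) / (x \<bullet> b) < 1" using less xy(1,2) pos by blast+
    then have "(x \<bullet> b) / (y \<bullet> b) = 1" using pos nz by (auto simp: divide_simps split: if_splits)
    then have "x \<bullet> b = y \<bullet> b" using nz by simp
    then show ?thesis using exp by metis
  qed
  have ex: "\<exists>v\<in>V. v \<bullet> c > 0" if c: "norm c = 1" for c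
  proof (rule ccontr)
    assume "\<not> ?thesis"
    then have "V \<subseteq> {x. c \<bullet> x \<le> 0}" by (auto simp: not_less inner_commute)
    then have sub: "P \<subseteq> {x. c \<bullet> x \<le> 0}" unfolding hullV by (intro hull_minimal convex_halfspace_le)
    obtain e where e: "e > 0" "cball 0 e \<subseteq> P" using int0 by (auto simp: mem_interior_cball)
    then have "e *\<^sub>R c \<in> P" using c by (intro subsetD[OF e(2)]) simp
    then have "e * (c \<bullet> c) \<le> 0" using sub by auto
    then show False using e(1) c by (simp add: dot_square_norm)
  qed
  obtain v where v: "v \<in> V" "v \<bullet> b > 0" using ex[OF b] by blast
  obtain w where w: "w \<in> V" "w \<bullet> b < 0" using ex[of "- b"] b by auto
  have "x = v \<or> x = w" if x: "x \<in> V" for x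
  proof -
    have "x \<bullet> b \<noteq> 0" using V_nonzero[OF x] exp[of x] by auto
    then consider "x \<bullet> b > 0" | "x \<bullet> b < 0" by linarith
    then show ?thesis
    proof cases
      case 1
      then show ?thesis using uniq[OF x v(1)] v(2) by simp
    next
      case 2
      then show ?thesis using uniq[OF x w(1)] w(2) by (simp add: mult_neg_neg)
    qed
  qed
  then have "V = {v, w}" using v w by blast
  then show ?thesis using that[OF b exp v(2) w(2)] by blast
qed

text \<open>A segment has no ridges, so \<open>form\<close> carries no information in dimension one.\<close>

lemma kernel_matrix_line:
  assumes dim: "DIM('a) = 1"
  \<comment> \<open>A matrix of rank one on two vertices has a one-dimensional kernel, as required
    by the one-dimensional space of functionals.\<close>
  defines "M \<equiv> \<lambda>v w. 1 / (norm v * norm w)"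
  shows "v \<in> V \<Longrightarrow> w \<in> V \<Longrightarrow> v \<noteq> w \<Longrightarrow> convex hull {v, w} edge_of P"
    and "(\<forall>v\<in>V. (\<Sum>w\<in>V. M v w * f w) = 0) \<longleftrightarrow> (\<exists>t. \<forall>v\<in>V. f v = v \<bullet> t)"
proof -
  obtain b a c where b: "norm b = 1" "\<And>x::'a. x = (x \<bullet> b) *\<^sub>R b" and a: "a \<bullet> b > 0" and c: "c \<bullet> b < 0" and V: "V = {a, c}"
    using line_vertices[OF dim] by blast
  show "convex hull {v, w} edge_of P" if "v \<in> V" "w \<in> V" "v \<noteq> w"
  proof -
    have "{v, w} = V" using that V by blast
    then have "convex hull {v, w} = P" using hullV by simp
    moreover have "aff_dim (convex hull {v, w}) = 1" using that by (simp add: aff_dim_convex_hull aff_dim_2)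
    ultimately show ?thesis using polytope_imp_convex[OF P] by (simp add: edge_of_def face_of_refl)
  qed
  have nab: "norm a = a \<bullet> b" "norm c = - (c \<bullet> b)"
  proof -
    have "norm x = \<bar>x \<bullet> b\<bar>" for x :: 'a by (subst b(2)) (simp add: b(1))
    then show "norm a = a \<bullet> b" "norm c = - (c \<bullet> b)" using a c by simp_all
  qed
  have ac: "a \<noteq> c" using a c by auto
  have sum: "(\<Sum>w\<in>V. M v w * f w) = (f a / (a \<bullet> b) - f c / (c \<bullet> b)) / norm v" for v
  proof -
    have "(\<Sum>w\<in>V. M v w * f w) = 1 / (norm v * norm a) * f a + 1 / (norm v * norm c) * f c"
      unfolding V M_def using ac by simp
    then show ?thesis unfolding nab by (simp add: diff_divide_distrib mult.commute)
  qed
  have "(\<forall>v\<in>V. (\<Sum>w\<in>V. M v w * f w) = 0) \<longleftrightarrow> f a / (a \<bullet> b) = f c / (c \<bullet> b)"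
    unfolding sum using V V_nonzero by auto
  also have "\<dots> \<longleftrightarrow> (\<exists>t. \<forall>v\<in>V. f v = v \<bullet> t)"
  proof
    assume eq: "f a / (a \<bullet> b) = f c / (c \<bullet> b)"
    have "f v = v \<bullet> ((f a / (a \<bullet> b)) *\<^sub>R b)" if v: "v \<in> V" for v
    proof -
      consider "v = a" | "v = c" using v V by blast
      then show ?thesis
      proof cases
        case 1
        then show ?thesis using a by simp
      next
        case 2
        then show ?thesis unfolding eq using c by simp
      qed
    qed
    then show "\<exists>t. \<forall>v\<in>V. f v = v \<bullet> t" by blast
  next
    assume "\<exists>t. \<forall>v\<in>V. f v = v \<bullet> t"
    then obtain t where t: "f a = a \<bullet> t" "f c = c \<bullet> t" using V by blast
    have x: "x \<bullet> t = (x \<bullet> b) * (b \<bullet> t)" for x by (subst b(2)[of x]) simp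
    show "f a / (a \<bullet> b) = f c / (c \<bullet> b)" unfolding t x[of a] x[of c] using a c by simp
  qed
  finally show "(\<forall>v\<in>V. (\<Sum>w\<in>V. M v w * f w) = 0) \<longleftrightarrow> (\<exists>t. \<forall>v\<in>V. f v = v \<bullet> t)" .
qed

theorem kernel_matrix:
  obtains M :: "'a \<Rightarrow> 'a \<Rightarrow> real"
  where "\<And>v w. v \<in> V \<Longrightarrow> w \<in> V \<Longrightarrow> M v w = M w v"
    and "\<And>v w. v \<in> V \<Longrightarrow> w \<in> V \<Longrightarrow> v \<noteq> w \<Longrightarrow> \<not> convex hull {v, w} edge_of P \<Longrightarrow> M v w = 0"
    and "\<And>f. (\<forall>v\<in>V. (\<Sum>w\<in>V. M v w * f w) = 0) \<longleftrightarrow> (\<exists>t. \<forall>v\<in>V. f v = v \<bullet> t)"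
    and "\<And>O' v w. orthogonal_transformation O' \<Longrightarrow> O' ` P = P \<Longrightarrow> v \<in> V \<Longrightarrow> w \<in> V \<Longrightarrow> M (O' v) (O' w) = M v w"
proof (cases "DIM('a) = 1")
  case True
  show ?thesis
    by (rule that[of "\<lambda>v w. 1 / (norm v * norm w)"])
       (use kernel_matrix_line[OF True] in \<open>auto simp: mult.commute orthogonal_transformation_norm\<close>)
next
  case False
  moreover have "DIM('a) > 0" by simp
  ultimately obtain m where m: "DIM('a) = Suc (Suc m)" by (metis One_nat_def gr0_conv_Suc not0_implies_Suc)
  note k = kernel_matrix_high[OF m]
  show ?thesis by (rule that[OF k(1) k(2) k(3) k(4)])
qed

end

section \<open>Linear automorphisms\<close>

text \<open>A \<open>B\<close>-orthonormal set of maximal size spans the space, since a Gram-Schmidt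
  step would enlarge it otherwise. \<open>S\<close> maps it onto the standard basis.\<close>

lemma inner_product_iso:
  fixes B :: "'a::euclidean_space \<Rightarrow> 'a \<Rightarrow> real"
  assumes lin: "\<And>y. linear (\<lambda>x. B x y)" and sym: "\<And>x y. B x y = B y x"
    and pos: "\<And>x. x \<noteq> 0 \<Longrightarrow> B x x > 0"
  obtains S :: "'a \<Rightarrow> 'a" where "linear S" "bij S" "\<And>x y. S x \<bullet> S y = B x y"
proof -
  define orthonormal where "orthonormal E \<longleftrightarrow> finite E \<and> (\<forall>a\<in>E. \<forall>b\<in>E. B a b = (if a = b then 1 else 0))" for E
  have coord: "B (\<Sum>b\<in>E. c b *\<^sub>R b) a = c a" if E: "orthonormal E" "a \<in> E" for E c a
  proof -
    have "B (\<Sum>b\<in>E. c b *\<^sub>R b) a = (\<Sum>b\<in>E. c b * B b a)"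
      using linear_sum[OF lin[of a], of "\<lambda>b. c b *\<^sub>R b" E] linear_cmul[OF lin[of a]] by simp
    also have "\<dots> = (\<Sum>b\<in>E. if b = a then c b else 0)"
      using E by (intro sum.cong refl) (auto simp: orthonormal_def)
    also have "\<dots> = c a" using E by (simp add: orthonormal_def)
    finally show ?thesis .
  qed
  have indep: "independent E" if E: "orthonormal E" for E
  proof -
    have fin: "finite E" using E by (simp add: orthonormal_def)
    show ?thesis unfolding dependent_finite[OF fin]
    proof clarify
      fix u v assume v: "v \<in> E" "u v \<noteq> 0" and z: "(\<Sum>v\<in>E. u v *\<^sub>R v) = 0"
      show False using coord[OF E v(1), of u] v(2) linear_0[OF lin[of v]] unfolding z by simp
    qed
  qed
  have bound: "card E \<le> DIM('a)" if "orthonormal E" for E using independent_bound[OF indep[OF that]] by simp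
  have "orthonormal {}" by (simp add: orthonormal_def)
  then obtain E where E: "orthonormal E" and max: "\<And>E'. orthonormal E' \<Longrightarrow> card E' \<le> card E"
  proof -
    have "\<exists>E. orthonormal E \<and> (\<forall>E'. orthonormal E' \<longrightarrow> card E' \<le> card E)"
      using \<open>orthonormal {}\<close> bound by (intro ex_has_greatest_nat[where b = "Suc DIM('a)"]) (auto simp: less_Suc_eq_le)
    then show ?thesis using that by blast
  qed
  have fin: "finite E" using E by (simp add: orthonormal_def)
  have rep: "x = (\<Sum>b\<in>E. B x b *\<^sub>R b)" for x
  proof (rule ccontr)
    define y where "y = x - (\<Sum>b\<in>E. B x b *\<^sub>R b)"
    assume "x \<noteq> (\<Sum>b\<in>E. B x b *\<^sub>R b)"
    then have y: "B y y > 0" using pos[of y] by (simp add: y_def)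
    have yE: "B y a = 0" if "a \<in> E" for a
      unfolding y_def using linear_diff[OF lin[of a]] coord[OF E that] by simp
    define n where "n = y /\<^sub>R sqrt (B y y)"
    have nB: "B n z = B y z / sqrt (B y y)" for z unfolding n_def using linear_cmul[OF lin[of z]] by (simp add: divide_inverse mult.commute)
    have "B n n = B y n / sqrt (B y y)" by (rule nB)
    also have "B y n = B n y" by (rule sym)
    also have "B n y = B y y / sqrt (B y y)" by (rule nB)
    finally have nn: "B n n = 1" using y by simp
    have nE: "B n a = 0" "B a n = 0" if "a \<in> E" for a using nB[of a] yE[OF that] sym by simp_all
    have "n \<notin> E" using nE nn by force
    moreover have "orthonormal (insert n E)" using E nn nE by (auto simp: orthonormal_def)
    ultimately show False using max[of "insert n E"] fin by simp
  qed
  have "UNIV \<subseteq> span E"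
  proof
    fix x :: 'a
    have "(\<Sum>b\<in>E. B x b *\<^sub>R b) \<in> span E" by (intro span_sum span_scale span_base)
    then show "x \<in> span E" using rep[of x] by simp
  qed
  then have "card E = DIM('a)" using indep[OF E] dim_eq_card[of E UNIV] dim_UNIV by (metis basis_card_eq_dim subset_UNIV)
  then obtain g where g: "bij_betw g E (Basis :: 'a set)" using finite_same_card_bij[OF fin finite_Basis] by blast
  define S where "S x = (\<Sum>b\<in>E. B x b *\<^sub>R g b)" for x
  have linS: "linear S"
    unfolding S_def using linear_add[OF lin] linear_cmul[OF lin]
    by (intro linearI) (simp_all add: scaleR_add_left sum.distrib scaleR_sum_right)
  have gg: "g a \<bullet> g b = (if a = b then 1 else 0)" if "a \<in> E" "b \<in> E" for a b
    using that g inner_Basis[of "g a" "g b"] bij_betwE[OF g] by (auto simp: bij_betw_def inj_on_def)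
  have inner: "S x \<bullet> S y = B x y" for x y
  proof -
    have "g a \<bullet> S y = B y a" if a: "a \<in> E" for a
    proof -
      have "g a \<bullet> S y = (\<Sum>b\<in>E. B y b * (g a \<bullet> g b))" unfolding S_def by (simp add: inner_sum_right)
      also have "\<dots> = (\<Sum>b\<in>E. if b = a then B y b else 0)" using a by (intro sum.cong refl) (simp add: gg)
      finally show ?thesis using fin a by simp
    qed
    then have "S x \<bullet> S y = (\<Sum>a\<in>E. B x a * B y a)" unfolding S_def[of x] by (simp add: inner_sum_left)
    also have "\<dots> = B x y"
    proof -
      have "B y x = B (\<Sum>b\<in>E. B y b *\<^sub>R b) x" using rep[of y] by simp
      also have "\<dots> = (\<Sum>b\<in>E. B y b * B b x)"
        using linear_sum[OF lin[of x], of "\<lambda>b. B y b *\<^sub>R b" E] linear_cmul[OF lin[of x]] by simp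
      finally show ?thesis using sym by (simp add: mult.commute)
    qed
    finally show ?thesis .
  qed
  have "inj S"
  proof (rule linear_injective_0[OF linS, THEN iffD2], intro allI impI)
    fix x assume "S x = 0"
    then have "B x x = 0" using inner[of x x] by simp
    then show "x = 0" using pos[of x] by fastforce
  qed
  then have "bij S" using linear_injective_imp_surjective[OF linS] by (simp add: bij_def)
  then show ?thesis using that linS inner by blast
qed

definition aut :: "'a::euclidean_space set \<Rightarrow> ('a \<Rightarrow> 'a) set" where
  "aut P = {T. linear T \<and> bij T \<and> T ` P = P}"

lemma extreme_point_linear_image:
  assumes "linear f" "inj f" shows "f x extreme_point_of f ` S \<longleftrightarrow> x extreme_point_of S"
  using face_of_linear_image[OF assms, of "{x}" S] by (simp add: face_of_singleton)

context centered_polytope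
begin

lemma span_V: "span V = UNIV"
proof -
  have "P \<subseteq> span V" unfolding hullV by (rule convex_hull_subset_span)
  then have "interior P \<subseteq> interior (span V)" by (rule interior_mono)
  then have "interior (span V) \<noteq> {}" using int0 by blast
  then show ?thesis using dim_eq_full[of "span V"] by (metis affine_hull_nonempty_interior affine_hull_eq subspace_affine subspace_span)
qed

lemma aut_V: assumes "T \<in> aut P" shows "T x \<in> V \<longleftrightarrow> x \<in> V"
  using extreme_point_linear_image[of T x P] assms bij_is_inj by (auto simp: aut_def V_def)

text \<open>An automorphism permutes the finite set \<open>V\<close>, which spans, and so is
  determined by its restriction to \<open>V\<close>.\<close>

lemma finite_aut: "finite (aut P)"
proof (rule finite_imageD)
  show "finite ((\<lambda>T. restrict T V) ` aut P)"
  proof (rule finite_subset)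
    show "(\<lambda>T. restrict T V) ` aut P \<subseteq> V \<rightarrow>\<^sub>E V" using aut_V by auto
    show "finite (V \<rightarrow>\<^sub>E V)" using finV by (intro finite_PiE) auto
  qed
  show "inj_on (\<lambda>T. restrict T V) (aut P)"
  proof (rule inj_onI)
    fix S T assume S: "S \<in> aut P" and T: "T \<in> aut P" and eq: "restrict S V = restrict T V"
    have "S v = T v" if "v \<in> V" for v using fun_cong[OF eq, of v] that by simp
    then have "S x = T x" if "x \<in> span V" for x
      using S T that by (intro linear_eq_on[of S T x V]) (auto simp: aut_def)
    then show "S = T" using span_V by auto
  qed
qed

lemma aut_comp: "S \<in> aut P \<Longrightarrow> T \<in> aut P \<Longrightarrow> S \<circ> T \<in> aut P"
  unfolding aut_def by (simp only: mem_Collect_eq linear_compose bij_comp image_comp[symmetric])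

lemma bij_betw_aut_comp:
  assumes T: "T \<in> aut P" shows "bij_betw (\<lambda>S. S \<circ> T) (aut P) (aut P)"
proof -
  have "inj_on (\<lambda>S. S \<circ> T) (aut P)"
  proof (rule inj_onI)
    fix S S' assume "S \<circ> T = S' \<circ> T"
    moreover have "surj T" using T by (simp add: aut_def bij_is_surj)
    ultimately show "S = S'" by (metis surj_fun_eq comp_apply fun_eq_iff surjD)
  qed
  moreover have "(\<lambda>S. S \<circ> T) ` aut P \<subseteq> aut P" using aut_comp T by blast
  ultimately show ?thesis using finite_aut by (simp add: bij_betw_def endo_inj_surj)
qed

text \<open>Averaging the inner product over the finite group of linear automorphisms makes that group
  orthogonal after a change of coordinates.\<close>

lemma orthogonalize:
  obtains S :: "'a \<Rightarrow> 'a" where "linear S" "bij S"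
    "\<And>T. T \<in> aut P \<Longrightarrow> orthogonal_transformation (S \<circ> T \<circ> inv_into UNIV S)"
proof -
  define B where "B x y = (\<Sum>T\<in>aut P. T x \<bullet> T y)" for x y
  have lT: "linear T" if "T \<in> aut P" for T using that by (simp add: aut_def)
  have idA: "id \<in> aut P" by (simp add: aut_def linear_id)
  have lin: "linear (\<lambda>x. B x y)" for y
    unfolding B_def
    by (rule linear_compose_sum) (use lT in \<open>auto intro!: linearI simp: linear_add linear_cmul inner_add_left\<close>)
  have pos: "B x x > 0" if "x \<noteq> 0" for x
  proof -
    have "id x \<bullet> id x \<le> B x x" unfolding B_def
      by (rule member_le_sum[OF idA _ finite_aut]) simp
    then show ?thesis using that by (metis id_apply inner_gt_zero_iff order_less_le_trans)
  qed
  have symB: "B x y = B y x" for x y by (simp add: B_def inner_commute)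
  have "\<exists>S :: 'a \<Rightarrow> 'a. linear S \<and> bij S \<and> (\<forall>x y. S x \<bullet> S y = B x y)"
    by (rule inner_product_iso[of B, OF lin symB pos]) blast+
  then obtain S :: "'a \<Rightarrow> 'a" where S: "linear S" "bij S" "\<And>x y. S x \<bullet> S y = B x y" by blast
  have "orthogonal_transformation (S \<circ> T \<circ> inv_into UNIV S)" if T: "T \<in> aut P" for T
    unfolding orthogonal_transformation_def
  proof (intro conjI allI)
    show "linear (S \<circ> T \<circ> inv_into UNIV S)"
      using S lT[OF T] by (intro linear_compose inj_linear_imp_inv_linear bij_is_inj)
    fix x y
    have inv: "B (T x) (T y) = B x y" for x y
      unfolding B_def using sum.reindex_bij_betw[OF bij_betw_aut_comp[OF T], of "\<lambda>S. S x \<bullet> S y"] by simp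
    show "(S \<circ> T \<circ> inv_into UNIV S) x \<bullet> (S \<circ> T \<circ> inv_into UNIV S) y = x \<bullet> y"
      using S(3) inv bij_inv_eq_iff[OF S(2)] by (simp add: S(3)[symmetric] surj_f_inv_f[OF bij_is_surj[OF S(2)]])
  qed
  then show ?thesis using that S by blast
qed

theorem invariant_kernel_matrix:
  obtains M :: "'a \<Rightarrow> 'a \<Rightarrow> real"
  where "\<And>v w. v \<in> V \<Longrightarrow> w \<in> V \<Longrightarrow> M v w = M w v"
    and "\<And>v w. v \<in> V \<Longrightarrow> w \<in> V \<Longrightarrow> v \<noteq> w \<Longrightarrow> \<not> convex hull {v, w} edge_of P \<Longrightarrow> M v w = 0"
    and "\<And>f. (\<forall>v\<in>V. (\<Sum>w\<in>V. M v w * f w) = 0) \<longleftrightarrow> (\<exists>t. \<forall>v\<in>V. f v = v \<bullet> t)"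
    and "\<And>T v w. T \<in> aut P \<Longrightarrow> v \<in> V \<Longrightarrow> w \<in> V \<Longrightarrow> M (T v) (T w) = M v w"
proof -
  obtain S :: "'a \<Rightarrow> 'a" where S: "linear S" "bij S"
    and orth: "\<And>T. T \<in> aut P \<Longrightarrow> orthogonal_transformation (S \<circ> T \<circ> inv_into UNIV S)" using orthogonalize by blast
  have inj: "inj S" using S bij_is_inj by blast
  have inv: "inv_into UNIV S (S x) = x" for x by (rule inv_f_f[OF inj])
  have injV: "inj_on S V" using inj inj_on_subset by blast
  have SV: "S ` V = {x. x extreme_point_of S ` P}"
  proof (intro Set.set_eqI iffI)
    fix x assume "x \<in> {x. x extreme_point_of S ` P}"
    then have x: "x extreme_point_of S ` P" by simp
    then obtain y where "x = S y" by (auto simp: extreme_point_of_def)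
    then show "x \<in> S ` V" using x extreme_point_linear_image[OF S(1) inj] by (auto simp: V_def)
  qed (auto simp: V_def extreme_point_linear_image[OF S(1) inj])
  interpret S: centered_polytope "S ` P" "S ` V"
  proof
    show "polytope (S ` P)" by (rule polytope_linear_image[OF S(1) P])
    have "S 0 \<in> S ` interior P" using int0 by blast
    then show "0 \<in> interior (S ` P)"
      using interior_injective_linear_image[OF S(1) inj] linear_0[OF S(1)] by simp
    show "S ` V = {x. x extreme_point_of S ` P}" by (rule SV)
  qed
  obtain M where M: "\<And>v w. v \<in> S ` V \<Longrightarrow> w \<in> S ` V \<Longrightarrow> M v w = M w v"
    "\<And>v w. v \<in> S ` V \<Longrightarrow> w \<in> S ` V \<Longrightarrow> v \<noteq> w \<Longrightarrow> \<not> convex hull {v, w} edge_of S ` P \<Longrightarrow> M v w = 0"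
    "\<And>f. (\<forall>v\<in>S ` V. (\<Sum>w\<in>S ` V. M v w * f w) = 0) \<longleftrightarrow> (\<exists>t. \<forall>v\<in>S ` V. f v = v \<bullet> t)"
    "\<And>O' v w. orthogonal_transformation O' \<Longrightarrow> O' ` S ` P = S ` P \<Longrightarrow> v \<in> S ` V \<Longrightarrow> w \<in> S ` V \<Longrightarrow> M (O' v) (O' w) = M v w"
    by (rule S.kernel_matrix, rule that)
  show ?thesis
  proof (rule that[of "\<lambda>v w. M (S v) (S w)"])
    show "M (S v) (S w) = M (S w) (S v)" if "v \<in> V" "w \<in> V" for v w using M(1) that by blast
    show "M (S v) (S w) = 0" if vw: "v \<in> V" "w \<in> V" "v \<noteq> w" and ne: "\<not> convex hull {v, w} edge_of P" for v w
    proof -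
      have "convex hull {S v, S w} = S ` (convex hull {v, w})"
        using convex_hull_linear_image[OF S(1), of "{v, w}"] by simp
      then have "\<not> convex hull {S v, S w} edge_of S ` P"
        using ne by (simp add: edge_of_def face_of_linear_image[OF S(1) inj] S(1) inj)
      then show ?thesis using M(2)[of "S v" "S w"] vw injD[OF inj] by blast
    qed
    show "(\<forall>v\<in>V. (\<Sum>w\<in>V. M (S v) (S w) * f w) = 0) \<longleftrightarrow> (\<exists>t. \<forall>v\<in>V. f v = v \<bullet> t)" for f
    proof -
      have "(\<forall>v\<in>V. (\<Sum>w\<in>V. M (S v) (S w) * f w) = 0) \<longleftrightarrow> (\<forall>v\<in>S ` V. (\<Sum>w\<in>S ` V. M v w * f (inv_into UNIV S w)) = 0)"
        by (simp add: sum.reindex[OF injV] inv)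
      also have "\<dots> \<longleftrightarrow> (\<exists>t. \<forall>v\<in>V. f v = S v \<bullet> t)" using M(3)[of "\<lambda>w. f (inv_into UNIV S w)"] by (simp add: inv)
      also have "\<dots> \<longleftrightarrow> (\<exists>t. \<forall>v\<in>V. f v = v \<bullet> t)"
      proof
        assume "\<exists>t. \<forall>v\<in>V. f v = S v \<bullet> t"
        then obtain t where "\<forall>v\<in>V. f v = S v \<bullet> t" by blast
        then have "\<forall>v\<in>V. f v = v \<bullet> adjoint S t" by (simp add: adjoint_works[OF S(1)])
        then show "\<exists>t. \<forall>v\<in>V. f v = v \<bullet> t" by blast
      next
        assume "\<exists>t. \<forall>v\<in>V. f v = v \<bullet> t"
        then obtain t where t: "\<forall>v\<in>V. f v = v \<bullet> t" by blast
        have li: "linear (inv_into UNIV S)" by (rule inj_linear_imp_inv_linear[OF S(1) inj])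
        have "v \<bullet> t = S v \<bullet> adjoint (inv_into UNIV S) t" for v using adjoint_works[OF li, of "S v" t] by (simp add: inv)
        then show "\<exists>t. \<forall>v\<in>V. f v = S v \<bullet> t" using t by metis
      qed
      finally show ?thesis .
    qed
    show "M (S (T v)) (S (T w)) = M (S v) (S w)" if T: "T \<in> aut P" and vw: "v \<in> V" "w \<in> V" for T v w
    proof -
      have "T ` P = P" using T by (simp add: aut_def)
      then have "(S \<circ> T \<circ> inv_into UNIV S) ` S ` P = S ` P" by (simp add: image_comp[symmetric] image_image inv) (metis image_image)
      from M(4)[OF orth[OF T] this, of "S v" "S w"] show ?thesis using vw by (simp add: inv)
    qed
  qed
qed

text \<open>Each coordinate of \<open>\<pi>\<close>, as a function on \<open>V\<close>, is a kernel
  vector, because \<open>\<pi>\<close> preserves the matrix; hence it is a functional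
  \<open>t b\<close>. These functionals assemble into \<open>T\<close>, which is bijective since its
  image contains the spanning set \<open>V\<close>.\<close>

lemma linear_extension:
  assumes ker: "\<And>f. (\<forall>v\<in>V. (\<Sum>w\<in>V. M v w * f w) = 0) \<longleftrightarrow> (\<exists>t. \<forall>v\<in>V. f v = v \<bullet> t)"
    and \<pi>: "bij_betw \<pi> V V" and inv: "\<And>v w. v \<in> V \<Longrightarrow> w \<in> V \<Longrightarrow> M (\<pi> v) (\<pi> w) = M v w"
  obtains T where "T \<in> aut P" "\<And>v. v \<in> V \<Longrightarrow> T v = \<pi> v"
proof -
  have "\<exists>t. \<forall>v\<in>V. \<pi> v \<bullet> b = v \<bullet> t" for b
  proof -
    have b: "\<forall>v\<in>V. (\<Sum>w\<in>V. M v w * (w \<bullet> b)) = 0" using ker[of "\<lambda>w. w \<bullet> b"] by blast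
    have "(\<Sum>w\<in>V. M v w * (\<pi> w \<bullet> b)) = 0" if v: "v \<in> V" for v
    proof -
      have "(\<Sum>w\<in>V. M v w * (\<pi> w \<bullet> b)) = (\<Sum>w\<in>V. M (\<pi> v) (\<pi> w) * (\<pi> w \<bullet> b))"
        using inv v by simp
      also have "\<dots> = (\<Sum>w\<in>V. M (\<pi> v) w * (w \<bullet> b))" by (rule sum.reindex_bij_betw[OF \<pi>])
      also have "\<dots> = 0" using b bij_betwE[OF \<pi>] v by blast
      finally show ?thesis .
    qed
    then show ?thesis using ker[of "\<lambda>w. \<pi> w \<bullet> b"] by blast
  qed
  then obtain t where t: "\<And>b v. v \<in> V \<Longrightarrow> \<pi> v \<bullet> b = v \<bullet> t b" by metis
  define T where "T x = (\<Sum>b\<in>Basis. (x \<bullet> t b) *\<^sub>R b)" for x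
  have lin: "linear T" unfolding T_def by (intro linearI) (simp_all add: inner_add_left scaleR_add_left sum.distrib scaleR_sum_right)
  have T: "T v = \<pi> v" if "v \<in> V" for v
    using euclidean_representation[of "\<pi> v"] by (simp add: T_def t[OF that, symmetric])
  have TV: "T ` V = V" using T \<pi> by (simp add: bij_betw_def cong: image_cong)
  then have TP: "T ` P = P" unfolding hullV using convex_hull_linear_image[OF lin] by simp
  have "T ` UNIV = UNIV" using linear_span_image[OF lin, of V] TV span_V by simp
  then have "bij T" using linear_surjective_imp_injective[OF lin] by (simp add: bij_def)
  then show ?thesis using that[of T] T lin TP by (simp add: aut_def)
qed

end

section \<open>The orbit coloring\<close>

lemma aut_eq_carrier: "aut P = carrier (Aut_GL P)"
  by (simp add: aut_def Aut_GL_def)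

lemma edge_graph_edge_iff:
  assumes "i \<in> {1..n}" "j \<in> {1..n}"
  shows "{i, j} \<in> snd (edge_graph P v n) \<longleftrightarrow> convex hull {v i, v j} edge_of P"
proof
  assume "{i, j} \<in> snd (edge_graph P v n)"
  then obtain k l where "{i, j} = {k, l}" "convex hull {v k, v l} edge_of P"
    unfolding edge_graph_def by auto
  moreover then have "{v i, v j} = {v k, v l}" by (metis image_insert image_empty)
  ultimately show "convex hull {v i, v j} edge_of P" by simp
qed (use assms in \<open>auto simp: edge_graph_def\<close>)

lemma vertex_perm_outside: "i \<notin> {1..n} \<Longrightarrow> vertex_perm v n T i = i"
  by (simp only: vertex_perm_def if_False)

lemma edge_of_linear_image:
  assumes "linear T" "inj T" shows "T ` e edge_of T ` P \<longleftrightarrow> e edge_of P"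
  by (simp add: edge_of_def face_of_linear_image assms)

context
  fixes P :: "(real ^ 'd) set" and v :: "nat \<Rightarrow> real ^ 'd" and n :: nat and c :: "(nat, 'c) coloring"
  \<comment> \<open>This keeps the simplifier from rewriting \<open>{1..n}\<close> to
    \<open>{Suc 0..n}\<close>.\<close>
  notes [simp del] = One_nat_def
  assumes poly: "polytope P" and int0: "0 \<in> interior P"
    and v: "bij_betw v {1..n} {x. x extreme_point_of P}" and orb: "is_orbit_coloring P v n c"
begin

interpretation centered_polytope P "{x. x extreme_point_of P}"
  by unfold_locales (use poly int0 in auto)

lemma inj_v: "i \<in> {1..n} \<Longrightarrow> j \<in> {1..n} \<Longrightarrow> v i = v j \<longleftrightarrow> i = j"
  using bij_betw_imp_inj_on[OF v] by (simp only: inj_on_eq_iff)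

lemma v_extreme: "i \<in> {1..n} \<Longrightarrow> v i \<in> {x. x extreme_point_of P}"
  using bij_betwE[OF v] by (rule bspec)

lemma extremeE:
  assumes "x \<in> {x. x extreme_point_of P}"
  obtains i where "i \<in> {1..n}" "x = v i"
proof -
  have "x \<in> v ` {1..n}" unfolding bij_betw_imp_surj_on[OF v] by (rule assms)
  then show ?thesis by (rule imageE) (rule that)
qed

lemma vertex_perm_permutes:
  assumes T: "T \<in> carrier (Aut_GL P)" shows "vertex_perm v n T permutes {1..n}"
proof (rule bij_imp_permutes)
  have "inj T" using T by (simp add: Aut_GL_def bij_is_inj)
  have "inj_on (vertex_perm v n T) {1..n}"
  proof (rule inj_onI)
    fix i j assume i: "i \<in> {1..n}" and j: "j \<in> {1..n}" and "vertex_perm v n T i = vertex_perm v n T j"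
    then have "T (v i) = T (v j)" using vertex_perm_eq(2)[OF v T] by metis
    then have "v i = v j" by (rule injD[OF \<open>inj T\<close>])
    then show "i = j" using inj_v[OF i j] by blast
  qed
  moreover have "vertex_perm v n T ` {1..n} \<subseteq> {1..n}" using vertex_perm_eq(1)[OF v T] by blast
  ultimately show "bij_betw (vertex_perm v n T) {1..n} {1..n}"
    unfolding bij_betw_def using endo_inj_surj[OF finite_atLeastAtMost] by blast
qed (rule vertex_perm_outside)

lemma vertex_perm_colored:
  assumes T: "T \<in> carrier (Aut_GL P)"
  shows "vertex_perm v n T \<in> carrier (colored_graph_Aut (edge_graph P v n) c)"
proof -
  let ?\<sigma> = "vertex_perm v n T" and ?E = "edge_graph P v n"
  have V: "fst ?E = {1..n}" by (simp add: edge_graph_def)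
  have lin: "linear T" and inj: "inj T" and TP: "T ` P = P" using T by (auto simp: Aut_GL_def bij_is_inj)
  note s = vertex_perm_eq[OF v T]
  have edge: "{i, j} \<in> snd ?E \<longleftrightarrow> {?\<sigma> i, ?\<sigma> j} \<in> snd ?E" if "i \<in> {1..n}" "j \<in> {1..n}" for i j
  proof -
    have "convex hull {v (?\<sigma> i), v (?\<sigma> j)} = T ` (convex hull {v i, v j})"
      using convex_hull_linear_image[OF lin, of "{v i, v j}"] s(2)[OF that(1)] s(2)[OF that(2)] by simp
    then show ?thesis
      using edge_of_linear_image[OF lin inj, of _ P] TP
      by (simp only: edge_graph_edge_iff[OF that] edge_graph_edge_iff[OF s(1)[OF that(1)] s(1)[OF that(2)]])
  qed
  have vert: "c (Inl i) = c (Inl (?\<sigma> i))" if i: "i \<in> {1..n}" for i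
  proof -
    have "v (?\<sigma> i) \<in> orbit (Aut_GL P) (\<lambda>T. T) (v i)"
      unfolding orbit_def mem_Collect_eq using s(2)[OF i] T by (intro exI[of _ T] conjI) (simp only:)
    then show ?thesis using orb i s(1)[OF i] unfolding is_orbit_coloring_def V by blast
  qed
  have ecol: "c (Inr e) = c (Inr (?\<sigma> ` e))" if e: "e \<in> snd ?E" for e
  proof -
    obtain i j where ij: "e = {i, j}" "i \<in> {1..n}" "j \<in> {1..n}" using e unfolding edge_graph_def by auto
    have "v ` ?\<sigma> ` e = T ` v ` e" using ij s(2) by simp
    then have "convex hull (v ` ?\<sigma> ` e) = T ` (convex hull (v ` e))" by (simp add: convex_hull_linear_image[OF lin])
    then have "convex hull (v ` ?\<sigma> ` e) \<in> orbit (Aut_GL P) (`) (convex hull (v ` e))"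
      unfolding orbit_def using T by blast
    moreover have "?\<sigma> ` e \<in> snd ?E" using edge[OF ij(2,3)] e ij(1) by simp
    ultimately show ?thesis using orb e unfolding is_orbit_coloring_def by blast
  qed
  show ?thesis
    unfolding colored_graph_Aut_iff V using vertex_perm_permutes[OF T] edge vert ecol by blast
qed

lemma vertex_perm_comp:
  assumes S: "S \<in> carrier (Aut_GL P)" and T: "T \<in> carrier (Aut_GL P)"
  shows "vertex_perm v n (S \<circ> T) = vertex_perm v n S \<circ> vertex_perm v n T"
proof (rule ext)
  fix i
  have ST: "S \<circ> T \<in> carrier (Aut_GL P)" using aut_comp[of S T] S T by (simp only: aut_eq_carrier)
  show "vertex_perm v n (S \<circ> T) i = (vertex_perm v n S \<circ> vertex_perm v n T) i"
  proof (cases "i \<in> {1..n}")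
    case True
    note s = vertex_perm_eq[OF v S] and t = vertex_perm_eq[OF v T] and st = vertex_perm_eq[OF v ST]
    have "v (vertex_perm v n (S \<circ> T) i) = v (vertex_perm v n S (vertex_perm v n T i))"
      using st(2)[OF True] t(2)[OF True] s(2)[OF t(1)[OF True]] by simp
    then show ?thesis using inj_v[OF st(1)[OF True] s(1)[OF t(1)[OF True]]] by simp
  qed (simp only: vertex_perm_outside comp_apply not_False_eq_True)
qed

lemma vertex_perm_inj: "inj_on (vertex_perm v n) (carrier (Aut_GL P))"
proof (rule inj_onI)
  fix S T assume S: "S \<in> carrier (Aut_GL P)" and T: "T \<in> carrier (Aut_GL P)"
    and eq: "vertex_perm v n S = vertex_perm v n T"
  have "S x = T x" if x: "x \<in> {x. x extreme_point_of P}" for x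
  proof -
    obtain i where "i \<in> {1..n}" "x = v i" by (rule extremeE[OF x])
    then show ?thesis using vertex_perm_eq(2)[OF v S] vertex_perm_eq(2)[OF v T] eq by metis
  qed
  moreover have "linear S" "linear T" using S T by (simp_all add: Aut_GL_def)
  ultimately have "S x = T x" if "x \<in> span {x. x extreme_point_of P}" for x
    using that by (intro linear_eq_on[of S T x]) auto
  then show "S = T" using span_V by auto
qed

text \<open>The color of a vertex or an edge yields some automorphism with the desired effect on it,
  possibly a different one each time. Invariance of \<open>M\<close> turns each into an equality of
  entries, and \<open>linear_extension\<close> produces one automorphism from all of them.\<close>

lemma vertex_perm_surj:
  assumes \<sigma>: "\<sigma> \<in> carrier (colored_graph_Aut (edge_graph P v n) c)"
  shows "\<exists>T\<in>carrier (Aut_GL P). vertex_perm v n T = \<sigma>"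
proof -
  let ?V = "{x. x extreme_point_of P}" and ?E = "edge_graph P v n"
  have V: "fst ?E = {1..n}" by (simp add: edge_graph_def)
  have perm: "\<sigma> permutes {1..n}"
    and edge: "\<And>i j. i \<in> {1..n} \<Longrightarrow> j \<in> {1..n} \<Longrightarrow> {i, j} \<in> snd ?E \<longleftrightarrow> {\<sigma> i, \<sigma> j} \<in> snd ?E"
    and vert: "\<And>i. i \<in> {1..n} \<Longrightarrow> c (Inl i) = c (Inl (\<sigma> i))"
    and ecol: "\<And>e. e \<in> snd ?E \<Longrightarrow> c (Inr e) = c (Inr (\<sigma> ` e))"
    using \<sigma> unfolding colored_graph_Aut_iff V by blast+
  have \<sigma>n: "\<sigma> i \<in> {1..n}" if "i \<in> {1..n}" for i using permutes_in_image[OF perm] that by blast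
  note vV = v_extreme
  obtain M where sym: "\<And>x y. x \<in> ?V \<Longrightarrow> y \<in> ?V \<Longrightarrow> M x y = M y x"
    and nonedge: "\<And>x y. x \<in> ?V \<Longrightarrow> y \<in> ?V \<Longrightarrow> x \<noteq> y \<Longrightarrow> \<not> convex hull {x, y} edge_of P \<Longrightarrow> M x y = 0"
    and ker: "\<And>f. (\<forall>x\<in>?V. (\<Sum>y\<in>?V. M x y * f y) = 0) \<longleftrightarrow> (\<exists>t. \<forall>x\<in>?V. f x = x \<bullet> t)"
    and inv: "\<And>T x y. T \<in> aut P \<Longrightarrow> x \<in> ?V \<Longrightarrow> y \<in> ?V \<Longrightarrow> M (T x) (T y) = M x y"
    by (rule invariant_kernel_matrix, rule that)
  have M\<sigma>: "M (v (\<sigma> i)) (v (\<sigma> j)) = M (v i) (v j)" if i: "i \<in> {1..n}" and j: "j \<in> {1..n}" for i j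
  proof -
    consider "i = j" | "{i, j} \<in> snd ?E" | "i \<noteq> j" "{i, j} \<notin> snd ?E" by blast
    then show ?thesis
    proof cases
      case 1
      have "v (\<sigma> i) \<in> orbit (Aut_GL P) (\<lambda>T. T) (v i)"
        using orb vert[OF i] i \<sigma>n[OF i] unfolding is_orbit_coloring_def V by blast
      then obtain T where "T \<in> carrier (Aut_GL P)" "v (\<sigma> i) = T (v i)" by (auto simp: orbit_def)
      then show ?thesis using inv[of T "v i" "v i"] vV[OF i] 1 by (simp add: aut_eq_carrier)
    next
      case 2
      have "\<sigma> ` {i, j} \<in> snd ?E" using edge[OF i j] 2 by simp
      then have "convex hull (v ` \<sigma> ` {i, j}) \<in> orbit (Aut_GL P) (`) (convex hull (v ` {i, j}))"
        using orb ecol[OF 2] 2 unfolding is_orbit_coloring_def by blast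
      then obtain T where T: "T \<in> carrier (Aut_GL P)" "convex hull (v ` \<sigma> ` {i, j}) = T ` (convex hull (v ` {i, j}))"
        by (auto simp: orbit_def)
      then have "convex hull {v (\<sigma> i), v (\<sigma> j)} = convex hull {T (v i), T (v j)}"
        by (simp add: convex_hull_linear_image Aut_GL_def)
      \<comment> \<open>Equal segments have equal sets of end points. \<open>T\<close> may exchange
        the ends, which the symmetry of \<open>M\<close> absorbs.\<close>
      then have "x = v (\<sigma> i) \<or> x = v (\<sigma> j) \<longleftrightarrow> x = T (v i) \<or> x = T (v j)" for x
        by (metis extreme_point_of_convex_hull_2)
      then have "v (\<sigma> i) = T (v i) \<and> v (\<sigma> j) = T (v j) \<or> v (\<sigma> i) = T (v j) \<and> v (\<sigma> j) = T (v i)" by metis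
      then show ?thesis
        using inv[of T "v i" "v j"] inv[of T "v j" "v i"] sym[OF vV[OF i] vV[OF j]] vV[OF i] vV[OF j] T(1)
        unfolding aut_eq_carrier by auto
    next
      case 3
      have "\<sigma> i \<noteq> \<sigma> j" using 3 permutes_inj[OF perm] by (auto dest: injD)
      then show ?thesis
        using 3 nonedge vV i j \<sigma>n edge[OF i j] edge_graph_edge_iff[OF i j] edge_graph_edge_iff[OF \<sigma>n[OF i] \<sigma>n[OF j]]
          inj_v[OF i j] inj_v[OF \<sigma>n[OF i] \<sigma>n[OF j]] by metis
    qed
  qed
  define u where "u = inv_into {1..n} v"
  have u: "bij_betw u ?V {1..n}" unfolding u_def by (rule bij_betw_inv_into[OF v])
  have uv: "u (v i) = i" if "i \<in> {1..n}" for i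
    unfolding u_def by (rule inv_into_f_f[OF bij_betw_imp_inj_on[OF v] that])
  have "bij_betw (v \<circ> (\<sigma> \<circ> u)) ?V ?V"
    using bij_betw_trans[OF bij_betw_trans[OF u permutes_imp_bij[OF perm]] v] .
  moreover have "M ((v \<circ> (\<sigma> \<circ> u)) x) ((v \<circ> (\<sigma> \<circ> u)) y) = M x y" if x: "x \<in> ?V" and y: "y \<in> ?V" for x y
  proof -
    obtain i where i: "i \<in> {1..n}" "x = v i" by (rule extremeE[OF x])
    obtain j where j: "j \<in> {1..n}" "y = v j" by (rule extremeE[OF y])
    show ?thesis unfolding i(2) j(2) comp_apply uv[OF i(1)] uv[OF j(1)] by (rule M\<sigma>[OF i(1) j(1)])
  qed
  ultimately obtain T where T: "T \<in> aut P" "\<And>x. x \<in> ?V \<Longrightarrow> T x = (v \<circ> (\<sigma> \<circ> u)) x"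
    using linear_extension[OF ker] by blast
  have TC: "T \<in> carrier (Aut_GL P)" using T(1) by (simp add: aut_eq_carrier)
  have "vertex_perm v n T i = \<sigma> i" for i
  proof (cases "i \<in> {1..n}")
    case True
    have "v (vertex_perm v n T i) = v (\<sigma> i)"
      using vertex_perm_eq(2)[OF v TC True] T(2)[OF vV[OF True]] uv[OF True] by simp
    then show ?thesis using inj_v[OF vertex_perm_eq(1)[OF v TC True] \<sigma>n[OF True]] by blast
  next
    case False
    then have "\<sigma> i = i" by (rule permutes_not_in[OF perm])
    then show ?thesis using vertex_perm_outside[OF False] by (simp only:)
  qed
  then show ?thesis using TC by (intro bexI[of _ T]) auto
qed

end

theorem corollary4p8:
  fixes P :: "(real ^ 'd) set" and v :: "nat \<Rightarrow> real ^ 'd" and n :: nat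
    and \<oo> :: "(nat, 'c) coloring"
  assumes "polytope P"
    and "affine hull P = UNIV"
    and "0 \<in> interior P"
    and "bij_betw v {1..n} {x. x extreme_point_of P}"
    and "is_orbit_coloring P v n \<oo>"
  shows "captures_linear_symmetries P v n \<oo>"
proof -
  note hyps = assms(1,3,4,5)
  let ?H = "colored_graph_Aut (edge_graph P v n) \<oo>"
  have col: "\<forall>T\<in>carrier (Aut_GL P). vertex_perm v n T \<in> carrier ?H"
    using vertex_perm_colored[OF hyps] by blast
  have "vertex_perm v n \<in> hom (Aut_GL P) ?H"
    unfolding hom_def colored_graph_Aut_ops
    using col vertex_perm_comp[OF hyps] by (simp add: Aut_GL_def)
  moreover have "bij_betw (vertex_perm v n) (carrier (Aut_GL P)) (carrier ?H)"
    unfolding bij_betw_def using vertex_perm_inj[OF hyps] col vertex_perm_surj[OF hyps] by blast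
  ultimately show ?thesis unfolding captures_linear_symmetries_def iso_def using col by blast
qed

end
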